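(* Let $L$ be a centreless Lie $\Lambda$-torus of type $\Delta$ and let $L'$ be a centreless Lie $\Lambda'$-torus of type $\Delta'$. Suppose that $L$ is isotopic to $L'$. Then there is a bijection $(D,\tau)\mapsto(D',\tau')$ from $\mathcal P(L)$ onto $\mathcal P(L')$ such that $E(L,D,\tau)$ is isomorphic as an EALA to $E(L',D',\tau')$ for all $(D,\tau)\in\mathcal P(L)$.
   Context: **Conventions.** $F$ is a field of characteristic $0$; all algebras are over $F$. $\Lambda,\Lambda'$ are finitely generated free abelian groups. A finite irreducible root system $\Delta$ is a finite subset, containing $0$, of a finite dimensional $F$-vector space such that $\Delta^\times=\Delta\setminus\{0\}$ is a finite irreducible root system in the usual (Bourbaki) sense, possibly non-reduced. $Q(\Delta)=\mathrm{span}_{\mathbb Z}(\Delta)$ and $\Delta_{\mathrm{ind}}=\{0\}\cup\{\alpha\in\Delta^\times : \tfrac12\alpha\notin\Delta\}$. $\mathrm{Hom}(\cdot,\cdot)$ denotes group homomorphisms. **Lie tori.** Let $Q=Q(\Delta)$. A Lie $\Lambda$-torus of type $\Delta$ is a $Q\times\Lambda$-graded Lie algebra $L=\bigoplus_{(\alpha,\lambda)\in Q\times\Lambda}L_\alpha^\lambda$ such that, with $L_\alpha=\bigoplus_\lambda L_\alpha^\lambda$ and $L^\lambda=\bigoplus_\alpha L_\alpha^\lambda$: (LT1) $L_\alpha=0$ for $\alpha\in Q\setminus\Delta$; (LT2)(i) $L_\alpha^0\neq0$ for $0\ne\alpha\in\Delta_{\mathrm{ind}}$; (ii) if $0\neq\alpha\in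 Q$, $\lambda\in\Lambda$ and $L_\alpha^\lambda\ne0$, there are $e_\alpha^\lambda\in L_\alpha^\lambda$, $f_\alpha^\lambda\in L_{-\alpha}^{-\lambda}$ with $L_\alpha^\lambda=Fe_\alpha^\lambda$, $L_{-\alpha}^{-\lambda}=Ff_\alpha^\lambda$ and $[[e_\alpha^\lambda,f_\alpha^\lambda],x_\beta]=\langle\beta,\alpha^\vee\rangle x_\beta$ for $x_\beta\in L_\beta$, $\beta\in Q$; (LT3) $L$ is generated as an algebra by the $L_\alpha$, $\alpha\in\Delta^\times$; (LT4) $\Lambda$ is generated by $\{\lambda: L^\lambda\neq0\}$. It is centreless if its centre is $0$. **Isotopy.** A bi-isomorphism from a Lie $\Lambda$-torus $L$ of type $\Delta$ to a Lie $\Lambda'$-torus $L'$ of type $\Delta'$ is a Lie algebra isomorphism $\varphi:L\to L'$ together with group isomorphisms $\varphi_r:Q(\Delta)\to Q(\Delta')$, $\varphi_e:\Lambda\to\Lambda'$ with $\varphi(L_\alpha^\lambda)=L'^{\,\varphi_e(\lambda)}_{\varphi_r(\alpha)}$ for all $\alpha,\lambda$. For $s\in\mathrm{Hom}(Q,\Lambda)$, $L^{(s)}$ is the Lie algebra $L$ with the $Q\times\Lambda$-grading $(L^{(s)})_\alpha^\lambda=L_\alpha^{\lambda+s(\alpha)}$. $s$ is admissible for $L$ if $L_\alpha^{s(\alpha)}\ne0$ for all $0\neq\alpha\in\Delta_{\mathrm{ind}}$ (equivalently, $L^{(s)}$ is a Lie torus); then $L^{(s)}$ is called an isotope of $L$.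 $L$ is isotopic to $L'$ if some isotope $L^{(s)}$ of $L$ is bi-isomorphic to $L'$. **The EALAs $E(L,D,\tau)$.** Let $L$ be a centreless Lie $\Lambda$-torus of type $\Delta$. The centroid $\mathrm{Cent}(L)$ (endomorphisms of $L$ commuting with all $\mathrm{ad}(x)$) is $\Lambda$-graded by $\mathrm{Cent}(L)^\lambda=\{c: c(L^\mu)\subseteq L^{\lambda+\mu}\ \forall\mu\}$; its support $\Gamma=\Gamma(L)$ is a subgroup of $\Lambda$, and $\mathrm{Cent}(L)$ has a basis $\{t^\gamma\}_{\gamma\in\Gamma}$ with $t^\gamma\in\mathrm{Cent}(L)^\gamma$, $t^\gamma t^\delta=t^{\gamma+\delta}$. For $\theta\in\mathrm{Hom}(\Lambda,F)$ let $\partial_\theta\in\mathrm{Der}(L)$, $\partial_\theta(x)=\theta(\lambda)x$ for $x\in L^\lambda$. Put $\mathcal D=\{\partial_\theta\}$ and $\mathrm{CDer}(L)=\mathrm{Cent}(L)\mathcal D$, a $\Gamma$-graded Lie subalgebra of $\mathrm{Der}(L)$ with $\mathrm{CDer}(L)^\gamma=t^\gamma\mathcal D$. There is a nondegenerate invariant symmetric $\Lambda$-graded bilinear form $(\cdot|\cdot)$ on $L$, unique up to nonzero scalar; fix one. $\mathrm{SCDer}(L)$ is the $\Gamma$-graded subalgebra of $\mathrm{CDer}(L)$ of derivations skew with respect to the form; $\mathrm{SCDer}(L)^\gamma=\{t^\gamma\partial_\theta:\theta(\gamma)=0\}$. For a $\Gamma$-graded subalgebra $D=\bigoplus_\gamma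 D_\gamma$ of $\mathrm{SCDer}(L)$ let $C=D^{\mathrm{gr}*}=\bigoplus_\gamma(D_\gamma)^*\subseteq D^*$ with $C_\gamma=(D_{-\gamma})^*$, a graded $D$-module by $(d\cdot f)(e)=-f([d,e])$. Let $\sigma_D:L\times L\to C$, $\sigma_D(x,y)(d)=(dx|y)$, and $\mathrm{ev}:\Lambda\to C_0$, $\mathrm{ev}(\lambda)(\partial_\theta)=\theta(\lambda)$ for $\partial_\theta\in D_0$. $\mathcal P(L)$ is the set of pairs $(D,\tau)$ such that: (a) $D$ is a $\Gamma$-graded subalgebra of $\mathrm{SCDer}(L)$ with $\mathrm{ev}$ injective; (b) $\tau:D\times D\to C$ is a $\Gamma$-graded Lie algebra $2$-cocycle of $D$ with values in the $D$-module $C$, which is invariant, i.e. $\tau(d_1,d_2)(d_3)=\tau(d_2,d_3)(d_1)$, and $\tau(D_0,D)=0$. For $(D,\tau)\in\mathcal P(L)$, $E=E(L,D,\tau)=D\oplus L\oplus C$ with product $$[d_1+l_1+f_1,d_2+l_2+f_2]_E=[d_1,d_2]+\big([l_1,l_2]+d_1(l_2)-d_2(l_1)\big)+\big(d_1\cdot f_2-d_2\cdot f_1+\sigma_D(l_1,l_2)+\tau(d_1,d_2)\big),$$ form $(d_1+l_1+f_1|d_2+l_2+f_2)=(l_1|l_2)+f_1(d_2)+f_2(d_1)$, and distinguished subalgebra $H=D_0\oplus\mathfrak h\oplus C_0$, where $\mathfrak h=L_0^0$. The triple $(E,(\cdot|\cdot),H)$ is an extended affine Lie algebra (EALA). **EALA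 isomorphism.** $(E,(\cdot|\cdot),H)$ and $(E',(\cdot|\cdot)',H')$ are isomorphic as EALAs if there is a Lie algebra isomorphism $\chi:E\to E'$ with $\chi(H)=H'$ and, for some $a\in F^\times$, $(\chi(x)|\chi(y))'=a(x|y)$ for all $x,y\in E$. *)

theory Defs
  imports Complex_Main "HOL-Library.Function_Algebras" "HOL-Library.Product_Plus"
begin

definition zmul :: "int \<Rightarrow> 'a::ab_group_add \<Rightarrow> 'a" where
  "zmul n x = (\<Sum>i<nat n. x) - (\<Sum>i<nat (- n). x)"

lemma zmul_diff: "zmul (int a - int b) x = (\<Sum>i<a. x) - (\<Sum>i<b. x)"
proof -
  have add: "(\<Sum>i<m + n. x) = (\<Sum>i<m. x) + (\<Sum>i<n. x)" for m n :: nat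
    by (induction n) (simp_all add: algebra_simps)
  show ?thesis
  proof (cases "a \<ge> b")
    case True
    then show ?thesis
      using add[of "a - b" b] by (simp add: zmul_def nat_diff_distrib')
  next
    case False
    then show ?thesis
      using add[of "b - a" a] by (simp add: zmul_def nat_diff_distrib' algebra_simps)
  qed
qed

lemma zmul_add_left: "zmul (m + n) x = zmul m x + zmul n (x::'a::ab_group_add)"
proof -
  obtain a b c d where m: "m = int a - int b" and n: "n = int c - int d"
    by (metis int_diff_cases)
  have add: "(\<Sum>i<m + n. x) = (\<Sum>i<m. x) + (\<Sum>i<n. x)" for m n :: nat
    by (induction n) (simp_all add: algebra_simps)
  have "m + n = int (a + c) - int (b + d)" by (simp add: m n)
  then have "zmul (m + n) x = (\<Sum>i<a + c. x) - (\<Sum>i<b + d. x)"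
    by (simp only: zmul_diff)
  also have "\<dots> = zmul m x + zmul n x"
    unfolding m n zmul_diff add by (simp add: algebra_simps)
  finally show ?thesis .
qed

interpretation zmod: module "zmul :: int \<Rightarrow> 'a::ab_group_add \<Rightarrow> 'a"
proof
  show add: "zmul n (x + y) = zmul n x + zmul n y" for n and x y :: 'a
    by (simp add: zmul_def sum.distrib)
  show add': "zmul (m + n) x = zmul m x + zmul n x" for m n and x :: 'a
    by (rule zmul_add_left)
  show one: "zmul 1 x = x" for x :: 'a
    by (simp add: zmul_def)
  have zero: "zmul 0 x = 0" for x :: 'a by (simp add: zmul_def)
  have neg1: "zmul (- 1) x = - x" for x :: 'a by (simp add: zmul_def)
  show "zmul m (zmul n x) = zmul (m * n) x" for m n and x :: 'a
  proof (induction m rule: int_induct[where k = 0])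
    case base
    show ?case by (simp add: zero)
  next
    case (step1 i)
    have "(i + 1) * n = i * n + n" by (simp add: algebra_simps)
    then show ?case using step1 by (simp only: add' one)
  next
    case (step2 i)
    have "zmul (- n) y + zmul n y = 0" for y :: 'a
      using add'[of "- n" n y] zero[of y] by simp
    then have minus: "zmul (- n) x = - zmul n x" by (simp add: eq_neg_iff_add_eq_0)
    have "(i - 1) * n = i * n + - n" by (simp add: algebra_simps)
    moreover have "zmul (i - 1) y = zmul i y + - y" for y :: 'a
      using add'[of i "- 1" y] neg1[of y] by simp
    ultimately show ?case using step2 by (simp only: add' minus)
  qed
qed

definition fg_free_abelian :: "'g::ab_group_add set \<Rightarrow> bool" where
  "fg_free_abelian A \<longleftrightarrow>
     (\<exists>B. finite B \<and> \<not> module.dependent zmul B \<and> module.span zmul B = A)"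

definition group_hom_on :: "'a::ab_group_add set \<Rightarrow> ('a \<Rightarrow> 'b::ab_group_add) \<Rightarrow> bool" where
  "group_hom_on A f \<longleftrightarrow> (\<forall>x\<in>A. \<forall>y\<in>A. f (x + y) = f x + f y)"

definition lin_on ::
  "('f::field \<Rightarrow> 'a::ab_group_add \<Rightarrow> 'a) \<Rightarrow> ('f \<Rightarrow> 'b::ab_group_add \<Rightarrow> 'b) \<Rightarrow> 'a set \<Rightarrow> ('a \<Rightarrow> 'b) \<Rightarrow> bool"
where
  "lin_on sa sb A f \<longleftrightarrow>
     (\<forall>x\<in>A. \<forall>y\<in>A. f (x + y) = f x + f y) \<and> (\<forall>c. \<forall>x\<in>A. f (sa c x) = sb c (f x))"

definition pointwise :: "('f \<Rightarrow> 'b \<Rightarrow> 'b) \<Rightarrow> 'f \<Rightarrow> ('a \<Rightarrow> 'b) \<Rightarrow> ('a \<Rightarrow> 'b)" where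
  "pointwise s c f = (\<lambda>x. s c (f x))"

definition direct_sum ::
  "('f::field \<Rightarrow> 'a::ab_group_add \<Rightarrow> 'a) \<Rightarrow> 'i set \<Rightarrow> ('i \<Rightarrow> 'a set) \<Rightarrow> 'a set \<Rightarrow> bool"
where
  "direct_sum s I A W \<longleftrightarrow>
     module.subspace s W \<and> (\<forall>i\<in>I. module.subspace s (A i) \<and> A i \<subseteq> W) \<and>
     (\<forall>x\<in>W. \<exists>!u. (\<forall>i\<in>I. u i \<in> A i) \<and> (\<forall>i. i \<notin> I \<longrightarrow> u i = 0) \<and>
                 finite {i. u i \<noteq> 0} \<and> x = sum u {i. u i \<noteq> 0})"

definition is_coroot ::
  "('f::field_char_0 \<Rightarrow> 'v::ab_group_add \<Rightarrow> 'v) \<Rightarrow> 'v set \<Rightarrow> 'v \<Rightarrow> ('v \<Rightarrow> 'f) \<Rightarrow> bool"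
where
  "is_coroot s R \<alpha> h \<longleftrightarrow>
     Vector_Spaces.linear s (*) h \<and> h \<alpha> = 2 \<and> (\<forall>\<beta>\<in>R. \<beta> - s (h \<beta>) \<alpha> \<in> R)"

text \<open>\<open>R\<close> is a root system, in the sense of Bourbaki, in the subspace it spans.  A linear form
  on that subspace is represented by any linear form on the whole space that extends it.\<close>

definition root_system ::
  "('f::field_char_0 \<Rightarrow> 'v::ab_group_add \<Rightarrow> 'v) \<Rightarrow> 'v set \<Rightarrow> bool"
where
  "root_system s R \<longleftrightarrow>
     finite R \<and> 0 \<notin> R \<and> (\<forall>\<alpha>\<in>R. \<exists>h. is_coroot s R \<alpha> h \<and> (\<forall>\<beta>\<in>R. h \<beta> \<in> \<int>))"

text \<open>The last conjunct: \<open>R\<close> is not the direct sum of two nonempty root systems.\<close>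

definition irreducible_root_system ::
  "('f::field_char_0 \<Rightarrow> 'v::ab_group_add \<Rightarrow> 'v) \<Rightarrow> 'v set \<Rightarrow> bool"
where
  "irreducible_root_system s R \<longleftrightarrow>
     root_system s R \<and> R \<noteq> {} \<and>
     \<not> (\<exists>R1 R2. root_system s R1 \<and> root_system s R2 \<and> R1 \<noteq> {} \<and> R2 \<noteq> {} \<and>
          R = R1 \<union> R2 \<and> module.span s R1 \<inter> module.span s R2 = {0})"

text \<open>The spanning condition is part of Bourbaki's definition; it makes the ambient space finite
  dimensional, and determines each coroot.\<close>

definition finite_irreducible_root_system_0 ::
  "('f::field_char_0 \<Rightarrow> 'v::ab_group_add \<Rightarrow> 'v) \<Rightarrow> 'v set \<Rightarrow> bool"
where
  "finite_irreducible_root_system_0 s \<Delta> \<longleftrightarrow>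
     vector_space s \<and> 0 \<in> \<Delta> \<and>
     irreducible_root_system s (\<Delta> - {0}) \<and> module.span s (\<Delta> - {0}) = UNIV"

definition coroot ::
  "('f::field_char_0 \<Rightarrow> 'v::ab_group_add \<Rightarrow> 'v) \<Rightarrow> 'v set \<Rightarrow> 'v \<Rightarrow> 'v \<Rightarrow> 'f"
where
  "coroot s \<Delta> \<alpha> = (THE h. is_coroot s (\<Delta> - {0}) \<alpha> h)"

definition root_lattice :: "'v::ab_group_add set \<Rightarrow> 'v set" where
  "root_lattice \<Delta> = module.span zmul \<Delta>"

definition indivisible :: "('f::field_char_0 \<Rightarrow> 'v::ab_group_add \<Rightarrow> 'v) \<Rightarrow> 'v set \<Rightarrow> 'v set" where
  "indivisible s \<Delta> = insert 0 {\<alpha> \<in> \<Delta> - {0}. s (1/2) \<alpha> \<notin> \<Delta>}"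

definition lie_algebra ::
  "('f::field \<Rightarrow> 'l::ab_group_add \<Rightarrow> 'l) \<Rightarrow> ('l \<Rightarrow> 'l \<Rightarrow> 'l) \<Rightarrow> bool"
where
  "lie_algebra s br \<longleftrightarrow>
     vector_space s \<and>
     (\<forall>x. Vector_Spaces.linear s s (br x)) \<and> (\<forall>y. Vector_Spaces.linear s s (\<lambda>x. br x y)) \<and>
     (\<forall>x. br x x = 0) \<and>
     (\<forall>x y z. br x (br y z) + br y (br z x) + br z (br x y) = 0)"

definition lie_subalgebra ::
  "('f::field \<Rightarrow> 'l::ab_group_add \<Rightarrow> 'l) \<Rightarrow> ('l \<Rightarrow> 'l \<Rightarrow> 'l) \<Rightarrow> 'l set \<Rightarrow> bool"
where
  "lie_subalgebra s br S \<longleftrightarrow> module.subspace s S \<and> (\<forall>x\<in>S. \<forall>y\<in>S. br x y \<in> S)"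

definition commutator :: "('l \<Rightarrow> 'l) \<Rightarrow> ('l \<Rightarrow> 'l) \<Rightarrow> ('l::ab_group_add \<Rightarrow> 'l)" where
  "commutator d e = (\<lambda>x. d (e x) - e (d x))"

text \<open>\<open>homog L \<alpha> \<kappa>\<close> is \<open>L\<^sub>\<alpha>\<^sup>\<kappa>\<close>.  Its values for \<open>\<alpha>\<close> outside the root lattice carry no meaning and
  are never used.\<close>

record ('f, 'v, 'g, 'l) graded_lie =
  vscale :: "'f \<Rightarrow> 'v \<Rightarrow> 'v"
  roots :: "'v set"
  lscale :: "'f \<Rightarrow> 'l \<Rightarrow> 'l"
  bracket :: "'l \<Rightarrow> 'l \<Rightarrow> 'l"
  homog :: "'v \<Rightarrow> 'g \<Rightarrow> 'l set"

abbreviation Qlat where "Qlat L \<equiv> root_lattice (roots L)"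

definition root_space ::
  "('f::field_char_0, 'v::ab_group_add, 'g::ab_group_add, 'l::ab_group_add) graded_lie \<Rightarrow> 'v \<Rightarrow> 'l set"
where
  "root_space L \<alpha> = module.span (lscale L) (\<Union>\<kappa>. homog L \<alpha> \<kappa>)"

definition degree_space ::
  "('f::field_char_0, 'v::ab_group_add, 'g::ab_group_add, 'l::ab_group_add) graded_lie \<Rightarrow> 'g \<Rightarrow> 'l set"
where
  "degree_space L \<kappa> = module.span (lscale L) (\<Union>\<alpha>\<in>Qlat L. homog L \<alpha> \<kappa>)"

definition graded_lie_algebra ::
  "('f::field_char_0, 'v::ab_group_add, 'g::ab_group_add, 'l::ab_group_add) graded_lie \<Rightarrow> bool"
where
  "graded_lie_algebra L \<longleftrightarrow>
     lie_algebra (lscale L) (bracket L) \<and>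
     direct_sum (lscale L) (Qlat L \<times> UNIV) (\<lambda>(\<alpha>, \<kappa>). homog L \<alpha> \<kappa>) UNIV \<and>
     (\<forall>\<alpha>\<in>Qlat L. \<forall>\<beta>\<in>Qlat L. \<forall>\<kappa> \<mu>. \<forall>x\<in>homog L \<alpha> \<kappa>. \<forall>y\<in>homog L \<beta> \<mu>.
        bracket L x y \<in> homog L (\<alpha> + \<beta>) (\<kappa> + \<mu>))"

definition lie_torus ::
  "('f::field_char_0, 'v::ab_group_add, 'g::ab_group_add, 'l::ab_group_add) graded_lie \<Rightarrow> bool"
where
  "lie_torus L \<longleftrightarrow>
     fg_free_abelian (UNIV :: 'g set) \<and>
     finite_irreducible_root_system_0 (vscale L) (roots L) \<and>
     graded_lie_algebra L \<and>
     (\<forall>\<alpha>\<in>Qlat L - roots L. root_space L \<alpha> = {0}) \<and>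
     (\<forall>\<alpha>\<in>indivisible (vscale L) (roots L) - {0}. homog L \<alpha> 0 \<noteq> {0}) \<and>
     (\<forall>\<alpha>\<in>Qlat L - {0}. \<forall>\<kappa>. homog L \<alpha> \<kappa> \<noteq> {0} \<longrightarrow>
        (\<exists>e\<in>homog L \<alpha> \<kappa>. \<exists>f\<in>homog L (- \<alpha>) (- \<kappa>).
           homog L \<alpha> \<kappa> = module.span (lscale L) {e} \<and>
           homog L (- \<alpha>) (- \<kappa>) = module.span (lscale L) {f} \<and>
           (\<forall>\<beta>\<in>Qlat L. \<forall>x\<in>root_space L \<beta>.
              bracket L (bracket L e f) x = lscale L (coroot (vscale L) (roots L) \<alpha> \<beta>) x))) \<and>
     lie_subalgebra (lscale L) (bracket L) hull (\<Union>\<alpha>\<in>roots L - {0}. root_space L \<alpha>) = UNIV \<and>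
     module.span zmul {\<kappa>. degree_space L \<kappa> \<noteq> {0}} = UNIV"

definition centreless ::
  "('f::field_char_0, 'v::ab_group_add, 'g::ab_group_add, 'l::ab_group_add) graded_lie \<Rightarrow> bool"
where
  "centreless L \<longleftrightarrow> {z. \<forall>x. bracket L z x = 0} = {0}"

definition bi_isomorphic ::
  "('f::field_char_0, 'v::ab_group_add, 'g::ab_group_add, 'l::ab_group_add) graded_lie \<Rightarrow>
   ('f, 'w::ab_group_add, 'h::ab_group_add, 'm::ab_group_add) graded_lie \<Rightarrow> bool"
where
  "bi_isomorphic L L' \<longleftrightarrow>
     (\<exists>\<phi> \<phi>\<^sub>r \<phi>\<^sub>e.
        bij \<phi> \<and> Vector_Spaces.linear (lscale L) (lscale L') \<phi> \<and>
        (\<forall>x y. \<phi> (bracket L x y) = bracket L' (\<phi> x) (\<phi> y)) \<and>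
        bij_betw \<phi>\<^sub>r (Qlat L) (Qlat L') \<and> group_hom_on (Qlat L) \<phi>\<^sub>r \<and>
        bij \<phi>\<^sub>e \<and> group_hom_on UNIV \<phi>\<^sub>e \<and>
        (\<forall>\<alpha>\<in>Qlat L. \<forall>\<kappa>. \<phi> ` homog L \<alpha> \<kappa> = homog L' (\<phi>\<^sub>r \<alpha>) (\<phi>\<^sub>e \<kappa>)))"

definition regrade ::
  "('v \<Rightarrow> 'g::ab_group_add) \<Rightarrow> ('f, 'v, 'g, 'l) graded_lie \<Rightarrow> ('f, 'v, 'g, 'l) graded_lie"
where
  "regrade s L = L\<lparr>homog := \<lambda>\<alpha> \<kappa>. homog L \<alpha> (\<kappa> + s \<alpha>)\<rparr>"

definition admissible ::
  "('v \<Rightarrow> 'g) \<Rightarrow>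
   ('f::field_char_0, 'v::ab_group_add, 'g::ab_group_add, 'l::ab_group_add) graded_lie \<Rightarrow> bool"
where
  "admissible s L \<longleftrightarrow>
     (\<forall>\<alpha>\<in>indivisible (vscale L) (roots L) - {0}. homog L \<alpha> (s \<alpha>) \<noteq> {0})"

definition isotopic ::
  "('f::field_char_0, 'v::ab_group_add, 'g::ab_group_add, 'l::ab_group_add) graded_lie \<Rightarrow>
   ('f, 'w::ab_group_add, 'h::ab_group_add, 'm::ab_group_add) graded_lie \<Rightarrow> bool"
where
  "isotopic L L' \<longleftrightarrow>
     (\<exists>s. group_hom_on (Qlat L) s \<and> admissible s L \<and> bi_isomorphic (regrade s L) L')"

definition Cent ::
  "('f::field_char_0, 'v::ab_group_add, 'g::ab_group_add, 'l::ab_group_add) graded_lie \<Rightarrow> ('l \<Rightarrow> 'l) set"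
where
  "Cent L = {c. Vector_Spaces.linear (lscale L) (lscale L) c \<and>
                (\<forall>x y. c (bracket L x y) = bracket L x (c y))}"

definition Cent_deg ::
  "('f::field_char_0, 'v::ab_group_add, 'g::ab_group_add, 'l::ab_group_add) graded_lie \<Rightarrow> 'g \<Rightarrow>
   ('l \<Rightarrow> 'l) set"
where
  "Cent_deg L \<kappa> = {c \<in> Cent L. \<forall>\<mu>. c ` degree_space L \<mu> \<subseteq> degree_space L (\<kappa> + \<mu>)}"

definition centroid_support ::
  "('f::field_char_0, 'v::ab_group_add, 'g::ab_group_add, 'l::ab_group_add) graded_lie \<Rightarrow> 'g set"
where
  "centroid_support L = {\<gamma>. Cent_deg L \<gamma> \<noteq> {0}}"

definition degree_derivation ::
  "('f::field_char_0, 'v::ab_group_add, 'g::ab_group_add, 'l::ab_group_add) graded_lie \<Rightarrow>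
   ('g \<Rightarrow> 'f) \<Rightarrow> ('l \<Rightarrow> 'l)"
where
  "degree_derivation L \<theta> =
     (THE d. Vector_Spaces.linear (lscale L) (lscale L) d \<and>
             (\<forall>\<kappa>. \<forall>x\<in>degree_space L \<kappa>. d x = lscale L (\<theta> \<kappa>) x))"

definition degree_derivations ::
  "('f::field_char_0, 'v::ab_group_add, 'g::ab_group_add, 'l::ab_group_add) graded_lie \<Rightarrow> ('l \<Rightarrow> 'l) set"
where
  "degree_derivations L = degree_derivation L ` {\<theta>. group_hom_on UNIV \<theta>}"

definition CDer ::
  "('f::field_char_0, 'v::ab_group_add, 'g::ab_group_add, 'l::ab_group_add) graded_lie \<Rightarrow> ('l \<Rightarrow> 'l) set"
where
  "CDer L = module.span (pointwise (lscale L))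
              {c \<circ> d | c d. c \<in> Cent L \<and> d \<in> degree_derivations L}"

text \<open>For \<open>\<gamma>\<close> in the support of the centroid, \<open>Cent_deg L \<gamma>\<close> is the line spanned by \<open>t\<^sup>\<gamma>\<close>, so this is
  \<open>t\<^sup>\<gamma>\<D>\<close> whatever the normalisation of \<open>t\<^sup>\<gamma>\<close>.\<close>

definition CDer_deg ::
  "('f::field_char_0, 'v::ab_group_add, 'g::ab_group_add, 'l::ab_group_add) graded_lie \<Rightarrow> 'g \<Rightarrow>
   ('l \<Rightarrow> 'l) set"
where
  "CDer_deg L \<gamma> = module.span (pointwise (lscale L))
                    {c \<circ> d | c d. c \<in> Cent_deg L \<gamma> \<and> d \<in> degree_derivations L}"

definition invariant_form ::
  "('f::field_char_0, 'v::ab_group_add, 'g::ab_group_add, 'l::ab_group_add) graded_lie \<Rightarrow>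
   ('l \<Rightarrow> 'l \<Rightarrow> 'f) \<Rightarrow> bool"
where
  "invariant_form L b \<longleftrightarrow>
     (\<forall>x. Vector_Spaces.linear (lscale L) (*) (b x)) \<and>
     (\<forall>x y. b x y = b y x) \<and>
     (\<forall>x y z. b (bracket L x y) z = b x (bracket L y z)) \<and>
     (\<forall>x. (\<forall>y. b x y = 0) \<longrightarrow> x = 0) \<and>
     (\<forall>\<kappa> \<mu>. \<kappa> + \<mu> \<noteq> 0 \<longrightarrow> (\<forall>x\<in>degree_space L \<kappa>. \<forall>y\<in>degree_space L \<mu>. b x y = 0))"

definition SCDer ::
  "('f::field_char_0, 'v::ab_group_add, 'g::ab_group_add, 'l::ab_group_add) graded_lie \<Rightarrow>
   ('l \<Rightarrow> 'l \<Rightarrow> 'f) \<Rightarrow> ('l \<Rightarrow> 'l) set"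
where
  "SCDer L b = {d \<in> CDer L. \<forall>x y. b (d x) y = - b x (d y)}"

definition hcomp ::
  "('f::field_char_0, 'v::ab_group_add, 'g::ab_group_add, 'l::ab_group_add) graded_lie \<Rightarrow>
   ('l \<Rightarrow> 'l) set \<Rightarrow> 'g \<Rightarrow> ('l \<Rightarrow> 'l) set"
where
  "hcomp L D \<gamma> = D \<inter> CDer_deg L \<gamma>"

definition graded_subalgebra ::
  "('f::field_char_0, 'v::ab_group_add, 'g::ab_group_add, 'l::ab_group_add) graded_lie \<Rightarrow>
   ('l \<Rightarrow> 'l \<Rightarrow> 'f) \<Rightarrow> ('l \<Rightarrow> 'l) set \<Rightarrow> bool"
where
  "graded_subalgebra L b D \<longleftrightarrow>
     D \<subseteq> SCDer L b \<and> lie_subalgebra (pointwise (lscale L)) commutator D \<and>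
     direct_sum (pointwise (lscale L)) (centroid_support L) (hcomp L D) D"

text \<open>Linear forms on \<open>D\<close> are represented by functions vanishing outside \<open>D\<close>, so that equality of
  functions is equality of linear forms.\<close>

definition dual_space ::
  "('f::field_char_0, 'v::ab_group_add, 'g::ab_group_add, 'l::ab_group_add) graded_lie \<Rightarrow>
   ('l \<Rightarrow> 'l) set \<Rightarrow> (('l \<Rightarrow> 'l) \<Rightarrow> 'f) set"
where
  "dual_space L D = {f. lin_on (pointwise (lscale L)) (*) D f \<and> (\<forall>d. d \<notin> D \<longrightarrow> f d = 0)}"

text \<open>\<open>(D\<^sub>-\<^sub>\<gamma>)\<^sup>*\<close>, embedded in \<open>D\<^sup>*\<close> by extending linear forms by \<open>0\<close> on the other components.\<close>

definition C_deg ::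
  "('f::field_char_0, 'v::ab_group_add, 'g::ab_group_add, 'l::ab_group_add) graded_lie \<Rightarrow>
   ('l \<Rightarrow> 'l) set \<Rightarrow> 'g \<Rightarrow> (('l \<Rightarrow> 'l) \<Rightarrow> 'f) set"
where
  "C_deg L D \<gamma> =
     {f \<in> dual_space L D. \<forall>\<delta>\<in>centroid_support L. \<delta> \<noteq> - \<gamma> \<longrightarrow> (\<forall>d\<in>hcomp L D \<delta>. f d = 0)}"

definition graded_dual ::
  "('f::field_char_0, 'v::ab_group_add, 'g::ab_group_add, 'l::ab_group_add) graded_lie \<Rightarrow>
   ('l \<Rightarrow> 'l) set \<Rightarrow> (('l \<Rightarrow> 'l) \<Rightarrow> 'f) set"
where
  "graded_dual L D = module.span (pointwise (*)) (\<Union>\<gamma>\<in>centroid_support L. C_deg L D \<gamma>)"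

definition coadj ::
  "('l::ab_group_add \<Rightarrow> 'l) set \<Rightarrow> ('l \<Rightarrow> 'l) \<Rightarrow> (('l \<Rightarrow> 'l) \<Rightarrow> 'f::field_char_0) \<Rightarrow> (('l \<Rightarrow> 'l) \<Rightarrow> 'f)"
where
  "coadj D d f = (\<lambda>e. if e \<in> D then - f (commutator d e) else 0)"

definition sigma ::
  "('l \<Rightarrow> 'l \<Rightarrow> 'f::field_char_0) \<Rightarrow> ('l \<Rightarrow> 'l) set \<Rightarrow> 'l \<Rightarrow> 'l \<Rightarrow> (('l \<Rightarrow> 'l) \<Rightarrow> 'f)"
where
  "sigma b D x y = (\<lambda>d. if d \<in> D then b (d x) y else 0)"

definition ev ::
  "('f::field_char_0, 'v::ab_group_add, 'g::ab_group_add, 'l::ab_group_add) graded_lie \<Rightarrow>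
   ('l \<Rightarrow> 'l) set \<Rightarrow> 'g \<Rightarrow> (('l \<Rightarrow> 'l) \<Rightarrow> 'f)"
where
  "ev L D \<kappa> =
     (THE f. f \<in> C_deg L D 0 \<and>
        (\<forall>\<theta>. group_hom_on UNIV \<theta> \<and> degree_derivation L \<theta> \<in> hcomp L D 0 \<longrightarrow>
             f (degree_derivation L \<theta>) = \<theta> \<kappa>))"

text \<open>A map on \<open>D \<times> D\<close> is represented by a curried function vanishing outside \<open>D \<times> D\<close>
  (first conjunct), so that each cocycle has exactly one representative.\<close>

definition invariant_cocycle ::
  "('f::field_char_0, 'v::ab_group_add, 'g::ab_group_add, 'l::ab_group_add) graded_lie \<Rightarrow>
   ('l \<Rightarrow> 'l) set \<Rightarrow> (('l \<Rightarrow> 'l) \<Rightarrow> ('l \<Rightarrow> 'l) \<Rightarrow> (('l \<Rightarrow> 'l) \<Rightarrow> 'f)) \<Rightarrow> bool"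
where
  "invariant_cocycle L D \<tau> \<longleftrightarrow>
     (\<forall>d e. d \<notin> D \<or> e \<notin> D \<longrightarrow> \<tau> d e = 0) \<and>
     (\<forall>d\<in>D. \<forall>e\<in>D. \<tau> d e \<in> graded_dual L D) \<and>
     (\<forall>d\<in>D. lin_on (pointwise (lscale L)) (pointwise (*)) D (\<tau> d)) \<and>
     (\<forall>e\<in>D. lin_on (pointwise (lscale L)) (pointwise (*)) D (\<lambda>d. \<tau> d e)) \<and>
     (\<forall>d\<in>D. \<tau> d d = 0) \<and>
     (\<forall>d\<^sub>1\<in>D. \<forall>d\<^sub>2\<in>D. \<forall>d\<^sub>3\<in>D.
        coadj D d\<^sub>1 (\<tau> d\<^sub>2 d\<^sub>3) + coadj D d\<^sub>2 (\<tau> d\<^sub>3 d\<^sub>1) + coadj D d\<^sub>3 (\<tau> d\<^sub>1 d\<^sub>2) =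
        \<tau> (commutator d\<^sub>1 d\<^sub>2) d\<^sub>3 + \<tau> (commutator d\<^sub>2 d\<^sub>3) d\<^sub>1 + \<tau> (commutator d\<^sub>3 d\<^sub>1) d\<^sub>2) \<and>
     (\<forall>\<gamma>\<in>centroid_support L. \<forall>\<delta>\<in>centroid_support L.
        \<forall>d\<in>hcomp L D \<gamma>. \<forall>e\<in>hcomp L D \<delta>. \<tau> d e \<in> C_deg L D (\<gamma> + \<delta>)) \<and>
     (\<forall>d\<^sub>1\<in>D. \<forall>d\<^sub>2\<in>D. \<forall>d\<^sub>3\<in>D. \<tau> d\<^sub>1 d\<^sub>2 d\<^sub>3 = \<tau> d\<^sub>2 d\<^sub>3 d\<^sub>1) \<and>
     (\<forall>d\<in>hcomp L D 0. \<forall>e\<in>D. \<tau> d e = 0)"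

definition cocycle_pairs ::
  "('f::field_char_0, 'v::ab_group_add, 'g::ab_group_add, 'l::ab_group_add) graded_lie \<Rightarrow>
   ('l \<Rightarrow> 'l \<Rightarrow> 'f) \<Rightarrow>
   (('l \<Rightarrow> 'l) set \<times> (('l \<Rightarrow> 'l) \<Rightarrow> ('l \<Rightarrow> 'l) \<Rightarrow> (('l \<Rightarrow> 'l) \<Rightarrow> 'f))) set"
where
  "cocycle_pairs L b = {(D, \<tau>). graded_subalgebra L b D \<and> inj (ev L D) \<and> invariant_cocycle L D \<tau>}"

record ('f, 'e) eala =
  ecarrier :: "'e set"
  escale :: "'f \<Rightarrow> 'e \<Rightarrow> 'e"
  ebracket :: "'e \<Rightarrow> 'e \<Rightarrow> 'e"
  eform :: "'e \<Rightarrow> 'e \<Rightarrow> 'f"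
  ecartan :: "'e set"

definition EALA ::
  "('f::field_char_0, 'v::ab_group_add, 'g::ab_group_add, 'l::ab_group_add) graded_lie \<Rightarrow>
   ('l \<Rightarrow> 'l \<Rightarrow> 'f) \<Rightarrow> ('l \<Rightarrow> 'l) set \<Rightarrow> (('l \<Rightarrow> 'l) \<Rightarrow> ('l \<Rightarrow> 'l) \<Rightarrow> (('l \<Rightarrow> 'l) \<Rightarrow> 'f)) \<Rightarrow>
   ('f, ('l \<Rightarrow> 'l) \<times> 'l \<times> (('l \<Rightarrow> 'l) \<Rightarrow> 'f)) eala"
where
  "EALA L b D \<tau> =
     \<lparr>ecarrier = D \<times> UNIV \<times> graded_dual L D,
      escale = (\<lambda>c (d, l, f). (pointwise (lscale L) c d, lscale L c l, pointwise (*) c f)),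
      ebracket = (\<lambda>(d\<^sub>1, l\<^sub>1, f\<^sub>1) (d\<^sub>2, l\<^sub>2, f\<^sub>2).
        (commutator d\<^sub>1 d\<^sub>2,
         bracket L l\<^sub>1 l\<^sub>2 + d\<^sub>1 l\<^sub>2 - d\<^sub>2 l\<^sub>1,
         coadj D d\<^sub>1 f\<^sub>2 - coadj D d\<^sub>2 f\<^sub>1 + sigma b D l\<^sub>1 l\<^sub>2 + \<tau> d\<^sub>1 d\<^sub>2)),
      eform = (\<lambda>(d\<^sub>1, l\<^sub>1, f\<^sub>1) (d\<^sub>2, l\<^sub>2, f\<^sub>2). b l\<^sub>1 l\<^sub>2 + f\<^sub>1 d\<^sub>2 + f\<^sub>2 d\<^sub>1),
      ecartan = hcomp L D 0 \<times> homog L 0 0 \<times> C_deg L D 0\<rparr>"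

definition eala_isomorphic ::
  "('f::field, 'e::ab_group_add) eala \<Rightarrow> ('f, 'k::ab_group_add) eala \<Rightarrow> bool"
where
  "eala_isomorphic A B \<longleftrightarrow>
     (\<exists>\<chi>. bij_betw \<chi> (ecarrier A) (ecarrier B) \<and>
          lin_on (escale A) (escale B) (ecarrier A) \<chi> \<and>
          (\<forall>x\<in>ecarrier A. \<forall>y\<in>ecarrier A. \<chi> (ebracket A x y) = ebracket B (\<chi> x) (\<chi> y)) \<and>
          \<chi> ` ecartan A = ecartan B \<and>
          (\<exists>a. a \<noteq> 0 \<and>
             (\<forall>x\<in>ecarrier A. \<forall>y\<in>ecarrier A. eform B (\<chi> x) (\<chi> y) = a * eform A x y)))"

end

theory Submission
  imports Defs
begin

text \<open>Let \<open>\<phi> : L\<^sup>(\<^sup>s\<^sup>) \<rightarrow> L'\<close> be a bi-isomorphism.  A derivation \<open>d = \<Sum> c\<^sub>i \<partial>\<^bsub>\<theta>\<^sub>i\<^esub>\<close> acts on \<open>L\<^sup>\<kappa>\<close> as the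
  centroid element \<open>M \<kappa> = \<Sum> \<theta>\<^sub>i(\<kappa>) c\<^sub>i\<close>, and the additive map \<open>M\<close> determines \<open>d\<close>.  Since coroots span
  the homomorphisms on the root lattice, there is a unique \<open>\<psi> d \<in> L\<^sub>0\<close> acting on \<open>L\<^sub>\<alpha>\<close> as \<open>M (s \<alpha>)\<close>,
  and \<open>T d = \<phi> (d - ad (\<psi> d)) \<phi>\<^sup>-\<^sup>1\<close> is the derivation of \<open>L'\<close> that belongs to the same \<open>M\<close> up to
  transport along \<open>\<phi>\<close>.  The map \<open>T\<close> preserves brackets, degrees and skewness, so it carries pairs
  \<open>(D, \<tau>)\<close> to pairs.  The forms agree up to a factor because an invariant form is unique up to a
  scalar, and \<open>d + l + f \<mapsto> T d + \<phi> (l + \<psi> d) + f'\<close> is the isomorphism of extensions, where \<open>f'\<close> is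
  the transport of \<open>f - (\<psi> \<sqdot> | l) - (\<psi> \<sqdot> | \<psi> d) / 2\<close>.\<close>

section \<open>Root lattices and coroots\<close>

text \<open>The obstacle is that \<phi> respects roots but not degrees: it moves degree \<kappa> by
  s \<alpha>, which depends on the root. Hence the plain conjugate
  \<open>\<phi> \<circ> d \<circ> inv \<phi>\<close> acts on a homogeneous component by an operator
  depending on both root and degree, and in general it is not one of the derivations attached to L'.
  The unwanted part M (s \<alpha>) is additive in the root alone, and exactly such a part is the
  action of an element of root degree zero. The inner derivation removed from d reappears in the
  extension as a translation of the L-component by psi d. This disturbs the form, and the
  C-component compensates: a term mixing D and L is absorbed by one functional, while (psi d | psi
  e), symmetric in d and e, is shared equally by two, whence the half. Uniqueness of M and of the
  form rests on one simplicity statement: an ideal containing a nonzero homogeneous element is all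
  of L. Bijectivity comes from symmetry, since the inverse of an isotopy is an isotopy and every
  construction can be instantiated for the inverse data.\<close>

lemma sum_fun_apply: "(\<Sum>i\<in>A. f i) x = (\<Sum>i\<in>A. f i x)"
  for f :: "'i \<Rightarrow> 'a \<Rightarrow> 'b::comm_monoid_add"
  by (induction A rule: infinite_finite_induct) auto

lemma linear_iff:
  "Vector_Spaces.linear s t f \<longleftrightarrow> vector_space s \<and> vector_space t \<and>
     (\<forall>x y. f (x + y) = f x + f y) \<and> (\<forall>c x. f (s c x) = t c (f x))"
  unfolding Vector_Spaces.linear_def module_hom_def module_hom_axioms_def module_iff_vector_space
  by auto

lemma vector_space_pointwise: "vector_space s \<Longrightarrow> vector_space (pointwise s)"
  unfolding vector_space_def pointwise_def by (auto simp: fun_eq_iff)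

lemma vector_space_mult: "vector_space ((*) :: 'f::field \<Rightarrow> 'f \<Rightarrow> 'f)"
  by unfold_locales (auto simp: algebra_simps)

lemma zmul_induct:
  assumes "P 0" and diff: "\<And>x y. P x \<Longrightarrow> P y \<Longrightarrow> P (x - y)" and "P x"
  shows "P (zmul n x)"
proof -
  have add: "P (x + y)" if "P x" "P y" for x y
    using diff[OF that(1) diff[OF \<open>P 0\<close> that(2)]] by simp
  have "P (\<Sum>i<n. x)" for n :: nat
    by (induction n) (auto intro: add assms)
  then show ?thesis unfolding zmul_def by (intro diff)
qed

text \<open>Bridges integer multiples in the lattice and scalar multiples, needed where integral
  coroot values meet maps that are only additive.\<close>

lemma scale_of_int:
  assumes "vector_space s"
  shows "s (of_int n) x = zmul n x"
proof -
  interpret vector_space s by fact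
  have "s (of_nat k) x = (\<Sum>i<k. x)" for k :: nat
    by (induction k) (auto simp: scale_left_distrib algebra_simps)
  moreover have "(of_int n :: 'a) = of_nat (nat n) - of_nat (nat (- n))"
    by (cases "n \<ge> 0") auto
  ultimately show ?thesis by (simp add: zmul_def scale_left_diff_distrib)
qed

lemma root_lattice_simps [intro]:
  "0 \<in> root_lattice \<Delta>"
  "x \<in> \<Delta> \<Longrightarrow> x \<in> root_lattice \<Delta>"
  "x \<in> root_lattice \<Delta> \<Longrightarrow> y \<in> root_lattice \<Delta> \<Longrightarrow> x + y \<in> root_lattice \<Delta>"
  "x \<in> root_lattice \<Delta> \<Longrightarrow> y \<in> root_lattice \<Delta> \<Longrightarrow> x - y \<in> root_lattice \<Delta>"
  "x \<in> root_lattice \<Delta> \<Longrightarrow> - x \<in> root_lattice \<Delta>"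
  "x \<in> root_lattice \<Delta> \<Longrightarrow> zmul n x \<in> root_lattice \<Delta>"
  unfolding root_lattice_def
  by (auto intro: zmod.span_zero zmod.span_base zmod.span_add zmod.span_diff zmod.span_neg zmod.span_scale)

text \<open>Closure under differences already yields sums, negatives and integer multiples, so an
  identity of homomorphisms needs a single inductive step. Membership in the span is carried along
  because most maps are additive only on the lattice.\<close>

lemma zmul_span_induct:
  assumes "x \<in> module.span zmul X"
    and zero: "P 0" and base: "\<And>x. x \<in> X \<Longrightarrow> P x"
    and diff: "\<And>x y. x \<in> module.span zmul X \<Longrightarrow> y \<in> module.span zmul X \<Longrightarrow> P x \<Longrightarrow> P y \<Longrightarrow> P (x - y)"
  shows "P x"
proof -
  let ?S = "module.span zmul X"
  let ?P = "\<lambda>x. x \<in> ?S \<and> P x"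
  have d: "?P (x - y)" if "?P x" "?P y" for x y
    using that diff[of x y] zmod.span_diff[of x X y] by blast
  have z: "?P 0" using zero zmod.span_zero by blast
  have "?P x"
    using assms(1)
  proof (rule zmod.span_induct)
    show "zmod.subspace (Collect ?P)"
      unfolding zmod.subspace_def
    proof (intro conjI ballI allI)
      show "x + y \<in> Collect ?P" if "x \<in> Collect ?P" "y \<in> Collect ?P" for x y
        using d[of x "0 - y"] d[of 0 y] z that by simp
      show "zmul c x \<in> Collect ?P" if "x \<in> Collect ?P" for c x
        using zmul_induct[of ?P x c, OF z d] that by auto
    qed (use z in auto)
  qed (use base zmod.span_base in auto)
  then show ?thesis by blast
qed

lemma root_lattice_induct [consumes 1, case_names zero root diff]:
  assumes "x \<in> root_lattice \<Delta>"
    and "P 0" and "\<And>x. x \<in> \<Delta> \<Longrightarrow> P x"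
    and "\<And>x y. x \<in> root_lattice \<Delta> \<Longrightarrow> y \<in> root_lattice \<Delta> \<Longrightarrow> P x \<Longrightarrow> P y \<Longrightarrow> P (x - y)"
  shows "P x"
  using assms zmul_span_induct[of x \<Delta> P] unfolding root_lattice_def by blast

lemma group_hom_on_rules:
  assumes "group_hom_on A f" and A: "zmod.subspace A"
  shows group_hom_on_zero: "f 0 = 0"
    and group_hom_on_minus: "x \<in> A \<Longrightarrow> f (- x) = - f x"
    and group_hom_on_add: "x \<in> A \<Longrightarrow> y \<in> A \<Longrightarrow> f (x + y) = f x + f y"
    and group_hom_on_diff: "x \<in> A \<Longrightarrow> y \<in> A \<Longrightarrow> f (x - y) = f x - f y"
    and group_hom_on_zmul: "x \<in> A \<Longrightarrow> f (zmul n x) = zmul n (f x)"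
proof -
  note sub = zmod.subspace_0[OF A] zmod.subspace_neg[OF A] zmod.subspace_diff[OF A]
  show add: "f (x + y) = f x + f y" if "x \<in> A" "y \<in> A" for x y
    using that assms unfolding group_hom_on_def by blast
  show zero: "f 0 = 0" using add[of 0 0] sub by simp
  show neg: "f (- x) = - f x" if "x \<in> A" for x
    using add[OF that sub(2)[OF that]] zero by (simp add: eq_neg_iff_add_eq_0 add.commute)
  show diff: "f (x - y) = f x - f y" if "x \<in> A" "y \<in> A" for x y
    using add[OF that(1) sub(2)[OF that(2)]] neg[OF that(2)] by simp
  show "f (zmul n x) = zmul n (f x)" if "x \<in> A"
  proof -
    have "(\<Sum>i<k. x) \<in> A \<and> f (\<Sum>i<k. x) = (\<Sum>i<k. f x)" for k :: nat
      using that by (induction k) (auto simp: zero add sub(1) intro: zmod.subspace_add[OF A])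
    then show ?thesis by (simp add: zmul_def diff)
  qed
qed

lemma subspace_root_lattice: "zmod.subspace (root_lattice \<Delta>)"
  unfolding root_lattice_def by (rule zmod.subspace_span)

section \<open>Finite root systems and their coroots\<close>

locale root_sys =
  fixes sv :: "'f::field_char_0 \<Rightarrow> 'v::ab_group_add \<Rightarrow> 'v" and \<Delta> :: "'v set"
  assumes finite_irreducible: "finite_irreducible_root_system_0 sv \<Delta>"
begin

sublocale V: vector_space sv
  using finite_irreducible unfolding finite_irreducible_root_system_0_def by simp

definition "R = \<Delta> - {0}"

abbreviation "cr \<equiv> coroot sv \<Delta>"
abbreviation "QQ \<equiv> root_lattice \<Delta>"

lemma irreducible: "irreducible_root_system sv R"
  using finite_irreducible unfolding finite_irreducible_root_system_0_def R_def by simp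

lemma finite_R: "finite R" and zero_notin_R: "0 \<notin> R" and R_nonempty: "R \<noteq> {}"
  using irreducible unfolding irreducible_root_system_def root_system_def by simp_all

lemma span_R: "module.span sv R = UNIV"
  using finite_irreducible unfolding finite_irreducible_root_system_0_def R_def by simp

lemma coroot_linear:
  assumes "is_coroot sv X \<alpha> h"
  shows "h (x + y) = h x + h y" "h (x - y) = h x - h y" "h (sv c x) = c * h x" "h (- x) = - h x"
    "h 0 = 0" "h \<alpha> = 2"
proof -
  interpret l: Vector_Spaces.linear sv "(*)" h using assms unfolding is_coroot_def by blast
  show "h (x + y) = h x + h y" "h (x - y) = h x - h y" "h (sv c x) = c * h x" "h (- x) = - h x"
    "h 0 = 0"
    by (simp_all add: l.add l.diff l.scale l.neg l.zero)
  show "h \<alpha> = 2" using assms unfolding is_coroot_def by blast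
qed

lemma linear_eq_on_R:
  assumes "Vector_Spaces.linear sv t h" "Vector_Spaces.linear sv t h'" "\<And>\<beta>. \<beta> \<in> R \<Longrightarrow> h \<beta> = h' \<beta>"
  shows "h x = h' x"
proof -
  interpret vector_space_pair sv t
    using assms(1) unfolding vector_space_pair_def linear_iff by blast
  have "x \<in> module.span sv R" using span_R by simp
  then show ?thesis using linear_eq_on_span[OF assms(1,2)] assms(3) by blast
qed

text \<open>Two coroots of \<alpha> give two reflections, whose composite translates \<delta> by (h'
  \<delta> - h \<delta>) \<alpha>. Both forms take the value 2 at \<alpha>, so the translation
  amount stays constant under iteration. If it were nonzero, a root would have an infinite orbit in
  the finite set R.\<close>

lemma is_coroot_unique:
  assumes h: "is_coroot sv R \<alpha> h" and h': "is_coroot sv R \<alpha> h'"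
  shows "h = h'"
proof
  fix x
  have "h \<beta> = h' \<beta>" if "\<beta> \<in> R" for \<beta>
  proof (rule ccontr)
    assume ne: "h \<beta> \<noteq> h' \<beta>"
    define g where "g = h' \<beta> - h \<beta>"
    have step: "\<delta> + sv (h' \<delta> - h \<delta>) \<alpha> \<in> R" if "\<delta> \<in> R" for \<delta>
    proof -
      have "\<delta> - sv (h' \<delta>) \<alpha> \<in> R" using h' that unfolding is_coroot_def by blast
      then have "(\<delta> - sv (h' \<delta>) \<alpha>) - sv (h (\<delta> - sv (h' \<delta>) \<alpha>)) \<alpha> \<in> R"
        using h unfolding is_coroot_def by blast
      moreover have "(\<delta> - sv (h' \<delta>) \<alpha>) - sv (h (\<delta> - sv (h' \<delta>) \<alpha>)) \<alpha> = \<delta> + sv (h' \<delta> - h \<delta>) \<alpha>"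
      proof -
        have c: "h' \<delta> + (h \<delta> - h' \<delta> * 2) = - (h' \<delta> - h \<delta>)" by simp
        have "(\<delta> - sv (h' \<delta>) \<alpha>) - sv (h \<delta> - h' \<delta> * 2) \<alpha> = \<delta> - sv (h' \<delta> + (h \<delta> - h' \<delta> * 2)) \<alpha>"
          by (simp only: V.scale_left_distrib diff_diff_eq)
        then show ?thesis
          unfolding coroot_linear[OF h] c by (simp only: V.scale_minus_left diff_minus_eq_add)
      qed
      ultimately show ?thesis by simp
    qed
    have "\<beta> + sv (of_nat n * g) \<alpha> \<in> R" for n :: nat
    proof (induction n)
      case (Suc n)
      let ?d = "\<beta> + sv (of_nat n * g) \<alpha>"
      have "h' ?d - h ?d = g"
        unfolding coroot_linear[OF h] coroot_linear[OF h'] g_def by simp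
      then show ?case using step[OF Suc] by (simp add: V.scale_left_distrib algebra_simps)
    qed (use that in simp)
    then have "range (\<lambda>n::nat. \<beta> + sv (of_nat n * g) \<alpha>) \<subseteq> R" by blast
    then have "finite (range (\<lambda>n::nat. \<beta> + sv (of_nat n * g) \<alpha>))"
      using finite_R finite_subset by blast
    moreover have "\<alpha> \<noteq> 0" using coroot_linear[OF h] by force
    moreover have "g \<noteq> 0" using ne g_def by simp
    ultimately have "finite (UNIV :: nat set)"
      by (elim finite_imageD) (simp add: inj_on_def V.scale_right_imp_eq)
    then show False by simp
  qed
  then show "h x = h' x"
    using linear_eq_on_R[of "(*)" h h' x] h h' unfolding is_coroot_def by simp
qed

lemma is_coroot_cr: "\<alpha> \<in> R \<Longrightarrow> is_coroot sv R \<alpha> (cr \<alpha>)"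
  and cr_Ints: "\<alpha> \<in> R \<Longrightarrow> \<beta> \<in> R \<Longrightarrow> cr \<alpha> \<beta> \<in> \<int>"
proof -
  assume \<alpha>: "\<alpha> \<in> R"
  have "root_system sv R"
    using irreducible unfolding irreducible_root_system_def by simp
  then obtain h where h: "is_coroot sv R \<alpha> h" "\<forall>\<beta>\<in>R. h \<beta> \<in> \<int>"
    using \<alpha> unfolding root_system_def by meson
  have eq: "cr \<alpha> = h"
    unfolding coroot_def R_def[symmetric]
    by (rule the_equality) (rule h, erule is_coroot_unique[OF _ h(1)])
  show "is_coroot sv R \<alpha> (cr \<alpha>)" using h eq by simp
  show "\<beta> \<in> R \<Longrightarrow> cr \<alpha> \<beta> \<in> \<int>" using h eq by simp
qed

lemma cr_eqI: "\<alpha> \<in> R \<Longrightarrow> is_coroot sv R \<alpha> h \<Longrightarrow> cr \<alpha> = h"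
  by (rule is_coroot_unique[OF is_coroot_cr])

lemmas cr_linear = coroot_linear[OF is_coroot_cr]

lemma cr_linear': "\<alpha> \<in> R \<Longrightarrow> Vector_Spaces.linear sv (*) (cr \<alpha>)"
  using is_coroot_cr unfolding is_coroot_def by blast

lemma cr_Ints_lattice:
  assumes "\<alpha> \<in> R" "\<beta> \<in> QQ"
  shows "cr \<alpha> \<beta> \<in> \<int>"
  using assms(2)
proof (induction \<beta> rule: root_lattice_induct)
  case (root x)
  then show ?case
    using cr_Ints[OF assms(1), of x] by (cases "x = 0") (auto simp: cr_linear[OF assms(1)] R_def)
qed (auto simp: cr_linear[OF assms(1)])

section \<open>Reflections and the Weyl group\<close>

definition "reflect \<alpha> \<beta> = \<beta> - sv (cr \<alpha> \<beta>) \<alpha>"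

lemma reflect_in_R: "\<alpha> \<in> R \<Longrightarrow> \<beta> \<in> R \<Longrightarrow> reflect \<alpha> \<beta> \<in> R"
  using is_coroot_cr unfolding is_coroot_def reflect_def by blast

lemma reflect_linear:
  assumes "\<alpha> \<in> R"
  shows "Vector_Spaces.linear sv sv (reflect \<alpha>)"
  unfolding linear_iff reflect_def
  by (simp add: V.vector_space_axioms algebra_simps cr_linear[OF assms] V.scale_left_distrib V.scale_right_diff_distrib)

lemma reflect_reflect:
  assumes "\<alpha> \<in> R"
  shows "reflect \<alpha> (reflect \<alpha> x) = x"
proof -
  have c: "cr \<alpha> x + (cr \<alpha> x - cr \<alpha> x * 2) = 0" by simp
  have "reflect \<alpha> (reflect \<alpha> x) = x - (sv (cr \<alpha> x) \<alpha> + sv (cr \<alpha> x - cr \<alpha> x * 2) \<alpha>)"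
    by (simp only: reflect_def cr_linear[OF assms] diff_diff_eq)
  then show ?thesis by (simp only: V.scale_left_distrib[symmetric] c V.scale_zero_left diff_zero)
qed

lemma reflect_self: "\<alpha> \<in> R \<Longrightarrow> reflect \<alpha> \<alpha> = - \<alpha>"
  using V.scale_left_distrib[of 1 1 \<alpha>] by (simp add: reflect_def cr_linear)

text \<open>Words grow on the right: for an additive f, passing from f \<circ> g to f \<circ> g
  \<circ> \<open>reflect \<alpha>\<close> changes the value at \<beta> by a multiple of the coroot
  value of \<alpha> at \<beta>. This closure and finiteness suffice, so no group structure is set
  up.\<close>

inductive_set Weyl where
  id: "(\<lambda>x. x) \<in> Weyl"
| comp: "g \<in> Weyl \<Longrightarrow> \<alpha> \<in> R \<Longrightarrow> (\<lambda>x. g (reflect \<alpha> x)) \<in> Weyl"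

lemma Weyl_linear: "g \<in> Weyl \<Longrightarrow> Vector_Spaces.linear sv sv g"
proof (induction rule: Weyl.induct)
  case (comp g \<alpha>)
  then show ?case using reflect_linear[of \<alpha>] unfolding linear_iff by simp
qed (simp add: V.linear_ident)

lemma Weyl_R: "g \<in> Weyl \<Longrightarrow> \<beta> \<in> R \<Longrightarrow> g \<beta> \<in> R"
  by (induction arbitrary: \<beta> rule: Weyl.induct) (auto simp: reflect_in_R)

lemma Weyl_lattice: assumes "g \<in> Weyl" "x \<in> QQ" shows "g x \<in> QQ"
proof -
  interpret g: Vector_Spaces.linear sv sv g using assms Weyl_linear by blast
  show ?thesis using assms(2)
  proof (induction rule: root_lattice_induct)
    case (root x)
    then have "x = 0 \<or> x \<in> R" by (auto simp: R_def)
    moreover have "g x \<in> QQ" if "x \<in> R" using Weyl_R[OF assms(1) that] by (auto simp: R_def)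
    ultimately show ?case by auto
  qed (auto simp: g.diff)
qed

text \<open>Each element maps R into R and, R being a spanning set, is determined by its graph on
  R.\<close>

lemma finite_Weyl: "finite Weyl"
proof (rule finite_imageD)
  let ?G = "\<lambda>g. {(x, g x) | x. x \<in> R}"
  have "?G ` Weyl \<subseteq> Pow (R \<times> R)" using Weyl_R by auto
  then show "finite (?G ` Weyl)" using finite_R by (meson finite_Pow_iff finite_SigmaI finite_subset)
  show "inj_on ?G Weyl"
  proof (rule inj_onI, rule ext)
    fix g g' x assume g: "g \<in> Weyl" "g' \<in> Weyl" "?G g = ?G g'"
    have "g \<beta> = g' \<beta>" if "\<beta> \<in> R" for \<beta>
    proof -
      have "(\<beta>, g \<beta>) \<in> ?G g'" using g(3) that by blast
      then show ?thesis by simp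
    qed
    then show "g x = g' x" using linear_eq_on_R Weyl_linear g by blast
  qed
qed

lemma Weyl_zero: assumes "g \<in> Weyl" shows "g 0 = 0"
proof -
  interpret g: Vector_Spaces.linear sv sv g using assms by (rule Weyl_linear)
  show ?thesis by (rule g.zero)
qed

lemma Weyl_sum_zero:
  fixes sc :: "'f \<Rightarrow> 'a::ab_group_add \<Rightarrow> 'a"
    and f :: "'v \<Rightarrow> 'a"
  assumes "vector_space sc" "group_hom_on QQ f" "x \<in> QQ"
  shows "(\<Sum>g\<in>Weyl. f (g x)) = 0"
  using assms(3)
proof (induction x rule: root_lattice_induct)
  case zero
  show ?case by (simp add: Weyl_zero group_hom_on_zero[OF assms(2) subspace_root_lattice])
next
  case (root x)
  interpret W: vector_space sc by fact
  show ?case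
  proof (cases "x = 0")
    case True
    then show ?thesis by (simp add: Weyl_zero group_hom_on_zero[OF assms(2) subspace_root_lattice])
  next
    case False
    then have x: "x \<in> R" using root by (simp add: R_def)
    \<comment> \<open>Composing on the right with the involution \<open>reflect x\<close> permutes
      the Weyl group.\<close>
    have "(\<Sum>g\<in>Weyl. f (g x)) = (\<Sum>g\<in>Weyl. f (g (reflect x x)))"
      by (rule sum.reindex_bij_witness[of _ "\<lambda>g y. g (reflect x y)" "\<lambda>g y. g (reflect x y)"])
         (auto simp: reflect_reflect x intro: Weyl.comp)
    also have "\<dots> = (\<Sum>g\<in>Weyl. - f (g x))"
    proof (rule sum.cong[OF HOL.refl])
      fix g assume g: "g \<in> Weyl"
      interpret g: Vector_Spaces.linear sv sv g using g Weyl_linear by blast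
      have "g x \<in> QQ" using Weyl_lattice[OF g] x unfolding R_def by blast
      then show "f (g (reflect x x)) = - f (g x)"
        using group_hom_on_minus[OF assms(2) subspace_root_lattice] by (simp add: reflect_self[OF x] g.neg)
    qed
    finally have "(\<Sum>g\<in>Weyl. f (g x)) + (\<Sum>g\<in>Weyl. f (g x)) = 0"
      by (simp add: sum_negf eq_neg_iff_add_eq_0)
    then have "sc 2 (\<Sum>g\<in>Weyl. f (g x)) = 0"
      using W.scale_left_distrib[of 1 1] by simp
    then show ?thesis by simp
  qed
next
  case (diff x y)
  have "(\<Sum>g\<in>Weyl. f (g (x - y))) = (\<Sum>g\<in>Weyl. f (g x) - f (g y))"
  proof (rule sum.cong[OF HOL.refl])
    fix g assume g: "g \<in> Weyl"
    interpret g: Vector_Spaces.linear sv sv g using g Weyl_linear by blast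
    show "f (g (x - y)) = f (g x) - f (g y)"
      using group_hom_on_diff[OF assms(2) subspace_root_lattice] Weyl_lattice[OF g] diff by (simp add: g.diff)
  qed
  then show ?case using diff by (simp add: sum_subtractf)
qed

text \<open>Induction on the word g. The subspace A records where the coefficients lie; with A the
  centroid elements of one degree, this later fixes the degree of \<open>psi\<close>.\<close>

lemma Weyl_telescope:
  assumes sc: "vector_space sc" and f: "group_hom_on QQ f" and A: "module.subspace sc A"
    and fA: "\<And>\<beta>. \<beta> \<in> QQ \<Longrightarrow> f \<beta> \<in> A" and g: "g \<in> Weyl"
  shows "\<exists>u. (\<forall>\<alpha>. u \<alpha> \<in> A) \<and> (\<forall>\<beta>\<in>QQ. f \<beta> - f (g \<beta>) = (\<Sum>\<alpha>\<in>R. sc (cr \<alpha> \<beta>) (u \<alpha>)))"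
  using g
proof (induction rule: Weyl.induct)
  interpret W: vector_space sc by fact
  case id
  show ?case by (rule exI[of _ "\<lambda>_. 0"]) (simp add: W.subspace_0[OF A])
next
  interpret W: vector_space sc by fact
  note hom = group_hom_on_rules[OF f subspace_root_lattice]
  case (comp g \<alpha>)
  then obtain u where u: "\<forall>\<alpha>. u \<alpha> \<in> A" "\<forall>\<beta>\<in>QQ. f \<beta> - f (g \<beta>) = (\<Sum>\<alpha>\<in>R. sc (cr \<alpha> \<beta>) (u \<alpha>))"
    by blast
  interpret g: Vector_Spaces.linear sv sv g using comp Weyl_linear by blast
  have \<alpha>Q: "\<alpha> \<in> QQ" using comp by (auto simp: R_def)
  \<comment> \<open>Only the coefficient at \<alpha> changes: the reflection subtracts from \<beta>
    an integer multiple of \<alpha>, so f (g \<beta>) drops by the same multiple of f (g \<alpha>).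
    Integrality matters because f is only additive.\<close>
  let ?u = "u(\<alpha> := u \<alpha> + f (g \<alpha>))"
  have "f \<beta> - f (g (reflect \<alpha> \<beta>)) = (\<Sum>\<gamma>\<in>R. sc (cr \<gamma> \<beta>) (?u \<gamma>))" if \<beta>: "\<beta> \<in> QQ" for \<beta>
  proof -
    obtain n where n: "cr \<alpha> \<beta> = of_int n" using cr_Ints_lattice[OF comp(2) \<beta>] by (elim Ints_cases)
    have z: "g (reflect \<alpha> \<beta>) = g \<beta> - zmul n (g \<alpha>)"
      by (simp add: reflect_def g.diff g.scale n flip: scale_of_int[OF V.vector_space_axioms])
    have "f (g (reflect \<alpha> \<beta>)) = f (g \<beta>) - zmul n (f (g \<alpha>))"
      using \<alpha>Q \<beta> Weyl_lattice[OF comp(1)] unfolding z by (subst hom) (auto simp: hom)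
    then have "f \<beta> - f (g (reflect \<alpha> \<beta>)) = (f \<beta> - f (g \<beta>)) + sc (cr \<alpha> \<beta>) (f (g \<alpha>))"
      by (simp add: n scale_of_int[OF sc])
    also have "\<dots> = (\<Sum>\<gamma>\<in>R. sc (cr \<gamma> \<beta>) (u \<gamma>)) + (\<Sum>\<gamma>\<in>R. if \<gamma> = \<alpha> then sc (cr \<alpha> \<beta>) (f (g \<alpha>)) else 0)"
      using u \<beta> comp finite_R by simp
    also have "\<dots> = (\<Sum>\<gamma>\<in>R. sc (cr \<gamma> \<beta>) (?u \<gamma>))"
      unfolding sum.distrib[symmetric] by (rule sum.cong) (auto simp: W.scale_right_distrib)
    finally show ?thesis .
  qed
  moreover have "\<forall>\<gamma>. ?u \<gamma> \<in> A"
    using u(1) fA[OF Weyl_lattice[OF comp(1) \<alpha>Q]] W.subspace_add[OF A] by simp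
  ultimately show ?case by blast
qed

text \<open>The average of a homomorphism \<open>f\<close> over the Weyl group vanishes, because a reflection negates
  its root, while each \<open>f - f \<circ> g\<close> is a combination of coroots.\<close>

lemma hom_coroot_combination:
  assumes sc: "vector_space sc" and f: "group_hom_on QQ f" and A: "module.subspace sc A"
    and fA: "\<And>\<beta>. \<beta> \<in> QQ \<Longrightarrow> f \<beta> \<in> A"
  obtains u where "\<And>\<alpha>. u \<alpha> \<in> A"
    and "\<And>\<beta>. \<beta> \<in> QQ \<Longrightarrow> f \<beta> = (\<Sum>\<alpha>\<in>R. sc (cr \<alpha> \<beta>) (u \<alpha>))"
proof -
  interpret W: vector_space sc by fact
  from Weyl_telescope[OF assms] obtain u where
    u: "\<And>g. g \<in> Weyl \<Longrightarrow> (\<forall>\<alpha>. u g \<alpha> \<in> A) \<and> (\<forall>\<beta>\<in>QQ. f \<beta> - f (g \<beta>) = (\<Sum>\<alpha>\<in>R. sc (cr \<alpha> \<beta>) (u g \<alpha>)))"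
    by metis
  define N where "N = (of_nat (card Weyl) :: 'f)"
  have N: "N \<noteq> 0" using Weyl.id finite_Weyl by (auto simp: N_def card_eq_0_iff)
  define v where "v \<alpha> = sc (1 / N) (\<Sum>g\<in>Weyl. u g \<alpha>)" for \<alpha>
  show ?thesis
  proof (rule that[of v])
    show "v \<alpha> \<in> A" for \<alpha>
      using u unfolding v_def by (intro W.subspace_scale[OF A] W.subspace_sum[OF A]) auto
    show "f \<beta> = (\<Sum>\<alpha>\<in>R. sc (cr \<alpha> \<beta>) (v \<alpha>))" if \<beta>: "\<beta> \<in> QQ" for \<beta>
    proof -
      have "sc N (f \<beta>) = (\<Sum>g\<in>Weyl. f \<beta> - f (g \<beta>))"
        by (simp add: sum_subtractf Weyl_sum_zero[OF sc f \<beta>] N_def W.sum_constant_scale)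
      also have "\<dots> = (\<Sum>g\<in>Weyl. \<Sum>\<alpha>\<in>R. sc (cr \<alpha> \<beta>) (u g \<alpha>))"
        using u \<beta> by (intro sum.cong) auto
      also have "\<dots> = (\<Sum>\<alpha>\<in>R. sc N (sc (cr \<alpha> \<beta>) (v \<alpha>)))"
        by (subst sum.swap) (simp add: v_def W.scale_sum_right N mult.commute)
      also have "\<dots> = sc N (\<Sum>\<alpha>\<in>R. sc (cr \<alpha> \<beta>) (v \<alpha>))" by (simp only: W.scale_sum_right)
      finally show ?thesis using N by simp
    qed
  qed
qed

text \<open>Applied to the identity map, the coroot expansion recovers each root from its coroot
  values. By linearity it holds for all vectors, so one with vanishing coroot values is
  zero.\<close>

lemma coroots_separate:
  assumes "\<And>\<alpha>. \<alpha> \<in> R \<Longrightarrow> cr \<alpha> x = 0"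
  shows "x = 0"
proof -
  have "group_hom_on QQ (\<lambda>x. x)" by (simp add: group_hom_on_def)
  then obtain u where u: "\<And>\<beta>. \<beta> \<in> QQ \<Longrightarrow> \<beta> = (\<Sum>\<alpha>\<in>R. sv (cr \<alpha> \<beta>) (u \<alpha>))"
    using hom_coroot_combination[of sv "\<lambda>x. x" UNIV] V.vector_space_axioms V.subspace_UNIV by auto
  have lin: "Vector_Spaces.linear sv sv (\<lambda>x. \<Sum>\<alpha>\<in>R. sv (cr \<alpha> x) (u \<alpha>))"
    unfolding linear_iff
    by (simp add: V.vector_space_axioms cr_linear V.scale_left_distrib sum.distrib V.scale_sum_right)
  have "x = (\<Sum>\<alpha>\<in>R. sv (cr \<alpha> x) (u \<alpha>))"
    by (rule linear_eq_on_R[OF V.linear_ident lin], rule u) (auto simp: R_def)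
  then show ?thesis using assms by simp
qed

text \<open>This replaces an invariant inner product. If \<open>reflect \<alpha>\<close> fixes
  \<beta>, then composing the coroot of \<beta> with it gives again a coroot of \<beta>, hence the
  same one. Evaluation at \<alpha>, which is negated, gives a value equal to its own
  negative.\<close>

lemma orthogonal_sym:
  assumes "\<alpha> \<in> R" "\<beta> \<in> R" "cr \<alpha> \<beta> = 0"
  shows "cr \<beta> \<alpha> = 0"
proof -
  interpret r: Vector_Spaces.linear sv sv "reflect \<alpha>" by (rule reflect_linear[OF assms(1)])
  have fixd: "reflect \<alpha> \<beta> = \<beta>" by (simp add: reflect_def assms)
  have "is_coroot sv R \<beta> (\<lambda>x. cr \<beta> (reflect \<alpha> x))"
    unfolding is_coroot_def
  proof (intro conjI ballI)
    show "Vector_Spaces.linear sv (*) (\<lambda>x. cr \<beta> (reflect \<alpha> x))"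
      using cr_linear'[OF assms(2)] reflect_linear[OF assms(1)] unfolding linear_iff by simp
    show "cr \<beta> (reflect \<alpha> \<beta>) = 2" by (simp add: fixd cr_linear assms)
    fix \<delta> assume \<delta>: "\<delta> \<in> R"
    have "reflect \<alpha> (reflect \<beta> (reflect \<alpha> \<delta>)) \<in> R" using assms \<delta> reflect_in_R by blast
    also have "reflect \<alpha> (reflect \<beta> (reflect \<alpha> \<delta>)) = \<delta> - sv (cr \<beta> (reflect \<alpha> \<delta>)) \<beta>"
      by (subst (2) reflect_def) (simp add: r.diff r.scale fixd reflect_reflect assms)
    finally show "\<delta> - sv (cr \<beta> (reflect \<alpha> \<delta>)) \<beta> \<in> R" .
  qed
  then have "cr \<beta> = (\<lambda>x. cr \<beta> (reflect \<alpha> x))" using cr_eqI assms by blast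
  then have "cr \<beta> \<alpha> = - cr \<beta> \<alpha>"
    by (metis reflect_self assms(1,2) cr_linear(4))
  then have "cr \<beta> \<alpha> + cr \<beta> \<alpha> = 0" by (metis add.right_inverse)
  then show ?thesis by (simp add: mult_2[symmetric])
qed

text \<open>The form in which irreducibility is used. A set of roots closed under non-orthogonality
  is orthogonal to its complement; both parts are root systems, and their spans meet only in 0
  because a common vector is killed by every coroot.\<close>

lemma closed_component:
  assumes X: "X \<subseteq> R" "X \<noteq> {}" and closed: "\<And>\<alpha> \<beta>. \<alpha> \<in> X \<Longrightarrow> \<beta> \<in> R \<Longrightarrow> cr \<alpha> \<beta> \<noteq> 0 \<Longrightarrow> \<beta> \<in> X"
  shows "X = R"
proof (rule ccontr)
  assume "X \<noteq> R"
  define Y where "Y = R - X"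
  have Y: "Y \<subseteq> R" "Y \<noteq> {}" "X \<inter> Y = {}" "R = X \<union> Y" using X \<open>X \<noteq> R\<close> by (auto simp: Y_def)
  have orth: "cr \<alpha> \<beta> = 0" "cr \<beta> \<alpha> = 0" if "\<alpha> \<in> X" "\<beta> \<in> Y" for \<alpha> \<beta>
    using closed[of \<alpha> \<beta>] orthogonal_sym[of \<alpha> \<beta>] that X Y by auto
  have rs: "root_system sv Z" if Z: "Z \<union> Z' = R" "Z \<inter> Z' = {}" and o: "\<And>\<alpha> \<beta>. \<alpha> \<in> Z \<Longrightarrow> \<beta> \<in> Z' \<Longrightarrow> cr \<alpha> \<beta> = 0" for Z Z'
    unfolding root_system_def
  proof (intro conjI ballI)
    show "finite Z" "0 \<notin> Z" using Z(1) finite_R zero_notin_R finite_subset[of Z R] by auto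
    fix \<alpha> assume \<alpha>: "\<alpha> \<in> Z"
    then have \<alpha>R: "\<alpha> \<in> R" using Z by blast
    \<comment> \<open>A reflected root falling into Z' would be orthogonal to \<alpha>, hence fixed
      by the reflection, and \<beta> itself would lie in Z'.\<close>
    have "reflect \<alpha> \<beta> \<in> Z" if "\<beta> \<in> Z" for \<beta>
    proof (rule ccontr)
      assume n: "reflect \<alpha> \<beta> \<notin> Z"
      then have n': "reflect \<alpha> \<beta> \<in> Z'" using reflect_in_R[of \<alpha> \<beta>] that \<alpha>R Z by blast
      then have "reflect \<alpha> (reflect \<alpha> \<beta>) = reflect \<alpha> \<beta>" using o[OF \<alpha>] by (simp add: reflect_def[of \<alpha> "reflect \<alpha> \<beta>"])
      then show False using reflect_reflect[OF \<alpha>R] n' that Z by (metis IntI empty_iff)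
    qed
    then have "is_coroot sv Z \<alpha> (cr \<alpha>)"
      using is_coroot_cr[OF \<alpha>R] unfolding is_coroot_def reflect_def by blast
    then show "\<exists>h. is_coroot sv Z \<alpha> h \<and> (\<forall>\<beta>\<in>Z. h \<beta> \<in> \<int>)" using cr_Ints[OF \<alpha>R] Z by blast
  qed
  have "root_system sv X" "root_system sv Y"
    using rs[of X Y] rs[of Y X] Y orth by auto
  moreover have "module.span sv X \<inter> module.span sv Y = {0}"
  proof -
    have sub: "cr \<alpha> x = 0" if "x \<in> module.span sv Z" "\<alpha> \<in> R" "\<And>\<beta>. \<beta> \<in> Z \<Longrightarrow> cr \<alpha> \<beta> = 0" for \<alpha> x Z
    proof -
      interpret l: Vector_Spaces.linear sv "(*)" "cr \<alpha>" by (rule cr_linear'[OF that(2)])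
      show ?thesis using l.eq_0_on_span[of Z x] that by blast
    qed
    have "x = 0" if "x \<in> module.span sv X" "x \<in> module.span sv Y" for x
    proof (rule coroots_separate)
      fix \<alpha> assume \<alpha>: "\<alpha> \<in> R"
      then consider "\<alpha> \<in> X" | "\<alpha> \<in> Y" using Y(4) by blast
      then show "cr \<alpha> x = 0"
        by cases (use sub[OF that(1) \<alpha>] sub[OF that(2) \<alpha>] orth in auto)
    qed
    then show ?thesis using V.span_zero by blast
  qed
  ultimately show False
    using irreducible X(2) Y(2,4) unfolding irreducible_root_system_def by metis
qed

text \<open>Vectors of degree 0 are guaranteed only for indivisible roots. This reduces a divisible
  root to its half, whose coroot is twice as large. The half is indivisible, because for a root
  \<alpha>/4 the integer \<open>cr \<alpha>\<close> at \<alpha>/4 would be 1/2.\<close>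

lemma indivisible_or_half:
  assumes "\<alpha> \<in> R"
  shows "\<alpha> \<in> indivisible sv \<Delta> - {0} \<or>
    sv (1/2) \<alpha> \<in> indivisible sv \<Delta> - {0} \<and> sv (1/2) \<alpha> \<in> R \<and> cr (sv (1/2) \<alpha>) = (\<lambda>x. 2 * cr \<alpha> x)"
proof (cases "sv (1/2) \<alpha> \<in> \<Delta>")
  case False
  then show ?thesis using assms by (auto simp: indivisible_def R_def)
next
  case True
  define \<beta> where "\<beta> = sv (1/2) \<alpha>"
  have \<alpha>: "\<alpha> = sv 2 \<beta>" by (simp add: \<beta>_def)
  have \<beta>: "\<beta> \<in> R" using True assms by (auto simp: \<beta>_def R_def)
  have half: "cr \<gamma> = (\<lambda>x. cr (sv 2 \<gamma>) x * 2)" if "\<gamma> \<in> R" "sv 2 \<gamma> \<in> R" for \<gamma>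
  proof (rule cr_eqI[OF that(1)])
    have *: "cr (sv 2 \<gamma>) (sv 2 \<gamma>) = 2" using cr_linear(6) that(2) by blast
    show "is_coroot sv R \<gamma> (\<lambda>x. cr (sv 2 \<gamma>) x * 2)"
      using cr_linear'[OF that(2)] * is_coroot_cr[OF that(2)] unfolding is_coroot_def
      unfolding linear_iff by (simp add: algebra_simps cr_linear[OF that(2)])
  qed
  have "sv (1/2) \<beta> \<notin> \<Delta>"
  proof
    assume "sv (1/2) \<beta> \<in> \<Delta>"
    define \<gamma> where "\<gamma> = sv (1/2) \<beta>"
    have g: "\<gamma> \<in> R" "\<beta> = sv 2 \<gamma>" using \<open>sv (1/2) \<beta> \<in> \<Delta>\<close> \<beta> by (auto simp: \<gamma>_def R_def)
    have "cr \<gamma> \<gamma> = cr \<alpha> \<gamma> * 2 * 2" using half[of \<gamma>] half[of \<beta>] g \<beta> \<alpha> assms by metis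
    then have "cr \<alpha> \<gamma> * 4 = 2" using cr_linear(6)[OF g(1)] by simp
    moreover obtain n where "cr \<alpha> \<gamma> = of_int n" using cr_Ints[OF assms g(1)] by (elim Ints_cases)
    ultimately have "(of_int (n * 4) :: 'f) = of_int 2" by simp
    then have "n * 4 = 2" by (simp only: of_int_eq_iff)
    then show False by presburger
  qed
  then show ?thesis using \<beta> half[of \<beta>] assms \<alpha> unfolding \<beta>_def[symmetric]
    by (auto simp: indivisible_def R_def mult.commute)
qed

lemma indivisible_subset_R: "indivisible sv \<Delta> - {0} \<subseteq> R"
  by (auto simp: indivisible_def R_def)

lemma indivisible_exists: "\<exists>\<alpha>. \<alpha> \<in> indivisible sv \<Delta> - {0}"
  using R_nonempty indivisible_or_half by blast

end

section \<open>Direct sums\<close>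

text \<open>The body repeats the unique existence clause of \<open>direct_sum\<close>, so that its
  properties are those of a definite description.\<close>

definition decomp :: "'i set \<Rightarrow> ('i \<Rightarrow> 'a::ab_group_add set) \<Rightarrow> 'a \<Rightarrow> 'i \<Rightarrow> 'a" where
  "decomp I A x = (THE u. (\<forall>i\<in>I. u i \<in> A i) \<and> (\<forall>i. i \<notin> I \<longrightarrow> u i = 0) \<and>
                 finite {i. u i \<noteq> 0} \<and> x = sum u {i. u i \<noteq> 0})"

lemma sum_support_superset:
  "finite F \<Longrightarrow> {i. u i \<noteq> 0} \<subseteq> F \<Longrightarrow> sum u {i. u i \<noteq> 0} = sum u F"
  by (rule sum.mono_neutral_left) auto

locale dsum = vector_space s for s :: "'f::field \<Rightarrow> 'a::ab_group_add \<Rightarrow> 'a" +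
  fixes I :: "'i set" and A W
  assumes dsum: "direct_sum s I A W"
begin

lemma subspace_W: "subspace W"
  and subspace_A: "i \<in> I \<Longrightarrow> subspace (A i)"
  and A_subset: "i \<in> I \<Longrightarrow> A i \<subseteq> W"
  using dsum unfolding direct_sum_def by simp_all

lemma decomp_ex1:
  assumes "x \<in> W"
  shows "\<exists>!u. (\<forall>i\<in>I. u i \<in> A i) \<and> (\<forall>i. i \<notin> I \<longrightarrow> u i = 0) \<and>
              finite {i. u i \<noteq> 0} \<and> x = sum u {i. u i \<noteq> 0}"
  using dsum assms unfolding direct_sum_def by simp

lemma
  assumes "x \<in> W"
  shows decomp_in: "i \<in> I \<Longrightarrow> decomp I A x i \<in> A i"
    and decomp_out: "i \<notin> I \<Longrightarrow> decomp I A x i = 0"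
    and finite_decomp: "finite {i. decomp I A x i \<noteq> 0}"
    and sum_decomp: "sum (decomp I A x) {i. decomp I A x i \<noteq> 0} = x"
  using theI'[OF decomp_ex1[OF assms]] unfolding decomp_def[symmetric] by auto

lemma decomp_unique:
  assumes "x \<in> W" and "\<And>i. i \<in> I \<Longrightarrow> u i \<in> A i" and "\<And>i. i \<notin> I \<Longrightarrow> u i = 0"
    and "finite F" "{i. u i \<noteq> 0} \<subseteq> F" "x = sum u F"
  shows "decomp I A x = u"
  unfolding decomp_def
proof (rule the1_equality[OF decomp_ex1[OF assms(1)]], intro conjI)
  show "finite {i. u i \<noteq> 0}" using assms(4,5) finite_subset by blast
  show "x = sum u {i. u i \<noteq> 0}" using sum_support_superset[OF assms(4,5)] assms(6) by simp
qed (use assms in auto)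

lemma decomp_add:
  assumes "x \<in> W" "y \<in> W"
  shows "decomp I A (x + y) i = decomp I A x i + decomp I A y i"
proof -
  let ?F = "{i. decomp I A x i \<noteq> 0} \<union> {i. decomp I A y i \<noteq> 0}"
  have fin: "finite ?F" using finite_decomp assms by simp
  have "decomp I A (x + y) = (\<lambda>i. decomp I A x i + decomp I A y i)"
  proof (rule decomp_unique[where F = ?F])
    show "x + y \<in> W" using assms subspace_W subspace_add by blast
    show "x + y = (\<Sum>i\<in>?F. decomp I A x i + decomp I A y i)"
      using sum_support_superset[OF fin, of "decomp I A x"] sum_support_superset[OF fin, of "decomp I A y"]
        sum_decomp[OF assms(1)] sum_decomp[OF assms(2)] by (simp add: sum.distrib)
  qed (use fin decomp_in decomp_out assms subspace_A subspace_add in auto)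
  then show ?thesis by simp
qed

lemma decomp_scale:
  assumes "x \<in> W"
  shows "decomp I A (s c x) i = s c (decomp I A x i)"
proof -
  let ?F = "{i. decomp I A x i \<noteq> 0}"
  have "decomp I A (s c x) = (\<lambda>i. s c (decomp I A x i))"
  proof (rule decomp_unique[where F = ?F])
    show "s c x \<in> W" using assms subspace_W subspace_scale by blast
    show "s c x = (\<Sum>i\<in>?F. s c (decomp I A x i))"
      using sum_decomp[OF assms(1)] by (simp add: scale_sum_right[symmetric])
  qed (use finite_decomp decomp_in decomp_out assms subspace_A subspace_scale in auto)
  then show ?thesis by simp
qed

lemma decomp_homogeneous:
  assumes "i \<in> I" "x \<in> A i"
  shows "decomp I A x j = (if j = i then x else 0)"
proof -
  have "decomp I A x = (\<lambda>j. if j = i then x else 0)"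
    by (rule decomp_unique[where F = "{i}"])
       (use assms A_subset subspace_A subspace_0 in auto)
  then show ?thesis by simp
qed

lemma dsum_induct [consumes 1, case_names zero homogeneous add]:
  assumes "x \<in> W" and "P 0" and hom: "\<And>i x. i \<in> I \<Longrightarrow> x \<in> A i \<Longrightarrow> P x"
    and add: "\<And>x y. x \<in> W \<Longrightarrow> y \<in> W \<Longrightarrow> P x \<Longrightarrow> P y \<Longrightarrow> P (x + y)"
  shows "P x"
proof -
  have i: "decomp I A x i \<in> W \<and> P (decomp I A x i)" for i
    using decomp_in[OF assms(1), of i] decomp_out[OF assms(1), of i] hom A_subset[of i]
      subspace_0[OF subspace_W] \<open>P 0\<close> by (cases "i \<in> I") auto
  have "sum (decomp I A x) F \<in> W \<and> P (sum (decomp I A x) F)" if "finite F" for F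
    using that
    by (induction F rule: finite_induct)
       (use i add subspace_0[OF subspace_W] \<open>P 0\<close> subspace_add[OF subspace_W] in auto)
  then show ?thesis using finite_decomp[OF assms(1)] sum_decomp[OF assms(1)] by metis
qed

lemma homogeneous_if_decomp:
  assumes "x \<in> W" "i \<in> I" "\<And>j. j \<noteq> i \<Longrightarrow> decomp I A x j = 0"
  shows "x \<in> A i"
proof -
  have "{j. decomp I A x j \<noteq> 0} \<subseteq> {i}" using assms(3) by blast
  then have "x = decomp I A x i"
    using sum_decomp[OF assms(1)] sum_support_superset[of "{i}" "decomp I A x"] by simp
  then show ?thesis using decomp_in[OF assms(1,2)] by simp
qed

text \<open>Maps prescribed on the summands glue to one linear map. This is how degree derivations
  come into existence, with each G i a scalar.\<close>

lemma dsum_extend: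
  assumes W: "W = UNIV" and t: "vector_space t" and G: "\<And>i. i \<in> I \<Longrightarrow> Vector_Spaces.linear s t (G i)"
  obtains d where "Vector_Spaces.linear s t d" "\<And>i x. i \<in> I \<Longrightarrow> x \<in> A i \<Longrightarrow> d x = G i x"
proof -
  interpret t: vector_space t by fact
  define G' where "G' i = (if i \<in> I then G i else (\<lambda>_. 0))" for i
  define d where "d x = (\<Sum>i | decomp I A x i \<noteq> 0. G' i (decomp I A x i))" for x
  have G'add: "G' i (x + y) = G' i x + G' i y" and G'scale: "G' i (s c x) = t c (G' i x)"
    and G'0: "G' i 0 = 0" for i x y c
  proof -
    show "G' i (x + y) = G' i x + G' i y" "G' i (s c x) = t c (G' i x)" for x y c
      using G unfolding linear_iff G'_def by auto
    then show "G' i 0 = 0" by (metis add_cancel_right_right)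
  qed
  have d: "d x = (\<Sum>i\<in>F. G' i (decomp I A x i))" if "finite F" "{i. decomp I A x i \<noteq> 0} \<subseteq> F" for F x
    unfolding d_def by (rule sum.mono_neutral_left) (use that G'0 in auto)
  have "d (x + y) = d x + d y" for x y
  proof -
    let ?F = "{i. decomp I A x i \<noteq> 0} \<union> {i. decomp I A y i \<noteq> 0}"
    have dec: "decomp I A (x + y) i = decomp I A x i + decomp I A y i" for i
      using decomp_add W by simp
    have fin: "finite ?F" using finite_decomp W by simp
    have "d (x + y) = (\<Sum>i\<in>?F. G' i (decomp I A (x + y) i))"
      by (rule d[OF fin]) (auto simp: dec)
    also have "\<dots> = d x + d y"
      unfolding dec G'add sum.distrib using d[OF fin, of x] d[OF fin, of y] by simp
    finally show ?thesis .
  qed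
  moreover have "d (s c x) = t c (d x)" for c x
  proof -
    have dec: "decomp I A (s c x) i = s c (decomp I A x i)" for i
      using decomp_scale W by simp
    have fin: "finite {i. decomp I A x i \<noteq> 0}" using finite_decomp W by simp
    have "d (s c x) = (\<Sum>i | decomp I A x i \<noteq> 0. G' i (decomp I A (s c x) i))"
      by (rule d[OF fin]) (auto simp: dec)
    then show ?thesis by (simp add: dec G'scale d_def t.scale_sum_right)
  qed
  ultimately have "Vector_Spaces.linear s t d"
    unfolding linear_iff using t vector_space_axioms by blast
  moreover have "d x = G i x" if "i \<in> I" "x \<in> A i" for i x
  proof -
    have "d x = (\<Sum>j\<in>{i}. G' j (decomp I A x j))"
      by (rule d) (use decomp_homogeneous[OF that] in auto)
    then show ?thesis using decomp_homogeneous[OF that] that by (simp add: G'_def)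
  qed
  ultimately show ?thesis using that by blast
qed

end

section \<open>Centreless Lie tori\<close>

locale centreless_lie_torus =
  fixes L :: "('f::field_char_0, 'v::ab_group_add, 'g::ab_group_add, 'l::ab_group_add) graded_lie"
  assumes lie_torus: "lie_torus L" and centreless: "centreless L"
begin

abbreviation "sc \<equiv> lscale L"
abbreviation "br \<equiv> bracket L"
abbreviation "H \<equiv> homog L"
abbreviation "QL \<equiv> Qlat L"

sublocale Rt: root_sys "vscale L" "roots L"
  using lie_torus unfolding lie_torus_def root_sys_def by simp

lemma graded: "graded_lie_algebra L" using lie_torus unfolding lie_torus_def by simp

lemma lie: "lie_algebra sc br" using graded unfolding graded_lie_algebra_def by simp

sublocale V: vector_space sc using lie unfolding lie_algebra_def by simp

sublocale F: vector_space "pointwise sc"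
  by (rule vector_space_pointwise) (rule V.vector_space_axioms)

sublocale DS: dsum sc "QL \<times> UNIV" "\<lambda>(\<alpha>, \<kappa>). H \<alpha> \<kappa>" UNIV
  using graded unfolding graded_lie_algebra_def dsum_def dsum_axioms_def
  by (simp add: V.vector_space_axioms)

lemma br_linear:
  "br (x + y) z = br x z + br y z" "br z (x + y) = br z x + br z y"
  "br (sc c x) z = sc c (br x z)" "br z (sc c x) = sc c (br z x)"
  "br 0 z = 0" "br z 0 = 0" "br (- x) z = - br x z" "br z (- x) = - br z x"
  "br (x - y) z = br x z - br y z" "br z (x - y) = br z x - br z y"
proof -
  interpret l: Vector_Spaces.linear sc sc "br z" using lie unfolding lie_algebra_def by simp
  interpret r: Vector_Spaces.linear sc sc "\<lambda>x. br x z" using lie unfolding lie_algebra_def by simp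
  show "br (x + y) z = br x z + br y z" by (rule r.add)
  show "br z (x + y) = br z x + br z y" by (rule l.add)
  show "br (sc c x) z = sc c (br x z)" by (rule r.scale)
  show "br z (sc c x) = sc c (br z x)" by (rule l.scale)
  show "br 0 z = 0" by (rule r.zero)
  show "br z 0 = 0" by (rule l.zero)
  show "br (- x) z = - br x z" by (rule r.neg)
  show "br z (- x) = - br z x" by (rule l.neg)
  show "br (x - y) z = br x z - br y z" by (rule r.diff)
  show "br z (x - y) = br z x - br z y" by (rule l.diff)
qed

lemma br_self: "br x x = 0" using lie unfolding lie_algebra_def by simp

lemma br_anti: "br x y = - br y x"
proof -
  have "br x y + br y x = 0"
    using br_self[of "x + y"] unfolding br_linear(1,2) by (simp add: br_self add.commute)
  then show ?thesis by (simp add: eq_neg_iff_add_eq_0)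
qed

lemma jacobi: "br x (br y z) = br (br x y) z + br y (br x z)"
proof -
  have "br x (br y z) + br y (br z x) + br z (br x y) = 0"
    using lie unfolding lie_algebra_def by simp
  moreover have "br y (br z x) = - br y (br x z)" by (subst br_anti[of z x]) (simp add: br_linear)
  moreover have "br z (br x y) = - br (br x y) z" by (rule br_anti)
  ultimately show ?thesis by (simp add: algebra_simps)
qed

lemma H_subspace: "\<alpha> \<in> QL \<Longrightarrow> V.subspace (H \<alpha> \<kappa>)"
  using DS.subspace_A[of "(\<alpha>, \<kappa>)"] by simp

lemma H_br: "\<alpha> \<in> QL \<Longrightarrow> \<beta> \<in> QL \<Longrightarrow> x \<in> H \<alpha> \<kappa> \<Longrightarrow> y \<in> H \<beta> \<mu> \<Longrightarrow> br x y \<in> H (\<alpha> + \<beta>) (\<kappa> + \<mu>)"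
  using graded unfolding graded_lie_algebra_def by simp

definition "cmp \<alpha> \<kappa> x = decomp (QL \<times> UNIV) (\<lambda>(\<alpha>, \<kappa>). H \<alpha> \<kappa>) x (\<alpha>, \<kappa>)"

lemma cmp_in: "\<alpha> \<in> QL \<Longrightarrow> cmp \<alpha> \<kappa> x \<in> H \<alpha> \<kappa>"
  using DS.decomp_in[of x "(\<alpha>, \<kappa>)"] by (simp add: cmp_def)

lemma cmp_out: "\<alpha> \<notin> QL \<Longrightarrow> cmp \<alpha> \<kappa> x = 0"
  using DS.decomp_out[of x "(\<alpha>, \<kappa>)"] by (simp add: cmp_def)

lemma cmp_add: "cmp \<alpha> \<kappa> (x + y) = cmp \<alpha> \<kappa> x + cmp \<alpha> \<kappa> y"
  by (simp add: cmp_def DS.decomp_add)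

lemma cmp_scale: "cmp \<alpha> \<kappa> (sc c x) = sc c (cmp \<alpha> \<kappa> x)"
  by (simp add: cmp_def DS.decomp_scale)

lemma cmp_0: "cmp \<alpha> \<kappa> 0 = 0"
  using cmp_scale[of \<alpha> \<kappa> 0 0] by simp

lemma cmp_linear: "Vector_Spaces.linear sc sc (cmp \<alpha> \<kappa>)"
  unfolding linear_iff by (simp add: cmp_add cmp_scale V.vector_space_axioms)

lemma cmp_homogeneous:
  "\<alpha> \<in> QL \<Longrightarrow> x \<in> H \<alpha> \<kappa> \<Longrightarrow> cmp \<beta> \<mu> x = (if \<beta> = \<alpha> \<and> \<mu> = \<kappa> then x else 0)"
  using DS.decomp_homogeneous[of "(\<alpha>, \<kappa>)" x "(\<beta>, \<mu>)"] by (simp add: cmp_def)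

lemma homogeneous_if_cmp:
  assumes "\<alpha> \<in> QL" "\<And>\<beta> \<mu>. \<beta> \<noteq> \<alpha> \<or> \<mu> \<noteq> \<kappa> \<Longrightarrow> cmp \<beta> \<mu> x = 0"
  shows "x \<in> H \<alpha> \<kappa>"
  using DS.homogeneous_if_decomp[of x "(\<alpha>, \<kappa>)"] assms unfolding cmp_def by auto

lemma eq_0_if_cmp:
  assumes "\<And>\<beta> \<mu>. cmp \<beta> \<mu> x = 0"
  shows "x = 0"
proof -
  have "{i. decomp (QL \<times> UNIV) (\<lambda>(\<alpha>, \<kappa>). H \<alpha> \<kappa>) x i \<noteq> 0} = {}"
    using assms unfolding cmp_def by auto
  then show ?thesis using DS.sum_decomp[of x] by (metis UNIV_I sum.empty)
qed

lemma homog_induct [case_names zero homogeneous add]: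
  assumes "P 0" and "\<And>\<alpha> \<kappa> x. \<alpha> \<in> QL \<Longrightarrow> x \<in> H \<alpha> \<kappa> \<Longrightarrow> P x"
    and "\<And>x y. P x \<Longrightarrow> P y \<Longrightarrow> P (x + y)"
  shows "P x"
  using DS.dsum_induct[of x P] assms by auto

lemma homog_ext:
  assumes "Vector_Spaces.linear sc t f" "Vector_Spaces.linear sc t g"
    and "\<And>\<alpha> \<kappa> x. \<alpha> \<in> QL \<Longrightarrow> x \<in> H \<alpha> \<kappa> \<Longrightarrow> f x = g x"
  shows "f x = g x"
proof (induction x rule: homog_induct)
  case zero
  show ?case using assms(3)[of 0 0 0] H_subspace[of 0] V.subspace_0 by blast
next
  case (homogeneous \<alpha> \<kappa> x)
  then show ?case by (rule assms(3))
next
  case (add x y)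
  then show ?case using assms(1,2) unfolding linear_iff by simp
qed

lemma H_sub_root_space: "x \<in> H \<alpha> \<kappa> \<Longrightarrow> x \<in> root_space L \<alpha>"
  unfolding root_space_def by (rule V.span_base) blast

lemma H_sub_degree_space: "\<alpha> \<in> QL \<Longrightarrow> x \<in> H \<alpha> \<kappa> \<Longrightarrow> x \<in> degree_space L \<kappa>"
  unfolding degree_space_def by (rule V.span_base) blast

lemma cmp_degree_space:
  assumes "x \<in> degree_space L \<kappa>" "\<mu> \<noteq> \<kappa>"
  shows "cmp \<beta> \<mu> x = 0"
proof -
  interpret l: Vector_Spaces.linear sc sc "cmp \<beta> \<mu>" by (rule cmp_linear)
  show ?thesis
    by (rule l.eq_0_on_span[of "\<Union>\<alpha>\<in>QL. H \<alpha> \<kappa>"])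
      (use assms cmp_homogeneous in \<open>auto simp: degree_space_def\<close>)
qed

lemma H_outside: "\<alpha> \<in> QL \<Longrightarrow> \<alpha> \<notin> roots L \<Longrightarrow> x \<in> H \<alpha> \<kappa> \<Longrightarrow> x = 0"
  using lie_torus H_sub_root_space unfolding lie_torus_def by (metis Diff_iff singletonD)

lemma indivisible_nonzero: "\<alpha> \<in> indivisible (vscale L) (roots L) - {0} \<Longrightarrow> H \<alpha> 0 \<noteq> {0}"
  using lie_torus unfolding lie_torus_def by simp

lemma sl2:
  assumes "\<alpha> \<in> QL" "\<alpha> \<noteq> 0" "H \<alpha> \<kappa> \<noteq> {0}"
  obtains e f where "e \<in> H \<alpha> \<kappa>" "f \<in> H (- \<alpha>) (- \<kappa>)" "H \<alpha> \<kappa> = V.span {e}"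
    "H (- \<alpha>) (- \<kappa>) = V.span {f}"
    "\<And>\<beta> \<mu> x. \<beta> \<in> QL \<Longrightarrow> x \<in> H \<beta> \<mu> \<Longrightarrow> br (br e f) x = sc (Rt.cr \<alpha> \<beta>) x"
proof -
  have "\<exists>e\<in>H \<alpha> \<kappa>. \<exists>f\<in>H (- \<alpha>) (- \<kappa>). H \<alpha> \<kappa> = V.span {e} \<and> H (- \<alpha>) (- \<kappa>) = V.span {f} \<and>
      (\<forall>\<beta>\<in>QL. \<forall>x\<in>root_space L \<beta>. br (br e f) x = sc (Rt.cr \<alpha> \<beta>) x)"
    using lie_torus assms unfolding lie_torus_def by simp
  then obtain e f where ef: "e \<in> H \<alpha> \<kappa>" "f \<in> H (- \<alpha>) (- \<kappa>)" "H \<alpha> \<kappa> = V.span {e}"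
    "H (- \<alpha>) (- \<kappa>) = V.span {f}"
    "\<forall>\<beta>\<in>QL. \<forall>x\<in>root_space L \<beta>. br (br e f) x = sc (Rt.cr \<alpha> \<beta>) x" by blast
  then show ?thesis using that[OF ef(1-4)] H_sub_root_space by simp
qed

lemma generated:
  assumes S: "V.subspace S" "\<And>x y. x \<in> S \<Longrightarrow> y \<in> S \<Longrightarrow> br x y \<in> S"
    and R: "\<And>\<alpha> \<kappa>. \<alpha> \<in> Rt.R \<Longrightarrow> H \<alpha> \<kappa> \<subseteq> S"
  shows "x \<in> S"
proof -
  have "lie_subalgebra sc br S" unfolding lie_subalgebra_def using S by simp
  moreover have "(\<Union>\<alpha>\<in>roots L - {0}. root_space L \<alpha>) \<subseteq> S"
  proof (rule UN_least)
    fix \<alpha> assume "\<alpha> \<in> roots L - {0}"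
    then have "(\<Union>\<kappa>. H \<alpha> \<kappa>) \<subseteq> S" using R unfolding Rt.R_def by blast
    then show "root_space L \<alpha> \<subseteq> S" unfolding root_space_def by (rule V.span_minimal[OF _ S(1)])
  qed
  ultimately have "lie_subalgebra sc br hull (\<Union>\<alpha>\<in>roots L - {0}. root_space L \<alpha>) \<subseteq> S"
    by (intro hull_minimal)
  then show ?thesis using lie_torus unfolding lie_torus_def by auto
qed

section \<open>Coroot elements and graded simplicity\<close>

lemma centreless': "(\<And>y. br x y = 0) \<Longrightarrow> x = 0"
  using centreless unfolding centreless_def by blast

text \<open>A trivial centre makes ad injective. Every uniqueness claim for coroot elements and for
  \<open>psi\<close> goes through this.\<close>

lemma eq_if_same_action:
  assumes "\<And>\<beta> \<mu> y. \<beta> \<in> QL \<Longrightarrow> y \<in> H \<beta> \<mu> \<Longrightarrow> br x y = br x' y"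
  shows "x = x'"
proof -
  have "br x y = br x' y" for y
    by (rule homog_ext[of sc]) (use assms lie in \<open>auto simp: lie_algebra_def\<close>)
  then have "br (x - x') y = 0" for y by (simp add: br_linear)
  then show ?thesis using centreless'[of "x - x'"] by simp
qed

lemma R_QL: "\<alpha> \<in> Rt.R \<Longrightarrow> \<alpha> \<in> QL" by (auto simp: Rt.R_def)

text \<open>For indivisible \<alpha> the product [e, f] of an sl2-pair in degrees 0 and 0 serves.
  For divisible \<alpha>, half of the element of \<alpha>/2 serves, as the coroot of \<alpha>/2 is
  twice that of \<alpha>.\<close>

lemma coroot_element_exists:
  assumes "\<alpha> \<in> Rt.R"
  shows "\<exists>t\<in>H 0 0. \<forall>\<beta>\<in>QL. \<forall>\<mu>. \<forall>x\<in>H \<beta> \<mu>. br t x = sc (Rt.cr \<alpha> \<beta>) x"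
proof -
  have ind: "\<exists>t\<in>H 0 0. \<forall>\<beta>\<in>QL. \<forall>\<mu>. \<forall>x\<in>H \<beta> \<mu>. br t x = sc (Rt.cr \<alpha> \<beta>) x"
    if "\<alpha> \<in> indivisible (vscale L) (roots L) - {0}" for \<alpha>
  proof -
    have \<alpha>: "\<alpha> \<in> QL" "\<alpha> \<noteq> 0" using that Rt.indivisible_subset_R R_QL by auto
    have nz: "H \<alpha> 0 \<noteq> {0}" by (rule indivisible_nonzero[OF that])
    obtain e f where ef: "e \<in> H \<alpha> 0" "f \<in> H (- \<alpha>) (- 0)"
      "\<And>\<beta> \<mu> x. \<beta> \<in> QL \<Longrightarrow> x \<in> H \<beta> \<mu> \<Longrightarrow> br (br e f) x = sc (Rt.cr \<alpha> \<beta>) x"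
      using sl2[OF \<alpha> nz] by metis
    then have "br e f \<in> H 0 0" using H_br[of \<alpha> "- \<alpha>" e 0 f "- 0"] \<alpha> by auto
    then show ?thesis using ef(3) by blast
  qed
  from Rt.indivisible_or_half[OF assms] show ?thesis
  proof
    let ?\<gamma> = "vscale L (1/2) \<alpha>"
    assume \<gamma>: "?\<gamma> \<in> indivisible (vscale L) (roots L) - {0} \<and> ?\<gamma> \<in> Rt.R \<and> Rt.cr ?\<gamma> = (\<lambda>x. 2 * Rt.cr \<alpha> x)"
    then obtain t where t: "t \<in> H 0 0" "\<forall>\<beta>\<in>QL. \<forall>\<mu>. \<forall>x\<in>H \<beta> \<mu>. br t x = sc (2 * Rt.cr \<alpha> \<beta>) x"
      using ind[of ?\<gamma>] by auto
    have "sc (1/2) t \<in> H 0 0" using t(1) H_subspace V.subspace_scale by blast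
    moreover have "\<forall>\<beta>\<in>QL. \<forall>\<mu>. \<forall>x\<in>H \<beta> \<mu>. br (sc (1/2) t) x = sc (Rt.cr \<alpha> \<beta>) x"
      using t(2) by (simp add: br_linear)
    ultimately show ?thesis by blast
  qed (rule ind)
qed

text \<open>The coroot of \<alpha> realised inside the component of root and degree zero. The choice
  is harmless, since \<open>coroot_elt_eqI\<close> determines it by its action.\<close>

definition "coroot_elt \<alpha> = (SOME t. t \<in> H 0 0 \<and> (\<forall>\<beta>\<in>QL. \<forall>\<mu>. \<forall>x\<in>H \<beta> \<mu>. br t x = sc (Rt.cr \<alpha> \<beta>) x))"

lemma coroot_elt: assumes "\<alpha> \<in> Rt.R"
  shows coroot_elt_H: "coroot_elt \<alpha> \<in> H 0 0"
    and coroot_elt_act: "\<beta> \<in> QL \<Longrightarrow> x \<in> H \<beta> \<mu> \<Longrightarrow> br (coroot_elt \<alpha>) x = sc (Rt.cr \<alpha> \<beta>) x"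
proof -
  have "\<exists>t. t \<in> H 0 0 \<and> (\<forall>\<beta>\<in>QL. \<forall>\<mu>. \<forall>x\<in>H \<beta> \<mu>. br t x = sc (Rt.cr \<alpha> \<beta>) x)"
    using coroot_element_exists[OF assms] by blast
  from someI_ex[OF this, folded coroot_elt_def]
  show "coroot_elt \<alpha> \<in> H 0 0" "\<beta> \<in> QL \<Longrightarrow> x \<in> H \<beta> \<mu> \<Longrightarrow> br (coroot_elt \<alpha>) x = sc (Rt.cr \<alpha> \<beta>) x" by simp_all
qed

lemma coroot_elt_eqI:
  assumes "\<alpha> \<in> Rt.R" "\<And>\<beta> \<mu> x. \<beta> \<in> QL \<Longrightarrow> x \<in> H \<beta> \<mu> \<Longrightarrow> br t x = sc (Rt.cr \<alpha> \<beta>) x"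
  shows "t = coroot_elt \<alpha>"
  by (rule eq_if_same_action) (use assms coroot_elt_act in simp)

lemma nonzero_root:
  "\<alpha> \<in> QL \<Longrightarrow> \<alpha> \<noteq> 0 \<Longrightarrow> x \<in> H \<alpha> \<kappa> \<Longrightarrow> x \<noteq> 0 \<Longrightarrow> \<alpha> \<in> Rt.R"
  using H_outside unfolding Rt.R_def by blast

definition "lie_ideal I \<longleftrightarrow> V.subspace I \<and> (\<forall>x\<in>I. \<forall>y. br x y \<in> I)"

text \<open>The component of x is a line, so the ideal contains its generator e and then [e, f].
  Whatever the degree \<kappa>, this product acts as the coroot of \<alpha>, hence is the one coroot
  element.\<close>

lemma coroot_elt_in_ideal:
  assumes I: "lie_ideal I" and x: "\<alpha> \<in> Rt.R" "x \<in> H \<alpha> \<kappa>" "x \<noteq> 0" "x \<in> I"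
  shows "coroot_elt \<alpha> \<in> I"
proof -
  have \<alpha>: "\<alpha> \<in> QL" "\<alpha> \<noteq> 0" using x Rt.zero_notin_R R_QL by auto
  have "H \<alpha> \<kappa> \<noteq> {0}" using x by blast
  then obtain e f where ef: "e \<in> H \<alpha> \<kappa>" "H \<alpha> \<kappa> = V.span {e}"
    "\<And>\<beta> \<mu> x. \<beta> \<in> QL \<Longrightarrow> x \<in> H \<beta> \<mu> \<Longrightarrow> br (br e f) x = sc (Rt.cr \<alpha> \<beta>) x"
    using sl2[OF \<alpha>] by metis
  then obtain k where k: "x = sc k e" using x(2) by (auto simp: V.span_singleton)
  then have "k \<noteq> 0" using x(3) by auto
  then have "e = sc (1 / k) x" using k by simp
  then have "e \<in> I" using I x(4) V.subspace_scale unfolding lie_ideal_def by blast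
  then have "br e f \<in> I" using I unfolding lie_ideal_def by blast
  then show ?thesis using coroot_elt_eqI[OF x(1) ef(3)] by simp
qed

text \<open>The ideal need not be graded: the lemma applies to the kernel of any centroid element.\<close>

lemma ideal_UNIV:
  assumes I: "lie_ideal I" and \<alpha>: "\<alpha> \<in> QL" and x: "x \<in> H \<alpha> \<kappa>" "x \<noteq> 0" "x \<in> I"
  shows "y \<in> I"
proof -
  have sub: "V.subspace I" and abs: "\<And>x y. x \<in> I \<Longrightarrow> br x y \<in> I"
    using I unfolding lie_ideal_def by auto
  \<comment> \<open>The first aim is a nonzero root vector in I. If x has root 0, bracketing with x
    supplies one: the elements killed by x form a subalgebra, which would be everything if it
    contained all root spaces.\<close>
  have "\<exists>\<beta> \<mu> z. \<beta> \<in> Rt.R \<and> z \<in> H \<beta> \<mu> \<and> z \<noteq> 0 \<and> z \<in> I"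
  proof (cases "\<alpha> = 0")
    case False
    then show ?thesis using \<alpha> x nonzero_root by blast
  next
    case True
    have "\<exists>\<beta> \<mu> z. \<beta> \<in> Rt.R \<and> z \<in> H \<beta> \<mu> \<and> br x z \<noteq> 0"
    proof (rule ccontr)
      assume no: "\<not> ?thesis"
      have "br x z = 0" for z
      proof -
        have "V.subspace {z. br x z = 0}"
          by (rule V.subspaceI) (auto simp: br_linear)
        then have "z \<in> {z. br x z = 0}"
          by (rule generated) (use no in \<open>auto simp: jacobi[of x] br_linear\<close>)
        then show ?thesis by simp
      qed
      then show False using centreless' x(2) by blast
    qed
    then obtain \<beta> \<mu> z where z: "\<beta> \<in> Rt.R" "z \<in> H \<beta> \<mu>" "br x z \<noteq> 0" by blast
    then have "br x z \<in> H \<beta> (\<kappa> + \<mu>)" using H_br[OF \<alpha> R_QL x(1) z(2)] True by simp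
    then show ?thesis using z abs[OF x(3)] by blast
  qed
  then obtain \<beta> \<mu> z where z: "\<beta> \<in> Rt.R" "z \<in> H \<beta> \<mu>" "z \<noteq> 0" "z \<in> I" by blast
  \<comment> \<open>The ideal contains every root space not orthogonal to a root of X, being an
    eigenspace with nonzero eigenvalue. Each such root then enters X itself, and irreducibility
    makes X the whole root system.\<close>
  define X where "X = {\<alpha> \<in> Rt.R. coroot_elt \<alpha> \<in> I}"
  have root_in: "H \<gamma> \<mu> \<subseteq> I" if "\<beta> \<in> X" "\<gamma> \<in> Rt.R" "Rt.cr \<beta> \<gamma> \<noteq> 0" for \<beta> \<gamma> \<mu>
  proof
    fix y assume y: "y \<in> H \<gamma> \<mu>"
    have "br (coroot_elt \<beta>) y \<in> I" using that abs unfolding X_def by blast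
    then have "sc (Rt.cr \<beta> \<gamma>) y \<in> I" using coroot_elt_act[of \<beta> \<gamma> y] y that R_QL unfolding X_def by simp
    then have "sc (1 / Rt.cr \<beta> \<gamma>) (sc (Rt.cr \<beta> \<gamma>) y) \<in> I" using V.subspace_scale[OF sub] by blast
    then show "y \<in> I" using that by simp
  qed
  have ind: "\<gamma> \<in> X" if "\<beta> \<in> X" "\<gamma> \<in> indivisible (vscale L) (roots L) - {0}" "Rt.cr \<beta> \<gamma> \<noteq> 0" for \<beta> \<gamma>
  proof -
    have \<gamma>: "\<gamma> \<in> Rt.R" using that Rt.indivisible_subset_R by blast
    have nz: "H \<gamma> 0 \<noteq> {0}" by (rule indivisible_nonzero[OF that(2)])
    then obtain y where "y \<in> H \<gamma> 0" "y \<noteq> 0"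
      using V.subspace_0[OF H_subspace[OF R_QL[OF \<gamma>]]] by blast
    then show ?thesis
      using coroot_elt_in_ideal[OF I \<gamma>] root_in[OF that(1) \<gamma> that(3)] \<gamma> unfolding X_def by blast
  qed
  have "X = Rt.R"
  proof (rule Rt.closed_component)
    show "X \<noteq> {}" using coroot_elt_in_ideal[OF I z] z(1) unfolding X_def by blast
    fix \<beta> \<gamma> assume \<beta>: "\<beta> \<in> X" and \<gamma>: "\<gamma> \<in> Rt.R" and ne: "Rt.cr \<beta> \<gamma> \<noteq> 0"
    \<comment> \<open>A divisible root may have no vector of degree 0, so it enters X through its
      half.\<close>
    from Rt.indivisible_or_half[OF \<gamma>] show "\<gamma> \<in> X"
    proof
      let ?\<delta> = "vscale L (1/2) \<gamma>"
      assume \<delta>: "?\<delta> \<in> indivisible (vscale L) (roots L) - {0} \<and> ?\<delta> \<in> Rt.R \<and> Rt.cr ?\<delta> = (\<lambda>x. 2 * Rt.cr \<gamma> x)"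
      have "Rt.cr \<beta> ?\<delta> \<noteq> 0" using \<beta> ne unfolding X_def by (simp add: Rt.cr_linear)
      then have in_I: "coroot_elt ?\<delta> \<in> I" using ind[OF \<beta>, of ?\<delta>] \<delta> unfolding X_def by blast
      have "sc (1/2) (coroot_elt ?\<delta>) = coroot_elt \<gamma>"
        by (rule coroot_elt_eqI[OF \<gamma>]) (use \<delta> coroot_elt_act[of ?\<delta>] in \<open>simp add: br_linear\<close>)
      then have "coroot_elt \<gamma> \<in> I" using V.subspace_scale[OF sub in_I, of "1/2"] by simp
      then show ?thesis using \<gamma> unfolding X_def by simp
    qed (use ind[OF \<beta> _ ne] in blast)
  qed (auto simp: X_def)
  \<comment> \<open>The coroot of \<gamma> has value 2 at \<gamma>, so all root spaces lie in I, and
    they generate L.\<close>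
  then have "H \<gamma> \<mu> \<subseteq> I" if "\<gamma> \<in> Rt.R" for \<gamma> \<mu>
    using root_in[of \<gamma> \<gamma>] that by (simp add: Rt.cr_linear)
  then show ?thesis using generated[OF sub] abs by blast
qed

end

section \<open>The centroid\<close>

context centreless_lie_torus
begin

lemma Cent_linear: "c \<in> Cent L \<Longrightarrow> Vector_Spaces.linear sc sc c"
  and Cent_br: "c \<in> Cent L \<Longrightarrow> c (br x y) = br x (c y)"
  unfolding Cent_def by simp_all

lemma linear_rules:
  assumes "Vector_Spaces.linear sc sc d"
  shows "d (x + y) = d x + d y" "d (x - y) = d x - d y" "d (sc k x) = sc k (d x)" "d 0 = 0" "d (- x) = - d x"
proof -
  interpret l: Vector_Spaces.linear sc sc d by fact
  show "d (x + y) = d x + d y" "d (x - y) = d x - d y" "d (sc k x) = sc k (d x)" "d 0 = 0" "d (- x) = - d x"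
    by (simp_all add: l.add l.diff l.scale l.zero l.neg)
qed

lemmas Cent_rules = linear_rules[OF Cent_linear]

lemma Cent_br_left: "c \<in> Cent L \<Longrightarrow> c (br x y) = br (c x) y"
  by (subst (1 2) br_anti) (simp add: Cent_rules Cent_br)

lemma subspace_Cent: "F.subspace (Cent L)"
  by (rule F.subspaceI)
     (auto simp: Cent_def linear_iff pointwise_def br_linear V.scale_right_distrib
        V.vector_space_axioms V.scale_left_commute algebra_simps)

text \<open>A root line in degree 0, the probe on which centroid elements and forms are
  compared.\<close>

lemma nonzero_homogeneous:
  obtains \<alpha> e where "\<alpha> \<in> Rt.R" "\<alpha> \<in> QL" "\<alpha> \<noteq> 0" "e \<in> H \<alpha> 0" "e \<noteq> 0" "V.span {e} = H \<alpha> 0"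
proof -
  obtain \<alpha> where \<alpha>: "\<alpha> \<in> indivisible (vscale L) (roots L) - {0}"
    using Rt.indivisible_exists by blast
  then have R: "\<alpha> \<in> Rt.R" "\<alpha> \<in> QL" "\<alpha> \<noteq> 0" using Rt.indivisible_subset_R R_QL by auto
  have nz: "H \<alpha> 0 \<noteq> {0}" by (rule indivisible_nonzero[OF \<alpha>])
  obtain e where e: "e \<in> H \<alpha> 0" "H \<alpha> 0 = V.span {e}" using sl2[OF R(2,3) nz] by metis
  then have "e \<noteq> 0" using nz by auto
  then show ?thesis using that R e by simp
qed

text \<open>The kernel of c is an ideal, so one nonzero homogeneous element in it forces c to
  vanish.\<close>

lemma Cent_eq_0:
  assumes c: "c \<in> Cent L" and x: "\<alpha> \<in> QL" "x \<in> H \<alpha> \<kappa>" "x \<noteq> 0" "c x = 0"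
  shows "c = 0"
proof
  fix y
  have "lie_ideal {x. c x = 0}"
    unfolding lie_ideal_def
    by (auto intro!: V.subspaceI simp: Cent_rules[OF c] Cent_br_left[OF c] br_linear)
  then have "y \<in> {x. c x = 0}" by (rule ideal_UNIV) (use x in auto)
  then show "c y = 0 y" by simp
qed

text \<open>Two centroid elements commute on brackets, because one can be moved to the left factor
  and the other to the right. The element 2 e = [t, e], with t a coroot element, is a bracket, so
  the commutator has a nonzero homogeneous element in its kernel.\<close>

lemma Cent_comm:
  assumes c: "c \<in> Cent L" and c': "c' \<in> Cent L"
  shows "c (c' x) = c' (c x)"
proof -
  obtain \<alpha> e where e: "\<alpha> \<in> Rt.R" "\<alpha> \<in> QL" "\<alpha> \<noteq> 0" "e \<in> H \<alpha> 0" "e \<noteq> 0" by (rule nonzero_homogeneous)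
  let ?k = "\<lambda>x. c (c' x) - c' (c x)"
  have "?k \<in> Cent L"
    unfolding Cent_def
    by (simp add: linear_iff V.vector_space_axioms Cent_rules[OF c] Cent_rules[OF c']
        Cent_br[OF c] Cent_br[OF c'] br_linear V.scale_right_diff_distrib)
  moreover have "?k (br (coroot_elt \<alpha>) e) = 0"
    by (simp add: Cent_br[OF c'] Cent_br_left[OF c])
  moreover have "br (coroot_elt \<alpha>) e = sc 2 e" using coroot_elt_act e by (simp add: Rt.cr_linear)
  moreover have "sc 2 e \<in> H \<alpha> 0" "sc 2 e \<noteq> 0" using e H_subspace V.subspace_scale by auto
  ultimately have "?k = 0" using Cent_eq_0[of ?k \<alpha> "sc 2 e" 0] e(2) by simp
  then have "?k x = 0 x" by metis
  then show ?thesis by simp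
qed

lemma cmp_coroot_elt:
  assumes "\<beta> \<in> Rt.R"
  shows "cmp \<gamma> \<mu> (br (coroot_elt \<beta>) z) = sc (Rt.cr \<beta> \<gamma>) (cmp \<gamma> \<mu> z)"
proof (rule homog_ext[of sc "\<lambda>z. cmp \<gamma> \<mu> (br (coroot_elt \<beta>) z)" "\<lambda>z. sc (Rt.cr \<beta> \<gamma>) (cmp \<gamma> \<mu> z)"])
  show "Vector_Spaces.linear sc sc (\<lambda>z. cmp \<gamma> \<mu> (br (coroot_elt \<beta>) z))"
    by (simp add: linear_iff V.vector_space_axioms cmp_add cmp_scale br_linear)
  show "Vector_Spaces.linear sc sc (\<lambda>z. sc (Rt.cr \<beta> \<gamma>) (cmp \<gamma> \<mu> z))"
    by (simp add: linear_iff V.vector_space_axioms cmp_add cmp_scale V.scale_right_distrib mult.commute)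
  show "cmp \<gamma> \<mu> (br (coroot_elt \<beta>) z) = sc (Rt.cr \<beta> \<gamma>) (cmp \<gamma> \<mu> z)" if "\<alpha> \<in> QL" "z \<in> H \<alpha> \<kappa>" for \<alpha> \<kappa> z
    using that by (simp add: coroot_elt_act[OF assms] cmp_scale cmp_homogeneous)
qed

lemma eq_root_if_coroots:
  assumes "\<And>\<beta>. \<beta> \<in> Rt.R \<Longrightarrow> Rt.cr \<beta> \<gamma> = Rt.cr \<beta> \<alpha>"
  shows "\<gamma> = \<alpha>"
  using Rt.coroots_separate[of "\<gamma> - \<alpha>"] assms by (simp add: Rt.cr_linear)

lemma cmp_weight:
  assumes "\<And>\<beta>. \<beta> \<in> Rt.R \<Longrightarrow> br (coroot_elt \<beta>) z = sc (Rt.cr \<beta> \<alpha>) z" and "\<gamma> \<noteq> \<alpha>"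
  shows "cmp \<gamma> \<mu> z = 0"
proof (rule ccontr)
  assume nz: "cmp \<gamma> \<mu> z \<noteq> 0"
  have "Rt.cr \<beta> \<gamma> = Rt.cr \<beta> \<alpha>" if "\<beta> \<in> Rt.R" for \<beta>
    using cmp_coroot_elt[OF that, of \<gamma> \<mu> z] nz by (simp add: assms(1)[OF that] cmp_scale)
  then show False using eq_root_if_coroots assms(2) by blast
qed

text \<open>A centroid element commutes with the action of all coroot elements, and these separate
  roots. Hence \<open>Cent_deg\<close>, which is defined through degrees alone, respects the whole
  grading.\<close>

lemma Cent_weight:
  assumes "c \<in> Cent L" "\<alpha> \<in> QL" "x \<in> H \<alpha> \<kappa>" "\<gamma> \<noteq> \<alpha>"
  shows "cmp \<gamma> \<mu> (c x) = 0"
  by (rule cmp_weight[OF _ assms(4)])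
     (simp add: Cent_br[OF assms(1), symmetric] coroot_elt_act[OF _ assms(2,3)] Cent_rules[OF assms(1)])

lemma Cent_deg_Cent: "c \<in> Cent_deg L \<gamma> \<Longrightarrow> c \<in> Cent L"
  unfolding Cent_deg_def by simp

lemma Cent_deg_homogeneous:
  assumes "c \<in> Cent_deg L \<gamma>" "\<alpha> \<in> QL" "x \<in> H \<alpha> \<kappa>"
  shows "c x \<in> H \<alpha> (\<gamma> + \<kappa>)"
proof (rule homogeneous_if_cmp[OF assms(2)])
  have "c x \<in> degree_space L (\<gamma> + \<kappa>)"
    using assms H_sub_degree_space unfolding Cent_deg_def by blast
  then show "cmp \<beta> \<mu> (c x) = 0" if "\<beta> \<noteq> \<alpha> \<or> \<mu> \<noteq> \<gamma> + \<kappa>" for \<beta> \<mu>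
    using that cmp_degree_space Cent_weight[OF Cent_deg_Cent[OF assms(1)] assms(2,3)] by metis
qed

lemma Cent_degI:
  assumes c: "c \<in> Cent L" and H: "\<And>\<alpha> \<kappa> x. \<alpha> \<in> QL \<Longrightarrow> x \<in> H \<alpha> \<kappa> \<Longrightarrow> c x \<in> H \<alpha> (\<gamma> + \<kappa>)"
  shows "c \<in> Cent_deg L \<gamma>"
proof -
  interpret c: Vector_Spaces.linear sc sc c by (rule Cent_linear[OF c])
  have "c ` degree_space L \<mu> \<subseteq> degree_space L (\<gamma> + \<mu>)" for \<mu>
    unfolding degree_space_def c.span_image[symmetric]
    by (rule V.span_mono) (use H in blast)
  then show ?thesis using c unfolding Cent_deg_def by blast
qed

lemma subspace_Cent_deg: "F.subspace (Cent_deg L \<gamma>)"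
proof (rule F.subspaceI)
  have z: "0 \<in> H \<alpha> \<kappa>" if "\<alpha> \<in> QL" for \<alpha> \<kappa> using H_subspace[OF that] by (rule V.subspace_0)
  show "0 \<in> Cent_deg L \<gamma>"
    by (rule Cent_degI) (use F.subspace_0[OF subspace_Cent] z in auto)
  show "c + d \<in> Cent_deg L \<gamma>" if "c \<in> Cent_deg L \<gamma>" "d \<in> Cent_deg L \<gamma>" for c d
    by (rule Cent_degI)
       (use that Cent_deg_Cent F.subspace_add[OF subspace_Cent] Cent_deg_homogeneous
          V.subspace_add[OF H_subspace] in auto)
  show "pointwise sc k c \<in> Cent_deg L \<gamma>" if "c \<in> Cent_deg L \<gamma>" for k c
    by (rule Cent_degI)
       (use that Cent_deg_Cent F.subspace_scale[OF subspace_Cent] Cent_deg_homogeneous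
          V.subspace_scale[OF H_subspace] in \<open>auto simp: pointwise_def\<close>)
qed

lemma id_Cent_deg: "(\<lambda>x. x) \<in> Cent_deg L 0"
  by (rule Cent_degI) (auto simp: Cent_def V.linear_ident)

text \<open>Such a c preserves the line spanned by e and so acts there as a scalar k. Subtracting k
  leaves a centroid element that kills e.\<close>

lemma Cent_deg_0:
  assumes "c \<in> Cent_deg L 0"
  obtains k where "c = sc k"
proof -
  obtain \<alpha> e where e: "\<alpha> \<in> Rt.R" "\<alpha> \<in> QL" "\<alpha> \<noteq> 0" "e \<in> H \<alpha> 0" "e \<noteq> 0" "V.span {e} = H \<alpha> 0"
    by (rule nonzero_homogeneous)
  have "c e \<in> V.span {e}" using Cent_deg_homogeneous[OF assms e(2,4)] e(6) by simp
  then obtain k where k: "c e = sc k e" by (auto simp: V.span_singleton)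
  define c' where "c' = c - pointwise sc k (\<lambda>x. x)"
  have "c' \<in> Cent L"
    unfolding c'_def
    by (intro F.subspace_diff F.subspace_scale subspace_Cent Cent_deg_Cent[OF assms] Cent_deg_Cent[OF id_Cent_deg])
  moreover have "c' e = 0" by (simp add: c'_def pointwise_def k)
  ultimately have "c' = 0" using Cent_eq_0 e by blast
  then have "c = sc k" by (simp add: c'_def pointwise_def)
  then show ?thesis using that by blast
qed

lemma zero_in_support: "0 \<in> centroid_support L"
proof -
  obtain \<alpha> e where e: "e \<in> H \<alpha> 0" "e \<noteq> 0" by (rule nonzero_homogeneous)
  have "(\<lambda>x::'l. x) \<noteq> 0" using e(2) by (metis zero_fun_apply)
  then show ?thesis using id_Cent_deg unfolding centroid_support_def by blast
qed

text \<open>A nonzero homogeneous centroid element is bijective: it is injective on every component,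
  and its range is an ideal containing a nonzero homogeneous element. Its inverse is a centroid
  element of opposite degree. The result is needed in \<open>kap_graded_dual\<close>.\<close>

lemma uminus_in_support:
  assumes "\<gamma> \<in> centroid_support L"
  shows "- \<gamma> \<in> centroid_support L"
proof -
  obtain c where c: "c \<in> Cent_deg L \<gamma>" "c \<noteq> 0"
    using assms F.subspace_0[OF subspace_Cent_deg] unfolding centroid_support_def by blast
  note cC = Cent_deg_Cent[OF c(1)]
  \<comment> \<open>Since c shifts components uniformly, both its injectivity and the degree of its
    inverse can be checked one component at a time.\<close>
  have cmp_c: "cmp \<alpha> (\<gamma> + \<kappa>) (c x) = c (cmp \<alpha> \<kappa> x)" for \<alpha> \<kappa> x
  proof (rule homog_ext[of sc "\<lambda>x. cmp \<alpha> (\<gamma> + \<kappa>) (c x)" "\<lambda>x. c (cmp \<alpha> \<kappa> x)"])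
    show "Vector_Spaces.linear sc sc (\<lambda>x. cmp \<alpha> (\<gamma> + \<kappa>) (c x))"
      and "Vector_Spaces.linear sc sc (\<lambda>x. c (cmp \<alpha> \<kappa> x))"
      by (simp_all add: linear_iff V.vector_space_axioms cmp_add cmp_scale Cent_rules[OF cC])
    show "cmp \<alpha> (\<gamma> + \<kappa>) (c x) = c (cmp \<alpha> \<kappa> x)" if "\<beta> \<in> QL" "x \<in> H \<beta> \<mu>" for \<beta> \<mu> x
      using cmp_homogeneous[OF that(1) Cent_deg_homogeneous[OF c(1) that]] cmp_homogeneous[OF that]
      by (simp add: Cent_rules[OF cC])
  qed
  have inj_hom: "x = 0" if "\<alpha> \<in> QL" "x \<in> H \<alpha> \<kappa>" "c x = 0" for \<alpha> \<kappa> x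
    using Cent_eq_0[OF cC that(1,2) _ that(3)] c(2) by blast
  have cmp_0': "cmp \<alpha> \<kappa> x = 0" if "cmp \<alpha> (\<gamma> + \<kappa>) (c x) = 0" for \<alpha> \<kappa> x
    using that inj_hom[OF _ cmp_in] cmp_out[of \<alpha>] unfolding cmp_c by blast
  have inj: "x = 0" if "c x = 0" for x
    by (rule eq_0_if_cmp) (rule cmp_0', simp add: that cmp_0)
  have range_c: "y \<in> range c" for y
  proof -
    obtain \<alpha> e where e: "\<alpha> \<in> QL" "e \<in> H \<alpha> 0" "e \<noteq> 0" by (rule nonzero_homogeneous)
    have "lie_ideal (range c)"
      unfolding lie_ideal_def
    proof (intro conjI ballI allI)
      show "V.subspace (range c)"
      proof (rule V.subspaceI)
        show "0 \<in> range c" using Cent_rules(4)[OF cC] by (metis rangeI)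
      qed (auto simp flip: Cent_rules(1,3)[OF cC])
      show "br x y \<in> range c" if "x \<in> range c" for x y
        using that by (auto simp: Cent_br_left[OF cC, symmetric])
    qed
    then show ?thesis
      by (rule ideal_UNIV[OF _ e(1) Cent_deg_homogeneous[OF c(1) e(1,2)]]) (use inj[of e] e in auto)
  qed
  define c' where "c' y = (SOME x. c x = y)" for y
  have c': "c (c' y) = y" for y
  proof -
    have "\<exists>x. c x = y" using range_c[of y] by auto
    then show ?thesis unfolding c'_def by (rule someI_ex)
  qed
  have inj': "x = x'" if "c x = c x'" for x x'
    using inj[of "x - x'"] that by (simp add: Cent_rules[OF cC])
  have C: "c' \<in> Cent L"
    unfolding Cent_def linear_iff
  proof (intro CollectI conjI allI V.vector_space_axioms)
    show "c' (x + y) = c' x + c' y" for x y by (rule inj') (simp add: c' Cent_rules[OF cC])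
    show "c' (sc k x) = sc k (c' x)" for k x by (rule inj') (simp add: c' Cent_rules[OF cC])
    show "c' (br x y) = br x (c' y)" for x y by (rule inj') (simp add: c' Cent_br[OF cC])
  qed
  have "c' \<in> Cent_deg L (- \<gamma>)"
  proof (rule Cent_degI[OF C])
    fix \<alpha> \<kappa> x assume x: "\<alpha> \<in> QL" "x \<in> H \<alpha> \<kappa>"
    show "c' x \<in> H \<alpha> (- \<gamma> + \<kappa>)"
    proof (rule homogeneous_if_cmp[OF x(1)])
      fix \<beta> \<mu> assume "\<beta> \<noteq> \<alpha> \<or> \<mu> \<noteq> - \<gamma> + \<kappa>"
      then have "\<beta> \<noteq> \<alpha> \<or> \<gamma> + \<mu> \<noteq> \<kappa>" by (auto simp: algebra_simps)
      then have "cmp \<beta> (\<gamma> + \<mu>) (c (c' x)) = 0" using cmp_homogeneous[OF x] by (auto simp: c')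
      then show "cmp \<beta> \<mu> (c' x) = 0" by (rule cmp_0')
    qed
  qed
  moreover have "c' \<noteq> 0"
  proof
    assume "c' = 0"
    then have "y = 0" for y :: 'l using c'[of y] by (simp add: Cent_rules[OF cC])
    then have "c = 0" by (intro ext) simp
    then show False using c(2) by blast
  qed
  ultimately show ?thesis unfolding centroid_support_def by blast
qed

section \<open>Derivations given by centroid multipliers\<close>

lemma degree_space_nonzero:
  assumes "degree_space L \<kappa> \<noteq> {0}"
  obtains \<alpha> x where "\<alpha> \<in> QL" "x \<in> H \<alpha> \<kappa>" "x \<noteq> 0"
proof -
  have "\<not> (\<Union>\<alpha>\<in>QL. H \<alpha> \<kappa>) \<subseteq> {0}"
    using V.span_minimal[of "\<Union>\<alpha>\<in>QL. H \<alpha> \<kappa>" "{0}"] V.span_zero assms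
    unfolding degree_space_def by (auto simp: V.subspace_def)
  then show ?thesis using that by blast
qed

text \<open>Axiom (LT4) in the form used: the degrees of nonzero homogeneous elements generate the
  grading group.\<close>

lemma hom_eq_if_eq_on_support:
  assumes "group_hom_on UNIV f" "group_hom_on UNIV g"
    and eq: "\<And>\<alpha> \<kappa> x. \<alpha> \<in> QL \<Longrightarrow> x \<in> H \<alpha> \<kappa> \<Longrightarrow> x \<noteq> 0 \<Longrightarrow> f \<kappa> = g \<kappa>"
  shows "f = g"
proof
  fix \<kappa> :: 'g
  have "\<kappa> \<in> module.span zmul {\<kappa>. degree_space L \<kappa> \<noteq> {0}}"
    using lie_torus unfolding lie_torus_def by simp
  then show "f \<kappa> = g \<kappa>"
  proof (rule zmul_span_induct)
    show "f 0 = g 0"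
      using group_hom_on_zero[OF assms(1) zmod.subspace_UNIV] group_hom_on_zero[OF assms(2) zmod.subspace_UNIV]
      by simp
    show "f x = g x" if "x \<in> {\<kappa>. degree_space L \<kappa> \<noteq> {0}}" for x
    proof -
      have "degree_space L x \<noteq> {0}" using that by simp
      then obtain \<alpha> y where "\<alpha> \<in> QL" "y \<in> H \<alpha> x" "y \<noteq> 0" by (rule degree_space_nonzero)
      then show ?thesis by (rule eq)
    qed
    show "f (x - y) = g (x - y)" if "f x = g x" "f y = g y" for x y
      using that group_hom_on_diff[OF assms(1) zmod.subspace_UNIV] group_hom_on_diff[OF assms(2) zmod.subspace_UNIV]
      by simp
  qed
qed

text \<open>A presentation of d by centroid elements and degree derivations is not unique, whereas M
  is (\<open>mult_unique\<close>). Constructions made from M therefore depend on d alone.\<close>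

definition mult :: "('l \<Rightarrow> 'l) \<Rightarrow> ('g \<Rightarrow> 'l \<Rightarrow> 'l) \<Rightarrow> bool" where
  "mult d M \<longleftrightarrow> Vector_Spaces.linear sc sc d \<and> (\<forall>\<kappa>. M \<kappa> \<in> Cent L) \<and> group_hom_on UNIV M \<and>
     (\<forall>\<alpha>\<in>QL. \<forall>\<kappa>. \<forall>x\<in>H \<alpha> \<kappa>. d x = M \<kappa> x)"

lemma mult_linear: "mult d M \<Longrightarrow> Vector_Spaces.linear sc sc d"
  and mult_Cent: "mult d M \<Longrightarrow> M \<kappa> \<in> Cent L"
  and mult_hom: "mult d M \<Longrightarrow> group_hom_on UNIV M"
  and mult_act: "mult d M \<Longrightarrow> \<alpha> \<in> QL \<Longrightarrow> x \<in> H \<alpha> \<kappa> \<Longrightarrow> d x = M \<kappa> x"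
  unfolding mult_def by simp_all

lemma mult_add_hom: "mult d M \<Longrightarrow> M (\<kappa> + \<mu>) = M \<kappa> + M \<mu>"
  by (rule group_hom_on_add[OF mult_hom zmod.subspace_UNIV UNIV_I UNIV_I])

text \<open>In a degree with a nonzero homogeneous x, the difference of the two centroid elements
  kills x and hence vanishes. Such degrees generate the group.\<close>

lemma mult_unique:
  assumes "mult d M" "mult d M'"
  shows "M = M'"
proof (rule hom_eq_if_eq_on_support)
  fix \<alpha> \<kappa> x assume x: "\<alpha> \<in> QL" "x \<in> H \<alpha> \<kappa>" "x \<noteq> 0"
  have "M \<kappa> - M' \<kappa> \<in> Cent L"
    using assms by (intro F.subspace_diff[OF subspace_Cent] mult_Cent)
  moreover have "(M \<kappa> - M' \<kappa>) x = 0"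
    using mult_act[OF assms(1) x(1,2)] mult_act[OF assms(2) x(1,2)] by simp
  ultimately have "M \<kappa> - M' \<kappa> = 0" using Cent_eq_0 x by blast
  then show "M \<kappa> = M' \<kappa>" by simp
qed (use assms mult_hom in auto)

lemma mult_determines: "mult d M \<Longrightarrow> mult d' M \<Longrightarrow> d = d'"
  by (rule ext, rule homog_ext[of sc]) (auto simp: mult_def)

lemma mult_zero: "mult 0 0"
  using F.subspace_0[OF subspace_Cent]
  by (auto simp: mult_def linear_iff V.vector_space_axioms group_hom_on_def)

lemma mult_add: "mult d M \<Longrightarrow> mult e N \<Longrightarrow> mult (d + e) (M + N)"
  using F.subspace_add[OF subspace_Cent]
  by (auto simp: mult_def linear_iff V.vector_space_axioms group_hom_on_def fun_eq_iff algebra_simps)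

lemma mult_scale: "mult d M \<Longrightarrow> mult (pointwise sc k d) (\<lambda>\<mu>. pointwise sc k (M \<mu>))"
  using F.subspace_scale[OF subspace_Cent]
  by (auto simp: mult_def linear_iff V.vector_space_axioms group_hom_on_def fun_eq_iff algebra_simps pointwise_def
      V.scale_left_commute)

text \<open>The Leibniz rule is additivity of M: M (\<kappa> + \<mu>) splits as M \<kappa> + M
  \<mu>, and on a bracket the first summand is moved to the left factor and the second to the
  right.\<close>

lemma mult_derivation:
  assumes "mult d M"
  shows "d (br x y) = br (d x) y + br x (d y)"
proof -
  note lin = linear_rules[OF mult_linear[OF assms]]
  have hom: "d (br x y) = br (d x) y + br x (d y)" if x: "\<alpha> \<in> QL" "x \<in> H \<alpha> \<kappa>" for \<alpha> \<kappa> x y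
  proof (rule homog_ext[of sc "\<lambda>y. d (br x y)" "\<lambda>y. br (d x) y + br x (d y)"])
    fix \<beta> \<mu> y assume y: "\<beta> \<in> QL" "y \<in> H \<beta> \<mu>"
    have "br x y \<in> H (\<alpha> + \<beta>) (\<kappa> + \<mu>)" using H_br x y by blast
    then have "d (br x y) = M \<kappa> (br x y) + M \<mu> (br x y)"
      using mult_act[OF assms, of "\<alpha> + \<beta>"] x y by (simp add: root_lattice_simps mult_add_hom[OF assms])
    then show "d (br x y) = br (d x) y + br x (d y)"
      by (simp add: Cent_br_left[OF mult_Cent[OF assms], of \<kappa>] Cent_br[OF mult_Cent[OF assms], of \<mu>]
          mult_act[OF assms x] mult_act[OF assms y])
  qed (auto simp: linear_iff V.vector_space_axioms br_linear lin V.scale_right_distrib)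
  show ?thesis
    by (rule homog_ext[of sc "\<lambda>x. d (br x y)" "\<lambda>x. br (d x) y + br x (d y)"])
       (auto simp: linear_iff V.vector_space_axioms br_linear lin V.scale_right_distrib hom)
qed

lemma commutator_Cent:
  assumes d: "mult d M" and c: "c \<in> Cent L"
  shows "commutator d c \<in> Cent L"
  unfolding Cent_def commutator_def
  by (simp add: linear_iff V.vector_space_axioms linear_rules[OF mult_linear[OF d]] Cent_rules[OF c]
      V.scale_right_diff_distrib mult_derivation[OF d] Cent_br[OF c] br_linear)

text \<open>Expanding on degree \<kappa>, the extra terms are the two products of M \<kappa> and N
  \<kappa>, which cancel because the centroid is commutative.\<close>

lemma mult_commutator:
  assumes d: "mult d M" and e: "mult e N"
  shows "mult (commutator d e) (\<lambda>\<mu>. commutator d (N \<mu>) - commutator e (M \<mu>))"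
  unfolding mult_def
proof (intro conjI ballI allI)
  note lin = linear_rules[OF mult_linear[OF d]] linear_rules[OF mult_linear[OF e]]
  show "Vector_Spaces.linear sc sc (commutator d e)"
    by (simp add: linear_iff V.vector_space_axioms commutator_def lin V.scale_right_diff_distrib)
  show "commutator d (N \<kappa>) - commutator e (M \<kappa>) \<in> Cent L" for \<kappa>
    by (intro F.subspace_diff subspace_Cent commutator_Cent[OF d] commutator_Cent[OF e] mult_Cent[OF d] mult_Cent[OF e])
  show "group_hom_on UNIV (\<lambda>\<mu>. commutator d (N \<mu>) - commutator e (M \<mu>))"
    by (auto simp: group_hom_on_def commutator_def fun_eq_iff mult_add_hom[OF d] mult_add_hom[OF e] lin)
  fix \<alpha> \<kappa> x assume x: "\<alpha> \<in> QL" "x \<in> H \<alpha> \<kappa>"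
  show "commutator d e x = (commutator d (N \<kappa>) - commutator e (M \<kappa>)) x"
    using Cent_comm[OF mult_Cent[OF d] mult_Cent[OF e], of \<kappa> \<kappa> x]
    by (simp add: commutator_def mult_act[OF d x] mult_act[OF e x])
qed

lemma degree_derivation_ex:
  assumes "group_hom_on UNIV \<theta>"
  obtains d where "Vector_Spaces.linear sc sc d" "\<And>\<alpha> \<kappa> x. \<alpha> \<in> QL \<Longrightarrow> x \<in> H \<alpha> \<kappa> \<Longrightarrow> d x = sc (\<theta> \<kappa>) x"
proof -
  obtain d where "Vector_Spaces.linear sc sc d"
    "\<And>i x. i \<in> QL \<times> UNIV \<Longrightarrow> x \<in> (\<lambda>(\<alpha>, \<kappa>). H \<alpha> \<kappa>) i \<Longrightarrow> d x = sc (\<theta> (snd i)) x"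
  proof (rule DS.dsum_extend[of sc "\<lambda>i. sc (\<theta> (snd i))"])
    show "Vector_Spaces.linear sc sc (sc (\<theta> (snd i)))" for i
      by (simp add: linear_iff V.vector_space_axioms V.scale_right_distrib mult.commute)
  qed (auto simp: V.vector_space_axioms)
  then show ?thesis using that by fastforce
qed

lemma degree_derivation:
  assumes "group_hom_on UNIV \<theta>"
  shows degree_derivation_linear: "Vector_Spaces.linear sc sc (degree_derivation L \<theta>)"
    and degree_derivation_act: "\<alpha> \<in> QL \<Longrightarrow> x \<in> H \<alpha> \<kappa> \<Longrightarrow> degree_derivation L \<theta> x = sc (\<theta> \<kappa>) x"
proof -
  obtain d where d: "Vector_Spaces.linear sc sc d" "\<And>\<alpha> \<kappa> x. \<alpha> \<in> QL \<Longrightarrow> x \<in> H \<alpha> \<kappa> \<Longrightarrow> d x = sc (\<theta> \<kappa>) x"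
    using degree_derivation_ex[OF assms] by metis
  have "degree_derivation L \<theta> = d"
    unfolding degree_derivation_def
  proof (rule the_equality)
    have "d x = sc (\<theta> \<kappa>) x" if "x \<in> degree_space L \<kappa>" for x \<kappa>
    proof -
      interpret vector_space_pair sc sc by (simp add: vector_space_pair_def V.vector_space_axioms)
      show ?thesis
        by (rule linear_eq_on_span[OF d(1), of "sc (\<theta> \<kappa>)" "\<Union>\<alpha>\<in>QL. H \<alpha> \<kappa>"])
           (use that d(2) in \<open>auto simp: linear_iff V.vector_space_axioms V.scale_right_distrib
              mult.commute degree_space_def\<close>)
    qed
    then show "Vector_Spaces.linear sc sc d \<and> (\<forall>\<kappa>. \<forall>x\<in>degree_space L \<kappa>. d x = sc (\<theta> \<kappa>) x)"
      using d(1) by blast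
    fix d' assume d': "Vector_Spaces.linear sc sc d' \<and> (\<forall>\<kappa>. \<forall>x\<in>degree_space L \<kappa>. d' x = sc (\<theta> \<kappa>) x)"
    show "d' = d"
      by (rule ext, rule homog_ext[of sc d' d]) (use d' d H_sub_degree_space in auto)
  qed
  then show "Vector_Spaces.linear sc sc (degree_derivation L \<theta>)"
    and "\<alpha> \<in> QL \<Longrightarrow> x \<in> H \<alpha> \<kappa> \<Longrightarrow> degree_derivation L \<theta> x = sc (\<theta> \<kappa>) x"
    using d by simp_all
qed

lemma mult_comp:
  assumes \<theta>: "group_hom_on UNIV \<theta>" and c: "c \<in> Cent L"
  shows "mult (c \<circ> degree_derivation L \<theta>) (\<lambda>\<mu>. pointwise sc (\<theta> \<mu>) c)"
  unfolding mult_def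
proof (intro conjI ballI allI)
  note lin = linear_rules[OF degree_derivation_linear[OF \<theta>]] Cent_rules[OF c]
  show "Vector_Spaces.linear sc sc (c \<circ> degree_derivation L \<theta>)"
    by (simp add: linear_iff V.vector_space_axioms lin)
  show "pointwise sc (\<theta> \<kappa>) c \<in> Cent L" for \<kappa> by (rule F.subspace_scale[OF subspace_Cent c])
  show "group_hom_on UNIV (\<lambda>\<mu>. pointwise sc (\<theta> \<mu>) c)"
    using \<theta> by (auto simp: group_hom_on_def pointwise_def V.scale_left_distrib)
  show "(c \<circ> degree_derivation L \<theta>) x = pointwise sc (\<theta> \<kappa>) c x" if "\<alpha> \<in> QL" "x \<in> H \<alpha> \<kappa>" for \<alpha> \<kappa> x
    by (simp add: degree_derivation_act[OF \<theta> that] lin pointwise_def)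
qed

lemma mult_degree_derivation:
  assumes "group_hom_on UNIV \<theta>"
  shows "mult (degree_derivation L \<theta>) (\<lambda>\<mu>. sc (\<theta> \<mu>))"
  using mult_comp[OF assms Cent_deg_Cent[OF id_Cent_deg]] by (simp add: comp_def pointwise_def)

lemma CDer_deg_mult:
  assumes "d \<in> CDer_deg L \<gamma>"
  shows "\<exists>M. mult d M \<and> (\<forall>\<mu>. M \<mu> \<in> Cent_deg L \<gamma>)"
  using assms unfolding CDer_deg_def
proof (induction rule: F.span_induct_alt)
  case base
  show ?case using mult_zero F.subspace_0[OF subspace_Cent_deg] by (metis zero_fun_apply)
next
  case (step k d e)
  then obtain N where N: "mult e N" "\<forall>\<mu>. N \<mu> \<in> Cent_deg L \<gamma>" by blast
  obtain c \<theta> where c: "c \<in> Cent_deg L \<gamma>" "group_hom_on UNIV \<theta>" "d = c \<circ> degree_derivation L \<theta>"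
    using step(1) unfolding degree_derivations_def by blast
  have "mult (pointwise sc k d + e) ((\<lambda>\<mu>. pointwise sc k (pointwise sc (\<theta> \<mu>) c)) + N)"
    unfolding c(3) by (intro mult_add mult_scale mult_comp c(2) Cent_deg_Cent[OF c(1)] N)
  moreover have "((\<lambda>\<mu>. pointwise sc k (pointwise sc (\<theta> \<mu>) c)) + N) \<mu> \<in> Cent_deg L \<gamma>" for \<mu>
    using N c(1) by (auto intro!: F.subspace_add F.subspace_scale subspace_Cent_deg)
  ultimately show ?case by blast
qed

text \<open>Multipliers of degree 0 are scalars, and additivity of the multiplier is additivity of
  these scalars.\<close>

lemma CDer_deg_0:
  assumes "d \<in> CDer_deg L 0"
  obtains \<theta> where "group_hom_on UNIV \<theta>" "d = degree_derivation L \<theta>"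
proof -
  obtain M where M: "mult d M" "\<forall>\<mu>. M \<mu> \<in> Cent_deg L 0" using CDer_deg_mult[OF assms] by blast
  then have "\<exists>k. M \<mu> = sc k" for \<mu> using Cent_deg_0 by metis
  then obtain \<theta> where \<theta>: "\<And>\<mu>. M \<mu> = sc (\<theta> \<mu>)" by metis
  obtain \<alpha> e where e: "e \<in> H \<alpha> 0" "e \<noteq> 0" by (rule nonzero_homogeneous)
  have "group_hom_on UNIV \<theta>"
    unfolding group_hom_on_def
  proof (intro ballI)
    fix x y
    have "sc (\<theta> (x + y)) e = sc (\<theta> x + \<theta> y) e"
      using mult_add_hom[OF M(1), of x y] by (simp add: \<theta> V.scale_left_distrib)
    then show "\<theta> (x + y) = \<theta> x + \<theta> y" using e(2) by simp
  qed
  moreover from this have "d = degree_derivation L \<theta>"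
    using mult_determines[OF M(1)] mult_degree_derivation \<theta> by presburger
  ultimately show ?thesis using that by blast
qed

lemma CDer_deg_subset_CDer: "CDer_deg L \<gamma> \<subseteq> CDer L"
  unfolding CDer_deg_def CDer_def by (rule F.span_mono) (use Cent_deg_Cent in blast)

section \<open>Invariant forms\<close>

lemma form_rules:
  assumes "invariant_form L b"
  shows "b x (y + z) = b x y + b x z" "b (x + y) z = b x z + b y z"
    "b x (y - z) = b x y - b x z" "b (x - y) z = b x z - b y z"
    "b x (sc k y) = k * b x y" "b (sc k x) y = k * b x y" "b x 0 = 0" "b 0 y = 0"
    "b x y = b y x" "b (br x y) z = b x (br y z)" "b (- x) y = - b x y" "b x (- y) = - b x y"
proof -
  interpret l: Vector_Spaces.linear sc "(*)" "b x" for x using assms unfolding invariant_form_def by simp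
  show sym: "b x y = b y x" for x y using assms unfolding invariant_form_def by simp
  show "b x (y + z) = b x y + b x z" "b x (y - z) = b x y - b x z" "b x (sc k y) = k * b x y" "b x 0 = 0"
    "b x (- y) = - b x y"
    by (simp_all add: l.add l.diff l.scale l.zero l.neg)
  show "b (x + y) z = b x z + b y z" unfolding sym[of _ z] by (rule l.add)
  show "b (x - y) z = b x z - b y z" unfolding sym[of _ z] by (rule l.diff)
  show "b (sc k x) y = k * b x y" unfolding sym[of "sc k x"] sym[of x] by (rule l.scale)
  show "b 0 y = 0" unfolding sym[of 0] by (rule l.zero)
  show "b (- x) y = - b x y" unfolding sym[of "- x"] sym[of x] by (rule l.neg)
  show "b (br x y) z = b x (br y z)" using assms unfolding invariant_form_def by blast
qed

text \<open>Invariance under the coroot elements makes roots of non-orthogonal vectors opposite.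
  Neither a grading nor nondegeneracy of b is assumed, because the lemma must apply to a pulled-back
  form before that form is known to be graded.\<close>

lemma form_root_orthogonal:
  assumes lin: "\<And>x y k. b x (sc k y) = k * b x y" and sym: "\<And>x y. b x y = b y x"
    and inv: "\<And>x y z. b (br x y) z = b x (br y z)"
    and "\<alpha> \<in> QL" "\<beta> \<in> QL" "x \<in> H \<alpha> \<kappa>" "y \<in> H \<beta> \<mu>" "b x y \<noteq> 0"
  shows "\<beta> = - \<alpha>"
proof (rule eq_root_if_coroots)
  fix \<gamma> assume \<gamma>: "\<gamma> \<in> Rt.R"
  have "b (br x (coroot_elt \<gamma>)) y = b x (br (coroot_elt \<gamma>) y)" by (rule inv)
  moreover have "br x (coroot_elt \<gamma>) = sc (- Rt.cr \<gamma> \<alpha>) x"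
    using br_anti[of x "coroot_elt \<gamma>"] coroot_elt_act[OF \<gamma> assms(4,6)] by simp
  ultimately have "- Rt.cr \<gamma> \<alpha> * b x y = Rt.cr \<gamma> \<beta> * b x y"
    using coroot_elt_act[OF \<gamma> assms(5,7)] lin sym by metis
  then show "Rt.cr \<gamma> \<beta> = Rt.cr \<gamma> (- \<alpha>)"
    using assms(8) by (simp add: Rt.cr_linear[OF \<gamma>] flip: mult_minus_left)
qed

lemma form_orthogonal:
  assumes b: "invariant_form L b" and "\<alpha> \<in> QL" "\<beta> \<in> QL" "x \<in> H \<alpha> \<kappa>" "y \<in> H \<beta> \<mu>" "b x y \<noteq> 0"
  shows "\<beta> = - \<alpha>" "\<mu> = - \<kappa>"
proof -
  show "\<beta> = - \<alpha>"
    by (rule form_root_orthogonal[of b]) (use assms form_rules[OF b] in auto)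
  have "x \<in> degree_space L \<kappa>" "y \<in> degree_space L \<mu>"
    using assms H_sub_degree_space by blast+
  then have "\<kappa> + \<mu> = 0"
    using b assms(6) unfolding invariant_form_def by metis
  then show "\<mu> = - \<kappa>" by (simp add: eq_neg_iff_add_eq_0 add.commute)
qed

text \<open>Against e, any invariant form sees only the line spanned by f, so a combination of two
  forms that vanishes at (e, f) has e in its radical. The radical is an ideal, hence
  everything.\<close>

lemma form_unique:
  assumes b: "invariant_form L b" and b': "invariant_form L b'"
  obtains a where "a \<noteq> 0" "\<And>x y. b' x y = a * b x y"
proof -
  note r = form_rules(1-8,10)[OF b] and r' = form_rules(1-8,10)[OF b']
  obtain \<alpha> e where e: "\<alpha> \<in> Rt.R" "\<alpha> \<in> QL" "\<alpha> \<noteq> 0" "e \<in> H \<alpha> 0" "e \<noteq> 0" by (rule nonzero_homogeneous)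
  then have "H \<alpha> 0 \<noteq> {0}" by blast
  then obtain f where f: "f \<in> H (- \<alpha>) 0" "H (- \<alpha>) 0 = V.span {f}" using sl2[OF e(2,3)] by (metis minus_zero)
  have opp: "\<beta> = - \<alpha> \<and> \<mu> = 0" if "invariant_form L b" "\<beta> \<in> QL" "y \<in> H \<beta> \<mu>" "b e y \<noteq> 0" for b \<beta> \<mu> y
    using form_orthogonal[OF that(1) e(2) that(2) e(4) that(3,4)] by simp
  have multiple: "\<exists>k. y = sc k f" if "invariant_form L b" "\<beta> \<in> QL" "y \<in> H \<beta> \<mu>" "b e y \<noteq> 0" for b \<beta> \<mu> y
  proof -
    have "y \<in> V.span {f}" using f(2) that(3) opp[OF that] by simp
    then show ?thesis by (auto simp: V.span_singleton)
  qed
  have nz: "b e f \<noteq> 0" if b: "invariant_form L b" for b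
  proof
    assume 0: "b e f = 0"
    have "b e y = 0" for y
    proof (induction y rule: homog_induct)
      case (homogeneous \<beta> \<mu> y)
      show ?case
      proof (rule ccontr)
        assume ne: "b e y \<noteq> 0"
        then obtain k where "y = sc k f" using multiple[OF b homogeneous] by blast
        then show False using 0 ne by (simp add: form_rules(5)[OF b])
      qed
    qed (simp_all add: form_rules(1,7)[OF b])
    then show False using b e(5) unfolding invariant_form_def by blast
  qed
  \<comment> \<open>Chosen to make b' - a b vanish at (e, f); a and its nonvanishing come from
    \<open>nz\<close> applied to both forms.\<close>
  define a where "a = b' e f / b e f"
  define g where "g x y = b' x y - a * b x y" for x y
  have g: "g x (y + z) = g x y + g x z" "g (x + y) z = g x z + g y z" "g (sc k x) y = k * g x y"
    "g x (sc k y) = k * g x y"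
    "g (br x y) z = g x (br y z)" "g 0 y = 0" "g x 0 = 0" for x y z k
    by (simp_all add: g_def r r' algebra_simps)
  have gef: "g e f = 0" using nz[OF b] by (simp add: g_def a_def)
  have "g e y = 0" for y
  proof (induction y rule: homog_induct)
    case (homogeneous \<beta> \<mu> y)
    show ?case
    proof (cases "b e y = 0 \<and> b' e y = 0")
      case False
      then show ?thesis using multiple[OF b homogeneous] multiple[OF b' homogeneous] gef by (auto simp: g)
    qed (simp add: g_def)
  qed (simp_all add: g)
  then have "e \<in> {x. \<forall>y. g x y = 0}" by simp
  moreover have "lie_ideal {x. \<forall>y. g x y = 0}"
    unfolding lie_ideal_def by (auto intro!: V.subspaceI simp: g)
  ultimately have "x \<in> {x. \<forall>y. g x y = 0}" for x using ideal_UNIV e by blast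
  then have "b' x y = a * b x y" for x y by (simp add: g_def)
  moreover have "a \<noteq> 0" using nz[OF b] nz[OF b'] by (simp add: a_def)
  ultimately show ?thesis using that by blast
qed

end

section \<open>Isotopies and derivations\<close>

context centreless_lie_torus
begin

text \<open>A linear domain containing every \<open>CDer_deg L \<gamma>\<close>, on which
  \<open>psi\<close> and \<open>T\<close> are additive without tracking degree or skewness.\<close>

definition "derivs = {d. \<exists>M. mult d M}"

lemma derivsI: "mult d M \<Longrightarrow> d \<in> derivs" by (auto simp: derivs_def)

lemma subspace_derivs: "F.subspace derivs"
  by (rule F.subspaceI) (auto simp: derivs_def intro: mult_zero mult_add mult_scale)

lemma CDer_deg_derivs: "CDer_deg L \<gamma> \<subseteq> derivs"
  using CDer_deg_mult derivsI by blast

end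

lemma pointwise_apply: "pointwise t c f x = t c (f x)"
  by (simp add: pointwise_def)

text \<open>The bi-isomorphism from the isotope is expressed in the original grading of L by
  \<open>phi_H\<close>. This keeps the regraded torus out of the proof and makes the data symmetric
  in the two tori.\<close>

locale isotopy = A: centreless_lie_torus L + B: centreless_lie_torus L'
  for L :: "('f::field_char_0, 'v::ab_group_add, 'g::ab_group_add, 'l::ab_group_add) graded_lie"
    and L' :: "('f, 'w::ab_group_add, 'h::ab_group_add, 'm::ab_group_add) graded_lie" +
  fixes \<phi> :: "'l \<Rightarrow> 'm" and \<phi>\<^sub>r :: "'v \<Rightarrow> 'w" and \<phi>\<^sub>e :: "'g \<Rightarrow> 'h" and s :: "'v \<Rightarrow> 'g"
  assumes phi_bij: "bij \<phi>" and phi_linear: "Vector_Spaces.linear (lscale L) (lscale L') \<phi>"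
    and phi_br: "\<And>x y. \<phi> (bracket L x y) = bracket L' (\<phi> x) (\<phi> y)"
    and r_bij: "bij_betw \<phi>\<^sub>r (Qlat L) (Qlat L')" and r_hom: "group_hom_on (Qlat L) \<phi>\<^sub>r"
    and e_bij: "bij \<phi>\<^sub>e" and e_hom: "group_hom_on UNIV \<phi>\<^sub>e"
    and s_hom: "group_hom_on (Qlat L) s"
    and phi_H: "\<And>\<alpha> \<kappa>. \<alpha> \<in> Qlat L \<Longrightarrow> \<phi> ` homog L \<alpha> \<kappa> = homog L' (\<phi>\<^sub>r \<alpha>) (\<phi>\<^sub>e (\<kappa> - s \<alpha>))"
begin

abbreviation "QL \<equiv> Qlat L"
abbreviation "QL' \<equiv> Qlat L'"

lemma phi_rules:
  "\<phi> (x + y) = \<phi> x + \<phi> y" "\<phi> (x - y) = \<phi> x - \<phi> y" "\<phi> (A.sc k x) = B.sc k (\<phi> x)" "\<phi> 0 = 0"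
proof -
  interpret l: Vector_Spaces.linear A.sc B.sc \<phi> by (rule phi_linear)
  show "\<phi> (x + y) = \<phi> x + \<phi> y" "\<phi> (x - y) = \<phi> x - \<phi> y" "\<phi> (A.sc k x) = B.sc k (\<phi> x)" "\<phi> 0 = 0"
    by (simp_all add: l.add l.diff l.scale l.zero)
qed

lemma phi_inv [simp]: "inv \<phi> (\<phi> x) = x" "\<phi> (inv \<phi> y) = y"
  using phi_bij by (simp_all add: bij_is_inj bij_is_surj surj_f_inv_f)

lemma phi_inject [simp]: "\<phi> x = \<phi> y \<longleftrightarrow> x = y"
  using phi_bij by (simp add: bij_is_inj inj_eq)

lemma e_inv [simp]: "inv \<phi>\<^sub>e (\<phi>\<^sub>e \<kappa>) = \<kappa>" "\<phi>\<^sub>e (inv \<phi>\<^sub>e \<mu>) = \<mu>"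
  using e_bij by (simp_all add: bij_is_inj bij_is_surj surj_f_inv_f)

lemma e_inject [simp]: "\<phi>\<^sub>e x = \<phi>\<^sub>e y \<longleftrightarrow> x = y"
  using e_bij by (simp add: bij_is_inj inj_eq)

lemma e_add: "\<phi>\<^sub>e (x + y) = \<phi>\<^sub>e x + \<phi>\<^sub>e y"
  and e_diff: "\<phi>\<^sub>e (x - y) = \<phi>\<^sub>e x - \<phi>\<^sub>e y"
  and e_minus: "\<phi>\<^sub>e (- x) = - \<phi>\<^sub>e x"
  and e_zero: "\<phi>\<^sub>e 0 = 0"
  using group_hom_on_rules[OF e_hom zmod.subspace_UNIV] by simp_all

lemma e_inv_add: "inv \<phi>\<^sub>e (x + y) = inv \<phi>\<^sub>e x + inv \<phi>\<^sub>e y"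
proof -
  have "\<phi>\<^sub>e (inv \<phi>\<^sub>e (x + y)) = \<phi>\<^sub>e (inv \<phi>\<^sub>e x + inv \<phi>\<^sub>e y)" by (simp add: e_add)
  then show ?thesis by (simp only: e_inject)
qed

lemma s_zero: "s 0 = 0"
  by (rule group_hom_on_zero[OF s_hom subspace_root_lattice])

lemma r_zero: "\<phi>\<^sub>r 0 = 0"
  by (rule group_hom_on_zero[OF r_hom subspace_root_lattice])

lemma r_in: "\<alpha> \<in> QL \<Longrightarrow> \<phi>\<^sub>r \<alpha> \<in> QL'"
  using r_bij by (auto simp: bij_betw_def)

lemma H'_cases:
  assumes "\<alpha>' \<in> QL'" "x' \<in> B.H \<alpha>' \<kappa>'"
  obtains \<alpha> \<kappa> x where "\<alpha> \<in> QL" "\<alpha>' = \<phi>\<^sub>r \<alpha>" "\<kappa>' = \<phi>\<^sub>e (\<kappa> - s \<alpha>)" "x \<in> A.H \<alpha> \<kappa>" "x' = \<phi> x"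
proof -
  obtain \<alpha> where \<alpha>: "\<alpha> \<in> QL" "\<alpha>' = \<phi>\<^sub>r \<alpha>" using assms(1) r_bij by (auto simp: bij_betw_def)
  have \<kappa>': "\<kappa>' = \<phi>\<^sub>e ((inv \<phi>\<^sub>e \<kappa>' + s \<alpha>) - s \<alpha>)" by simp
  have "x' \<in> \<phi> ` A.H \<alpha> (inv \<phi>\<^sub>e \<kappa>' + s \<alpha>)" using assms(2) \<alpha>(2) by (simp add: phi_H[OF \<alpha>(1)])
  then obtain x where "x \<in> A.H \<alpha> (inv \<phi>\<^sub>e \<kappa>' + s \<alpha>)" "x' = \<phi> x" by blast
  then show ?thesis using that[OF \<alpha> \<kappa>'] by blast
qed

lemma phi_in_H: "\<alpha> \<in> QL \<Longrightarrow> x \<in> A.H \<alpha> \<kappa> \<Longrightarrow> \<phi> x \<in> B.H (\<phi>\<^sub>r \<alpha>) (\<phi>\<^sub>e (\<kappa> - s \<alpha>))"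
  using phi_H by blast

lemma phi_H00: "\<phi> ` A.H 0 0 = B.H 0 0"
  using phi_H[of 0 0] by (simp add: s_zero r_zero e_zero root_lattice_simps)

section \<open>The inverse isotopy\<close>

definition "s_inv \<alpha>' = - \<phi>\<^sub>e (s (inv_into QL \<phi>\<^sub>r \<alpha>'))"

text \<open>The inverse of \<phi> raises the degree, transported back, by s at the corresponding
  root. The locale subtracts the shift, hence the sign in \<open>s_inv\<close>. Interpreting the
  locale here supplies converse inclusions, inverses and surjectivity.\<close>

lemma isotopy_inverse:
  "isotopy L' L (inv \<phi>) (inv_into QL \<phi>\<^sub>r) (inv \<phi>\<^sub>e) s_inv"
proof (intro isotopy.intro isotopy_axioms.intro A.centreless_lie_torus_axioms B.centreless_lie_torus_axioms)
  let ?r = "inv_into QL \<phi>\<^sub>r"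
  show "bij (inv \<phi>)" using phi_bij by (rule bij_imp_bij_inv)
  show "bij (inv \<phi>\<^sub>e)" using e_bij by (rule bij_imp_bij_inv)
  show r'_bij: "bij_betw ?r QL' QL" using r_bij by (rule bij_betw_inv_into)
  have r'_in: "?r \<alpha> \<in> QL" if "\<alpha> \<in> QL'" for \<alpha> using that r'_bij by (auto simp: bij_betw_def)
  have rr': "\<phi>\<^sub>r (?r \<alpha>) = \<alpha>" if "\<alpha> \<in> QL'" for \<alpha> using that r_bij by (simp add: bij_betw_inv_into_right)
  have r'r: "?r (\<phi>\<^sub>r \<alpha>) = \<alpha>" if "\<alpha> \<in> QL" for \<alpha> using that r_bij by (simp add: bij_betw_inv_into_left)
  have r'add: "?r (\<alpha> + \<beta>) = ?r \<alpha> + ?r \<beta>" if "\<alpha> \<in> QL'" "\<beta> \<in> QL'" for \<alpha> \<beta>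
  proof -
    have "\<phi>\<^sub>r (?r \<alpha> + ?r \<beta>) = \<alpha> + \<beta>"
      using group_hom_on_add[OF r_hom subspace_root_lattice] r'_in that rr' by simp
    then show ?thesis using r'r[of "?r \<alpha> + ?r \<beta>"] r'_in[OF that(1)] r'_in[OF that(2)] by (auto simp: root_lattice_simps)
  qed
  show "Vector_Spaces.linear (lscale L') (lscale L) (inv \<phi>)"
    unfolding linear_iff
  proof (intro conjI allI A.V.vector_space_axioms B.V.vector_space_axioms)
    show "inv \<phi> (x + y) = inv \<phi> x + inv \<phi> y" for x y
      by (subst phi_inject[symmetric]) (simp add: phi_rules del: phi_inject)
    show "inv \<phi> (lscale L' c x) = lscale L c (inv \<phi> x)" for c x
      by (subst phi_inject[symmetric]) (simp add: phi_rules del: phi_inject)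
  qed
  show "inv \<phi> (bracket L' x y) = bracket L (inv \<phi> x) (inv \<phi> y)" for x y
    by (subst phi_inject[symmetric]) (simp add: phi_br del: phi_inject)
  show "group_hom_on QL' ?r" by (simp add: group_hom_on_def r'add)
  show "group_hom_on UNIV (inv \<phi>\<^sub>e)" by (simp add: group_hom_on_def e_inv_add)
  show "group_hom_on QL' s_inv"
    using r'_in by (simp add: s_inv_def group_hom_on_def r'add group_hom_on_add[OF s_hom subspace_root_lattice] e_add)
  fix \<alpha>' \<kappa>' assume \<alpha>': "\<alpha>' \<in> QL'"
  have "\<phi> ` A.H (?r \<alpha>') (inv \<phi>\<^sub>e \<kappa>' + s (?r \<alpha>')) = B.H \<alpha>' \<kappa>'"
    by (subst phi_H) (simp_all add: r'_in rr' \<alpha>')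
  then have "inv \<phi> ` B.H \<alpha>' \<kappa>' = A.H (?r \<alpha>') (inv \<phi>\<^sub>e \<kappa>' + s (?r \<alpha>'))"
    by (metis image_inv_f_f phi_bij bij_is_inj)
  then show "inv \<phi> ` B.H \<alpha>' \<kappa>' = A.H (?r \<alpha>') (inv \<phi>\<^sub>e (\<kappa>' - s_inv \<alpha>'))"
    by (simp add: e_inv_add s_inv_def)
qed

section \<open>Conjugation of centroid elements\<close>

definition "conj_by c = (\<lambda>y. \<phi> (c (inv \<phi> y)))"

lemma conj_by_phi: "conj_by c (\<phi> x) = \<phi> (c x)"
  by (simp add: conj_by_def)

lemma conj_by_Cent:
  assumes "c \<in> Cent L"
  shows "conj_by c \<in> Cent L'"
proof -
  interpret I: isotopy L' L "inv \<phi>" "inv_into QL \<phi>\<^sub>r" "inv \<phi>\<^sub>e" s_inv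
    by (rule isotopy_inverse)
  show ?thesis
    by (simp add: Cent_def conj_by_def linear_iff A.V.vector_space_axioms B.V.vector_space_axioms
        I.phi_rules I.phi_br phi_rules phi_br A.Cent_rules[OF assms] A.Cent_br[OF assms])
qed

text \<open>Conjugation is graded although \<phi> is not: c preserves roots, so the shift s \<alpha>
  is the same before and after c and cancels.\<close>

lemma conj_by_Cent_deg:
  assumes c: "c \<in> Cent_deg L \<gamma>"
  shows "conj_by c \<in> Cent_deg L' (\<phi>\<^sub>e \<gamma>)"
proof (rule B.Cent_degI)
  show "conj_by c \<in> Cent L'" by (rule conj_by_Cent[OF A.Cent_deg_Cent[OF c]])
  fix \<alpha>' \<kappa>' x' assume "\<alpha>' \<in> QL'" "x' \<in> B.H \<alpha>' \<kappa>'"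
  then obtain \<alpha> \<kappa> x where x: "\<alpha> \<in> QL" "\<alpha>' = \<phi>\<^sub>r \<alpha>" "\<kappa>' = \<phi>\<^sub>e (\<kappa> - s \<alpha>)" "x \<in> A.H \<alpha> \<kappa>" "x' = \<phi> x"
    by (rule H'_cases)
  have "\<phi> (c x) \<in> B.H (\<phi>\<^sub>r \<alpha>) (\<phi>\<^sub>e (\<gamma> + \<kappa> - s \<alpha>))"
    by (rule phi_in_H[OF x(1) A.Cent_deg_homogeneous[OF c x(1,4)]])
  then show "conj_by c x' \<in> B.H \<alpha>' (\<phi>\<^sub>e \<gamma> + \<kappa>')"
    by (simp add: x conj_by_phi e_add e_diff algebra_simps)
qed

lemma support_image_subset: "\<phi>\<^sub>e ` centroid_support L \<subseteq> centroid_support L'"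
proof
  fix \<delta> assume "\<delta> \<in> \<phi>\<^sub>e ` centroid_support L"
  then obtain \<gamma> where \<gamma>: "\<delta> = \<phi>\<^sub>e \<gamma>" "Cent_deg L \<gamma> \<noteq> {0}" by (auto simp: centroid_support_def)
  then obtain c where c: "c \<in> Cent_deg L \<gamma>" "c \<noteq> 0"
    using A.F.subspace_0[OF A.subspace_Cent_deg] by blast
  then obtain x where "c x \<noteq> 0" by (auto simp: fun_eq_iff)
  then have "conj_by c (\<phi> x) \<noteq> 0" using phi_inject[of "c x" 0] by (simp add: conj_by_phi phi_rules del: phi_inject)
  then have "conj_by c \<noteq> 0" by (metis zero_fun_apply)
  then show "\<delta> \<in> centroid_support L'" using conj_by_Cent_deg[OF c(1)] \<gamma>(1) by (auto simp: centroid_support_def)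
qed

lemma support_image: "\<phi>\<^sub>e ` centroid_support L = centroid_support L'"
proof (rule antisym[OF support_image_subset])
  interpret I: isotopy L' L "inv \<phi>" "inv_into QL \<phi>\<^sub>r" "inv \<phi>\<^sub>e" s_inv
    by (rule isotopy_inverse)
  show "centroid_support L' \<subseteq> \<phi>\<^sub>e ` centroid_support L"
  proof
    fix \<delta> assume "\<delta> \<in> centroid_support L'"
    then have "inv \<phi>\<^sub>e \<delta> \<in> centroid_support L" using I.support_image_subset by blast
    then show "\<delta> \<in> \<phi>\<^sub>e ` centroid_support L" by (metis e_inv(2) imageI)
  qed
qed

section \<open>The inner correction of a derivation\<close>

lemma psi_exists:
  assumes M: "A.mult d M" and S: "A.F.subspace S" "S \<subseteq> Cent L" and MS: "\<And>\<mu>. M \<mu> \<in> S"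
  obtains u where "\<And>\<alpha>. u \<alpha> \<in> S"
    "\<And>\<beta> \<mu> x. \<beta> \<in> QL \<Longrightarrow> x \<in> A.H \<beta> \<mu> \<Longrightarrow> A.br (\<Sum>\<alpha>\<in>A.Rt.R. u \<alpha> (A.coroot_elt \<alpha>)) x = M (s \<beta>) x"
proof -
  \<comment> \<open>The unwanted action is a homomorphism from the root lattice, hence a combination
    of coroots with coefficients u in S. Centroid coefficients move in and out of brackets, so
    applying each u \<alpha> to the coroot element of \<alpha> realises it.\<close>
  have "group_hom_on QL (\<lambda>\<beta>. M (s \<beta>))"
    by (simp add: group_hom_on_def A.mult_add_hom[OF M] group_hom_on_add[OF s_hom subspace_root_lattice])
  then obtain u where u: "\<And>\<alpha>. u \<alpha> \<in> S"
    "\<And>\<beta>. \<beta> \<in> QL \<Longrightarrow> M (s \<beta>) = (\<Sum>\<alpha>\<in>A.Rt.R. pointwise A.sc (A.Rt.cr \<alpha> \<beta>) (u \<alpha>))"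
    using A.Rt.hom_coroot_combination[OF A.F.vector_space_axioms _ S(1), of "\<lambda>\<beta>. M (s \<beta>)"] MS by blast
  have "A.br (\<Sum>\<alpha>\<in>A.Rt.R. u \<alpha> (A.coroot_elt \<alpha>)) x = M (s \<beta>) x" if x: "\<beta> \<in> QL" "x \<in> A.H \<beta> \<mu>" for \<beta> \<mu> x
  proof -
    have br_sum: "A.br (\<Sum>\<alpha>\<in>X. g \<alpha>) x = (\<Sum>\<alpha>\<in>X. A.br (g \<alpha>) x)" for X and g :: "'v \<Rightarrow> 'l"
      by (induction X rule: infinite_finite_induct) (simp_all add: A.br_linear)
    have uC: "u \<alpha> \<in> Cent L" for \<alpha> using u(1) S(2) by blast
    have "A.br (u \<alpha> (A.coroot_elt \<alpha>)) x = A.sc (A.Rt.cr \<alpha> \<beta>) (u \<alpha> x)" if "\<alpha> \<in> A.Rt.R" for \<alpha>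
      using A.Cent_br_left[OF uC, symmetric] A.coroot_elt_act[OF that x] A.Cent_rules(3)[OF uC] by simp
    then show ?thesis by (simp add: br_sum u(2)[OF x(1)] sum_fun_apply pointwise_def)
  qed
  then show ?thesis using that u(1) by blast
qed

text \<open>M is unique, and an element is determined by its action, so this fixes psi d by d alone.
  Linearity and the commutator rule then follow by comparing actions, without choosing
  coefficients.\<close>

definition "psi_spec d p \<longleftrightarrow> (\<exists>M. A.mult d M \<and> (\<forall>\<beta>\<in>QL. \<forall>\<mu>. \<forall>x\<in>A.H \<beta> \<mu>. A.br p x = M (s \<beta>) x))"

definition "psi d = (THE p. psi_spec d p)"

lemma psi_eqI:
  assumes "A.mult d M" "\<And>\<beta> \<mu> x. \<beta> \<in> QL \<Longrightarrow> x \<in> A.H \<beta> \<mu> \<Longrightarrow> A.br p x = M (s \<beta>) x"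
  shows "psi d = p"
  unfolding psi_def
proof (rule the_equality)
  show "psi_spec d p" unfolding psi_spec_def using assms by blast
  fix q assume "psi_spec d q"
  then obtain N where N: "A.mult d N" "\<forall>\<beta>\<in>QL. \<forall>\<mu>. \<forall>x\<in>A.H \<beta> \<mu>. A.br q x = N (s \<beta>) x"
    unfolding psi_spec_def by blast
  have "N = M" by (rule A.mult_unique[OF N(1) assms(1)])
  show "q = p"
    by (rule A.eq_if_same_action) (simp add: assms(2) N(2) \<open>N = M\<close>)
qed

text \<open>S is the whole centroid or \<open>Cent_deg L \<gamma>\<close>; the second choice places
  psi d in a single degree.\<close>

lemma psi_combination:
  assumes M: "A.mult d M" and S: "A.F.subspace S" "S \<subseteq> Cent L" and MS: "\<And>\<mu>. M \<mu> \<in> S"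
  obtains u where "\<And>\<alpha>. u \<alpha> \<in> S" "psi d = (\<Sum>\<alpha>\<in>A.Rt.R. u \<alpha> (A.coroot_elt \<alpha>))"
proof (rule psi_exists[OF assms])
  fix u assume "\<And>\<alpha>. u \<alpha> \<in> S"
    "\<And>\<beta> \<mu> x. \<beta> \<in> QL \<Longrightarrow> x \<in> A.H \<beta> \<mu> \<Longrightarrow> A.br (\<Sum>\<alpha>\<in>A.Rt.R. u \<alpha> (A.coroot_elt \<alpha>)) x = M (s \<beta>) x"
  then show thesis using that psi_eqI[OF M] by blast
qed

lemma psi_act:
  assumes M: "A.mult d M" and x: "\<beta> \<in> QL" "x \<in> A.H \<beta> \<mu>"
  shows "A.br (psi d) x = M (s \<beta>) x"
proof (rule psi_exists[OF M A.subspace_Cent order_refl A.mult_Cent[OF M]])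
  fix u assume u: "\<And>\<alpha>. u \<alpha> \<in> Cent L"
    "\<And>\<beta> \<mu> x. \<beta> \<in> QL \<Longrightarrow> x \<in> A.H \<beta> \<mu> \<Longrightarrow> A.br (\<Sum>\<alpha>\<in>A.Rt.R. u \<alpha> (A.coroot_elt \<alpha>)) x = M (s \<beta>) x"
  then show ?thesis using psi_eqI[OF M u(2)] x by simp
qed

lemma psi_CDer_deg:
  assumes "d \<in> CDer_deg L \<gamma>"
  shows "psi d \<in> A.H 0 \<gamma>"
proof -
  obtain M where M: "A.mult d M" "\<And>\<mu>. M \<mu> \<in> Cent_deg L \<gamma>" using A.CDer_deg_mult[OF assms] by blast
  have 0: "0 \<in> QL" by (rule root_lattice_simps)
  obtain u where u: "\<And>\<alpha>. u \<alpha> \<in> Cent_deg L \<gamma>" "psi d = (\<Sum>\<alpha>\<in>A.Rt.R. u \<alpha> (A.coroot_elt \<alpha>))"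
    using psi_combination[OF M(1) A.subspace_Cent_deg _ M(2)] A.Cent_deg_Cent by (metis subsetI)
  have "u \<alpha> (A.coroot_elt \<alpha>) \<in> A.H 0 \<gamma>" if "\<alpha> \<in> A.Rt.R" for \<alpha>
    using A.Cent_deg_homogeneous[OF u(1) 0 A.coroot_elt_H[OF that]] by simp
  then show ?thesis unfolding u(2) by (intro A.V.subspace_sum A.H_subspace 0)
qed

lemma psi_add:
  assumes "d \<in> A.derivs" "e \<in> A.derivs"
  shows "psi (d + e) = psi d + psi e"
proof -
  obtain M N where M: "A.mult d M" and N: "A.mult e N" using assms unfolding A.derivs_def by blast
  show ?thesis
    by (rule psi_eqI[OF A.mult_add[OF M N]]) (simp add: A.br_linear psi_act[OF M] psi_act[OF N])
qed

lemma psi_scale: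
  assumes "d \<in> A.derivs"
  shows "psi (pointwise A.sc k d) = A.sc k (psi d)"
proof -
  obtain M where M: "A.mult d M" using assms unfolding A.derivs_def by blast
  show ?thesis
    by (rule psi_eqI[OF A.mult_scale[OF M]]) (simp add: A.br_linear psi_act[OF M] pointwise_apply)
qed

text \<open>psi d acts as M (s 0) = 0 on vectors of root 0, in particular on coroot elements, and
  psi e is obtained from these by centroid elements, which pull out of the bracket.\<close>

lemma br_psi_psi:
  assumes "d \<in> A.derivs" "e \<in> A.derivs"
  shows "A.br (psi d) (psi e) = 0"
proof -
  obtain M N where M: "A.mult d M" and N: "A.mult e N" using assms unfolding A.derivs_def by blast
  obtain u where u: "\<And>\<alpha>. u \<alpha> \<in> Cent L" "psi e = (\<Sum>\<alpha>\<in>A.Rt.R. u \<alpha> (A.coroot_elt \<alpha>))"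
    using psi_combination[OF N A.subspace_Cent order_refl A.mult_Cent[OF N]] by blast
  have br_sum: "A.br x (\<Sum>\<alpha>\<in>X. g \<alpha>) = (\<Sum>\<alpha>\<in>X. A.br x (g \<alpha>))" for X x and g :: "'v \<Rightarrow> 'l"
    by (induction X rule: infinite_finite_induct) (simp_all add: A.br_linear)
  have M0: "M 0 = 0" by (rule group_hom_on_zero[OF A.mult_hom[OF M] zmod.subspace_UNIV])
  have "A.br (psi d) (u \<alpha> (A.coroot_elt \<alpha>)) = 0" if "\<alpha> \<in> A.Rt.R" for \<alpha>
    using A.Cent_br[OF u(1), symmetric] psi_act[OF M root_lattice_simps(1) A.coroot_elt_H[OF that]]
    by (simp add: s_zero M0 A.Cent_rules(4)[OF u(1)])
  then show ?thesis by (simp add: u(2) br_sum)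
qed

text \<open>For a derivation d, ad (d p) is the commutator of d with ad p. With p = psi e, on root
  \<beta>, this is the commutator of d with N (s \<beta>), one of the two terms in the multiplier of
  [d, e] at s \<beta>.\<close>

lemma psi_commutator:
  assumes "d \<in> A.derivs" "e \<in> A.derivs"
  shows "psi (commutator d e) = d (psi e) - e (psi d)"
proof -
  obtain M N where M: "A.mult d M" and N: "A.mult e N" using assms unfolding A.derivs_def by blast
  have br: "A.br (d p) x = d (A.br p x) - A.br p (d x)" if "A.mult d M" for d M p x
    using A.mult_derivation[OF that, of p x] by simp
  show ?thesis
  proof (rule psi_eqI[OF A.mult_commutator[OF M N]])
    fix \<beta> \<mu> x assume x: "\<beta> \<in> QL" "x \<in> A.H \<beta> \<mu>"
    \<comment> \<open>M \<mu> x need not be homogeneous, so \<open>psi_act\<close> is applied to x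
      itself and the centroid element is pulled out of the bracket.\<close>
    have c: "A.br (psi e) (M \<mu> x) = N (s \<beta>) (M \<mu> x)" "A.br (psi d) (N \<mu> x) = M (s \<beta>) (N \<mu> x)"
      using A.Cent_br[OF A.mult_Cent[OF M], symmetric] A.Cent_br[OF A.mult_Cent[OF N], symmetric]
        psi_act[OF M x] psi_act[OF N x] A.Cent_comm[OF A.mult_Cent[OF M] A.mult_Cent[OF N]] by simp_all
    show "A.br (d (psi e) - e (psi d)) x = (commutator d (N (s \<beta>)) - commutator e (M (s \<beta>))) x"
      by (simp add: A.br_linear br[OF M] br[OF N] psi_act[OF M x] psi_act[OF N x]
          A.mult_act[OF M x] A.mult_act[OF N x] c commutator_def)
  qed
qed

section \<open>Transfer of derivations\<close>

definition "T d = conj_by (\<lambda>x. d x - A.br (psi d) x)"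

lemma T_phi: "T d (\<phi> x) = \<phi> (d x - A.br (psi d) x)"
  by (simp add: T_def conj_by_phi)

text \<open>On root \<alpha> and degree \<kappa>, d minus ad (psi d) acts as M \<kappa> - M (s
  \<alpha>) = M (\<kappa> - s \<alpha>), and \<open>\<phi>\<^sub>e (\<kappa> - s \<alpha>)\<close>
  is precisely the degree of the image. The root has disappeared.\<close>

lemma T_mult:
  assumes M: "A.mult d M"
  shows "B.mult (T d) (\<lambda>\<mu>. conj_by (M (inv \<phi>\<^sub>e \<mu>)))"
  unfolding B.mult_def
proof (intro conjI allI ballI)
  interpret I: isotopy L' L "inv \<phi>" "inv_into QL \<phi>\<^sub>r" "inv \<phi>\<^sub>e" s_inv
    by (rule isotopy_inverse)
  show "Vector_Spaces.linear B.sc B.sc (T d)"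
    by (simp add: linear_iff B.V.vector_space_axioms T_def conj_by_def I.phi_rules phi_rules
        A.linear_rules[OF A.mult_linear[OF M]] A.br_linear B.V.scale_right_diff_distrib)
  show "conj_by (M (inv \<phi>\<^sub>e \<kappa>)) \<in> Cent L'" for \<kappa> by (rule conj_by_Cent[OF A.mult_Cent[OF M]])
  show "group_hom_on UNIV (\<lambda>\<mu>. conj_by (M (inv \<phi>\<^sub>e \<mu>)))"
    by (simp add: group_hom_on_def conj_by_def fun_eq_iff e_inv_add A.mult_add_hom[OF M] phi_rules)
  fix \<alpha>' \<kappa>' x' assume "\<alpha>' \<in> QL'" "x' \<in> B.H \<alpha>' \<kappa>'"
  then obtain \<alpha> \<kappa> x where x: "\<alpha> \<in> QL" "\<alpha>' = \<phi>\<^sub>r \<alpha>" "\<kappa>' = \<phi>\<^sub>e (\<kappa> - s \<alpha>)" "x \<in> A.H \<alpha> \<kappa>" "x' = \<phi> x"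
    by (rule H'_cases)
  have "M (\<kappa> - s \<alpha>) = M \<kappa> - M (s \<alpha>)"
    using group_hom_on_diff[OF A.mult_hom[OF M] zmod.subspace_UNIV] by simp
  then show "T d x' = conj_by (M (inv \<phi>\<^sub>e \<kappa>')) x'"
    by (simp add: x T_phi conj_by_phi A.mult_act[OF M x(1,4)] psi_act[OF M x(1,4)])
qed

lemma T_add: "d \<in> A.derivs \<Longrightarrow> e \<in> A.derivs \<Longrightarrow> T (d + e) = T d + T e"
  by (simp add: T_def conj_by_def psi_add A.br_linear fun_eq_iff phi_rules)

lemma T_scale: "d \<in> A.derivs \<Longrightarrow> T (pointwise A.sc k d) = pointwise B.sc k (T d)"
  by (simp add: T_def conj_by_def psi_scale A.br_linear fun_eq_iff phi_rules pointwise_apply B.V.scale_right_diff_distrib)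

lemma T_zero: "T 0 = 0"
  using T_scale[of 0 0] A.F.subspace_0[OF A.subspace_derivs] by (simp add: A.F.scale_zero_left B.F.scale_zero_left)

text \<open>The actions of psi d and psi e commute, so the commutator of the two corrected
  derivations is [d, e] corrected by d (psi e) - e (psi d), which is psi [d, e].\<close>

lemma T_commutator:
  assumes d: "d \<in> A.derivs" and e: "e \<in> A.derivs"
  shows "T (commutator d e) = commutator (T d) (T e)"
proof -
  obtain M N where M: "A.mult d M" and N: "A.mult e N" using assms unfolding A.derivs_def by blast
  have der: "d (A.br x y) = A.br (d x) y + A.br x (d y)" "e (A.br x y) = A.br (e x) y + A.br x (e y)" for x y
    using A.mult_derivation[OF M] A.mult_derivation[OF N] by simp_all
  note lin = A.linear_rules[OF A.mult_linear[OF M]] A.linear_rules[OF A.mult_linear[OF N]]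
  have "A.br (psi d) (A.br (psi e) x) = A.br (psi e) (A.br (psi d) x)" for x
    using A.jacobi[of "psi d" "psi e" x] by (simp add: br_psi_psi[OF d e] A.br_linear)
  moreover have "T (commutator d e) (\<phi> x) = \<phi> (commutator d e x - A.br (d (psi e) - e (psi d)) x)" for x
    by (simp only: T_phi psi_commutator[OF d e])
  ultimately have "T (commutator d e) (\<phi> x) = commutator (T d) (T e) (\<phi> x)" for x
    by (simp add: T_phi commutator_def A.br_linear der lin flip: phi_rules(2))
  then have "T (commutator d e) (\<phi> (inv \<phi> y)) = commutator (T d) (T e) (\<phi> (inv \<phi> y))" for y by blast
  then show ?thesis by (simp add: fun_eq_iff)
qed

text \<open>Scalar multipliers are unchanged by conjugation. This is what makes \<open>ev\<close>
  compatible with T.\<close>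

lemma T_degree_derivation:
  assumes \<theta>: "group_hom_on UNIV \<theta>"
  shows "group_hom_on UNIV (\<lambda>\<mu>. \<theta> (inv \<phi>\<^sub>e \<mu>))"
    "T (degree_derivation L \<theta>) = degree_derivation L' (\<lambda>\<mu>. \<theta> (inv \<phi>\<^sub>e \<mu>))"
proof -
  show \<theta>': "group_hom_on UNIV (\<lambda>\<mu>. \<theta> (inv \<phi>\<^sub>e \<mu>))"
    using \<theta> by (simp add: group_hom_on_def e_inv_add)
  have "conj_by (A.sc k) = B.sc k" for k by (simp add: conj_by_def fun_eq_iff phi_rules)
  then show "T (degree_derivation L \<theta>) = degree_derivation L' (\<lambda>\<mu>. \<theta> (inv \<phi>\<^sub>e \<mu>))"
    using T_mult[OF A.mult_degree_derivation[OF \<theta>]] B.mult_degree_derivation[OF \<theta>']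
    by (intro B.mult_determines) simp_all
qed

lemma T_CDer_deg:
  assumes "d \<in> CDer_deg L \<gamma>"
  shows "T d \<in> CDer_deg L' (\<phi>\<^sub>e \<gamma>)"
proof -
  \<comment> \<open>Membership in \<open>derivs\<close> is carried through the induction because T
    is additive only there.\<close>
  have "d \<in> A.derivs \<and> T d \<in> CDer_deg L' (\<phi>\<^sub>e \<gamma>)"
    using assms unfolding CDer_deg_def[of L]
  proof (induction rule: A.F.span_induct_alt)
    case base
    show ?case
      unfolding T_zero CDer_deg_def by (intro conjI A.F.subspace_0[OF A.subspace_derivs] B.F.span_zero)
  next
    case (step k d e)
    obtain c \<theta> where c: "c \<in> Cent_deg L \<gamma>" and \<theta>: "group_hom_on UNIV \<theta>" and d: "d = c \<circ> degree_derivation L \<theta>"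
      using step(1) unfolding degree_derivations_def by blast
    have m: "A.mult d (\<lambda>\<mu>. pointwise A.sc (\<theta> \<mu>) c)"
      unfolding d by (rule A.mult_comp[OF \<theta> A.Cent_deg_Cent[OF c]])
    then have dd: "d \<in> A.derivs" by (rule A.derivsI)
    have "conj_by (pointwise A.sc k c) = pointwise B.sc k (conj_by c)" for k
      by (simp add: conj_by_def pointwise_def phi_rules)
    then have "T d = conj_by c \<circ> degree_derivation L' (\<lambda>\<mu>. \<theta> (inv \<phi>\<^sub>e \<mu>))"
      using T_mult[OF m] B.mult_comp[OF T_degree_derivation(1)[OF \<theta>] conj_by_Cent[OF A.Cent_deg_Cent[OF c]]]
      by (intro B.mult_determines) simp_all
    then have "T d \<in> CDer_deg L' (\<phi>\<^sub>e \<gamma>)"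
      unfolding CDer_deg_def degree_derivations_def
      using conj_by_Cent_deg[OF c] T_degree_derivation(1)[OF \<theta>] by (intro B.F.span_base) blast
    have e: "e \<in> A.derivs" using step by blast
    have kd: "pointwise A.sc k d \<in> A.derivs" by (rule A.F.subspace_scale[OF A.subspace_derivs dd])
    have "T (pointwise A.sc k d + e) = pointwise B.sc k (T d) + T e"
      by (simp only: T_add[OF kd e] T_scale[OF dd])
    also have "\<dots> \<in> CDer_deg L' (\<phi>\<^sub>e \<gamma>)"
      using \<open>T d \<in> _\<close> step unfolding CDer_deg_def by (intro B.F.span_add B.F.span_scale) auto
    finally show ?case using A.F.subspace_add[OF A.subspace_derivs kd e] by blast
  qed
  then show ?thesis by blast
qed

text \<open>Named independently of the inverse interpretation so that \<open>push\<close> and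
  \<open>push_cocycle\<close> can refer to the inverse of T.\<close>

definition "T' = isotopy.T L' (inv \<phi>) s_inv"

text \<open>The multiplier is conjugated by \<phi> and back, and a derivation is determined by its
  multiplier. Thus the inner correction of the inverse isotopy never has to be computed.\<close>

lemma T'_T: "d' \<in> A.derivs \<Longrightarrow> T' (T d') = d'"
  and T_T': "d \<in> B.derivs \<Longrightarrow> T (T' d) = d"
proof -
  interpret I: isotopy L' L "inv \<phi>" "inv_into QL \<phi>\<^sub>r" "inv \<phi>\<^sub>e" s_inv
    by (rule isotopy_inverse)
  have ii: "inv (inv \<phi>\<^sub>e) = \<phi>\<^sub>e" "inv (inv \<phi>) = \<phi>" using e_bij phi_bij by (simp_all add: inv_inv_eq)
  show "T' (T d) = d" if "d \<in> A.derivs" for d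
  proof -
    from that obtain M where M: "A.mult d M" unfolding A.derivs_def by blast
    show ?thesis
      unfolding T'_def using I.T_mult[OF T_mult[OF M]] M
      by (intro A.mult_determines) (simp_all add: I.conj_by_def conj_by_def ii)
  qed
  show "T (T' d) = d" if "d \<in> B.derivs" for d
  proof -
    from that obtain M where M: "B.mult d M" unfolding B.derivs_def by blast
    show ?thesis
      unfolding T'_def using T_mult[OF I.T_mult[OF M]] M
      by (intro B.mult_determines) (simp_all add: I.conj_by_def conj_by_def ii)
  qed
qed

lemma T'_CDer_deg:
  assumes "d \<in> A.derivs" "T d \<in> CDer_deg L' (\<phi>\<^sub>e \<gamma>)"
  shows "d \<in> CDer_deg L \<gamma>"
proof -
  interpret I: isotopy L' L "inv \<phi>" "inv_into QL \<phi>\<^sub>r" "inv \<phi>\<^sub>e" s_inv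
    by (rule isotopy_inverse)
  have "T' (T d) \<in> CDer_deg L (inv \<phi>\<^sub>e (\<phi>\<^sub>e \<gamma>))" unfolding T'_def by (rule I.T_CDer_deg[OF assms(2)])
  then show ?thesis by (simp add: T'_T[OF assms(1)])
qed

lemma T_inj: "inj_on T A.derivs"
  by (rule inj_on_inverseI[of _ T']) (rule T'_T)

end

section \<open>Graded duals and evaluation\<close>

text \<open>Linearity and injectivity of T are required only on W, since the transfer of derivations
  has them only on \<open>derivs\<close>. The map r relabels degrees.\<close>

lemma direct_sum_transport:
  fixes I :: "'i set" and W :: "'a::ab_group_add set" and T :: "'a \<Rightarrow> 'b::ab_group_add"
  assumes ds: "direct_sum s I A W" and s: "vector_space s" and s': "vector_space s'"
    and lin: "lin_on s s' W T" and inj: "inj_on T W" and r: "bij_betw r I I'"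
    and A': "\<And>i. i \<in> I \<Longrightarrow> A' (r i) = T ` A i"
  shows "direct_sum s' I' A' (T ` W)"
proof -
  interpret s': vector_space s' by fact
  interpret D: dsum s I A W using ds s by (simp add: dsum_def dsum_axioms_def)
  have add: "T (x + y) = T x + T y" if "x \<in> W" "y \<in> W" for x y
    using lin that unfolding lin_on_def by simp
  have scale: "T (s c x) = s' c (T x)" if "x \<in> W" for x c
    using lin that unfolding lin_on_def by simp
  have zero: "T 0 = 0" using scale[OF D.subspace_0[OF D.subspace_W], of 0] by simp
  have sub: "s'.subspace (T ` X)" if X: "D.subspace X" "X \<subseteq> W" for X
  proof (rule s'.subspaceI)
    show "0 \<in> T ` X" using zero D.subspace_0[OF X(1)] by (metis imageI)
    show "x + y \<in> T ` X" if "x \<in> T ` X" "y \<in> T ` X" for x y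
      using that X(2) D.subspace_add[OF X(1)] add by (smt (verit) imageE imageI subsetD)
    show "s' c x \<in> T ` X" if "x \<in> T ` X" for c x
      using that X(2) D.subspace_scale[OF X(1)] scale by (smt (verit) imageE imageI subsetD)
  qed
  have sum: "T (sum u F) = (\<Sum>i\<in>F. T (u i))" if "\<And>i. i \<in> F \<Longrightarrow> u i \<in> W" for u :: "'i \<Rightarrow> 'a" and F
    using that
  proof (induction F rule: infinite_finite_induct)
    case (insert x F)
    then show ?case using D.subspace_sum[OF D.subspace_W, of F u] by (simp add: add)
  qed (simp_all add: zero)
  have r_ex: "\<exists>i\<in>I. i' = r i" if "i' \<in> I'" for i' using that r by (auto simp: bij_betw_def)
  have r_in: "r i \<in> I'" if "i \<in> I" for i using that r by (auto simp: bij_betw_def)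
  have r_inj: "inj_on r I" using r by (simp add: bij_betw_def)
  show ?thesis
    unfolding direct_sum_def
  proof (intro conjI ballI)
    show "s'.subspace (T ` W)" by (rule sub[OF D.subspace_W order_refl])
    fix i' assume "i' \<in> I'"
    then obtain i where i: "i \<in> I" "i' = r i" using r_ex by blast
    show "s'.subspace (A' i')" using sub[OF D.subspace_A[OF i(1)] D.A_subset[OF i(1)]] i A' by simp
    show "A' i' \<subseteq> T ` W" using D.A_subset[OF i(1)] i A' by auto
  next
    fix x' assume "x' \<in> T ` W"
    then obtain x where x: "x \<in> W" "x' = T x" by blast
    let ?P = "\<lambda>u. (\<forall>i\<in>I'. u i \<in> A' i) \<and> (\<forall>i. i \<notin> I' \<longrightarrow> u i = 0) \<and>
                finite {i. u i \<noteq> 0} \<and> x' = sum u {i. u i \<noteq> 0}"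
    define u where "u = decomp I A x"
    define F where "F = {i. u i \<noteq> 0}"
    have F: "finite F" "F \<subseteq> I" using D.finite_decomp[OF x(1)] D.decomp_out[OF x(1)] by (auto simp: F_def u_def)
    have uA: "u i \<in> A i" if "i \<in> I" for i using D.decomp_in[OF x(1) that] by (simp add: u_def)
    define u' where "u' i' = (if i' \<in> I' then T (u (the_inv_into I r i')) else 0)" for i'
    have u'r: "u' (r i) = T (u i)" if "i \<in> I" for i
      using that r_in by (simp add: u'_def the_inv_into_f_f[OF r_inj])
    have supp: "{i. u' i \<noteq> 0} \<subseteq> r ` F"
    proof
      fix i' assume i': "i' \<in> {i. u' i \<noteq> 0}"
      then have "i' \<in> I'" by (auto simp: u'_def split: if_splits)
      then obtain i where i: "i \<in> I" "i' = r i" using r_ex by blast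
      then have "i \<in> F" using i' u'r[OF i(1)] zero by (auto simp: F_def)
      then show "i' \<in> r ` F" using i by blast
    qed
    have "x' = sum u' (r ` F)"
    proof -
      have "x' = T (sum u F)" using x D.sum_decomp[OF x(1)] by (simp add: u_def F_def)
      also have "\<dots> = (\<Sum>i\<in>F. T (u i))" by (rule sum) (use uA F D.A_subset in blast)
      also have "\<dots> = (\<Sum>i\<in>F. u' (r i))" by (rule sum.cong) (use u'r F in auto)
      also have "\<dots> = sum u' (r ` F)" using F r_inj by (subst sum.reindex) (auto intro: inj_on_subset)
      finally show ?thesis .
    qed
    moreover have "u' i' \<in> A' i'" if i': "i' \<in> I'" for i'
    proof -
      obtain i where i: "i \<in> I" "i' = r i" using r_ex[OF i'] by blast
      then show ?thesis using u'r[OF i(1)] uA[OF i(1)] A'[OF i(1)] by simp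
    qed
    moreover have "finite {i. u' i \<noteq> 0}" using finite_subset[OF supp] F(1) by simp
    moreover have "u' i' = 0" if "i' \<notin> I'" for i' using that by (simp add: u'_def)
    ultimately have ex: "?P u'" using sum_support_superset[OF _ supp] F(1) by simp
    have unique: "w = u'" if w: "?P w" for w
    proof -
      \<comment> \<open>A competing family w is pulled back through T, and uniqueness of the
        decomposition in W identifies it with u.\<close>
      define v where "v i = (if i \<in> I then the_inv_into W T (w (r i)) else 0)" for i
      have wW: "w (r i) \<in> T ` A i" "w (r i) \<in> T ` W" if "i \<in> I" for i
      proof -
        show "w (r i) \<in> T ` A i" using w r_in[OF that] A'[OF that] by auto
        then show "w (r i) \<in> T ` W" using D.A_subset[OF that] by blast
      qed
      have Tv: "T (v i) = w (r i)" if "i \<in> I" for i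
        using f_the_inv_into_f[OF inj wW(2)[OF that]] that by (simp add: v_def)
      have vA: "v i \<in> A i" if "i \<in> I" for i
      proof -
        obtain y where y: "y \<in> A i" "w (r i) = T y" using wW(1)[OF \<open>i \<in> I\<close>] by blast
        then have "v i = y" using D.A_subset[OF that] that by (simp add: v_def the_inv_into_f_f[OF inj] subset_eq)
        then show ?thesis using y by simp
      qed
      define G where "G = {i \<in> I. w (r i) \<noteq> 0}"
      have G: "{i. w i \<noteq> 0} = r ` G" using w r_ex by (auto simp: G_def)
      have finG: "finite G" using w G r_inj by (metis (no_types, lifting) G_def finite_imageD inj_on_subset mem_Collect_eq subsetI)
      have suppv: "{i. v i \<noteq> 0} \<subseteq> G"
      proof
        fix i assume i: "i \<in> {i. v i \<noteq> 0}"
        then have I: "i \<in> I" by (auto simp: v_def split: if_splits)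
        have "w (r i) \<noteq> 0"
        proof
          assume "w (r i) = 0"
          then have "T (v i) = T 0" using Tv[OF I] zero by simp
          then have "v i = 0"
            using inj vA[OF I] D.A_subset[OF I] D.subspace_0[OF D.subspace_W] by (auto simp: inj_on_def)
          then show False using i by simp
        qed
        then show "i \<in> G" using I by (simp add: G_def)
      qed
      have vW: "v i \<in> W" if "i \<in> G" for i using that vA D.A_subset by (auto simp: G_def)
      have "T x = sum w (r ` G)" using w x G by simp
      also have "\<dots> = (\<Sum>i\<in>G. w (r i))" using r_inj by (subst sum.reindex) (auto simp: G_def intro: inj_on_subset)
      also have "\<dots> = (\<Sum>i\<in>G. T (v i))" by (rule sum.cong) (use Tv in \<open>auto simp: G_def\<close>)
      also have "\<dots> = T (sum v G)" by (rule sum[symmetric]) (rule vW)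
      finally have "x = sum v G"
        using inj x(1) D.subspace_sum[OF D.subspace_W, of G v] vW by (auto simp: inj_on_def)
      then have "u = v"
        unfolding u_def by (intro D.decomp_unique[OF x(1) vA _ finG suppv]) (auto simp: v_def)
      show "w = u'"
      proof
        fix i'
        show "w i' = u' i'"
        proof (cases "i' \<in> I'")
          case True
          then obtain i where i: "i \<in> I" "i' = r i" using r_ex by blast
          then show ?thesis using u'r[OF i(1)] Tv[OF i(1)] \<open>u = v\<close> by simp
        qed (use w in \<open>simp add: u'_def\<close>)
      qed
    qed
    show "\<exists>!u. ?P u" using ex unique by (rule ex1I)
  qed
qed

interpretation fun_space: vector_space "pointwise ((*) :: 'f::field \<Rightarrow> 'f \<Rightarrow> 'f) :: 'f \<Rightarrow> ('a \<Rightarrow> 'f) \<Rightarrow> 'a \<Rightarrow> 'f"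
  by (rule vector_space_pointwise[OF vector_space_mult])

context centreless_lie_torus
begin

lemma graded_subalgebra_dsum:
  "graded_subalgebra L b D \<Longrightarrow> dsum (pointwise sc) (centroid_support L) (hcomp L D) D"
  by (simp add: graded_subalgebra_def dsum_def dsum_axioms_def F.vector_space_axioms)

lemma graded_subalgebra_commutator:
  "graded_subalgebra L b D \<Longrightarrow> d \<in> D \<Longrightarrow> e \<in> D \<Longrightarrow> commutator d e \<in> D"
  unfolding graded_subalgebra_def lie_subalgebra_def by simp

lemma graded_subalgebra_subspace: "graded_subalgebra L b D \<Longrightarrow> F.subspace D"
  unfolding graded_subalgebra_def lie_subalgebra_def by simp

lemma graded_subalgebra_skew: "graded_subalgebra L b D \<Longrightarrow> d \<in> D \<Longrightarrow> b (d x) y = - b x (d y)"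
  unfolding graded_subalgebra_def SCDer_def by blast

lemma dual_spaceI:
  assumes "\<And>d e. d \<in> D \<Longrightarrow> e \<in> D \<Longrightarrow> f (d + e) = f d + f e"
    and "\<And>k d. d \<in> D \<Longrightarrow> f (pointwise sc k d) = k * f d" and "\<And>d. d \<notin> D \<Longrightarrow> f d = 0"
  shows "f \<in> dual_space L D"
  using assms by (simp add: dual_space_def lin_on_def)

lemma dual_space_add: "f \<in> dual_space L D \<Longrightarrow> d \<in> D \<Longrightarrow> e \<in> D \<Longrightarrow> f (d + e) = f d + f e"
  and dual_space_scale: "f \<in> dual_space L D \<Longrightarrow> d \<in> D \<Longrightarrow> f (pointwise sc k d) = k * f d"
  and dual_space_out: "f \<in> dual_space L D \<Longrightarrow> d \<notin> D \<Longrightarrow> f d = 0"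
  by (simp_all add: dual_space_def lin_on_def)

lemma subspace_dual_space: "fun_space.subspace (dual_space L D)"
  by (rule fun_space.subspaceI) (auto simp: dual_space_def lin_on_def pointwise_apply algebra_simps)

lemma subspace_C_deg: "fun_space.subspace (C_deg L D \<gamma>)"
  by (rule fun_space.subspaceI)
     (auto simp: C_deg_def pointwise_apply fun_space.subspace_0[OF subspace_dual_space]
        fun_space.subspace_add[OF subspace_dual_space] fun_space.subspace_scale[OF subspace_dual_space])

lemma C_deg_dual: "f \<in> C_deg L D \<gamma> \<Longrightarrow> f \<in> dual_space L D"
  and C_deg_orthogonal: "f \<in> C_deg L D \<gamma> \<Longrightarrow> \<delta> \<in> centroid_support L \<Longrightarrow> \<delta> \<noteq> - \<gamma> \<Longrightarrow> d \<in> hcomp L D \<delta> \<Longrightarrow> f d = 0"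
  by (simp_all add: C_deg_def)

lemma graded_dual_dual: "graded_dual L D \<subseteq> dual_space L D"
  unfolding graded_dual_def
  by (rule fun_space.span_minimal[OF _ subspace_dual_space]) (use C_deg_dual in blast)

lemma subspace_graded_dual: "fun_space.subspace (graded_dual L D)"
  unfolding graded_dual_def by (rule fun_space.subspace_span)

definition "ev_spec D \<kappa> f \<longleftrightarrow> f \<in> C_deg L D 0 \<and>
   (\<forall>\<theta>. group_hom_on UNIV \<theta> \<and> degree_derivation L \<theta> \<in> hcomp L D 0 \<longrightarrow> f (degree_derivation L \<theta>) = \<theta> \<kappa>)"

text \<open>A degree derivation must determine the value \<theta> \<kappa>. If some component of
  degree \<kappa> is nonzero, the value is visible as an eigenvalue; any other \<kappa> is reached
  from such degrees by differences.\<close>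

lemma ev_exists:
  assumes gs: "graded_subalgebra L b D"
  shows "\<exists>f. ev_spec D \<kappa> f"
proof -
  interpret DD: dsum "pointwise sc" "centroid_support L" "hcomp L D" D by (rule graded_subalgebra_dsum[OF gs])
  have "\<kappa> \<in> module.span zmul {\<kappa>. degree_space L \<kappa> \<noteq> {0}}"
    using lie_torus unfolding lie_torus_def by simp
  then show ?thesis
  proof (rule zmul_span_induct)
    have "ev_spec D 0 0"
      unfolding ev_spec_def
      using fun_space.subspace_0[OF subspace_C_deg] group_hom_on_zero[OF _ zmod.subspace_UNIV] by auto
    then show "\<exists>f. ev_spec D 0 f" by blast
  next
    fix \<kappa> assume "\<kappa> \<in> {\<kappa>. degree_space L \<kappa> \<noteq> {0}}"
    then have "degree_space L \<kappa> \<noteq> {0}" by simp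
    then obtain \<alpha> x where x: "\<alpha> \<in> QL" "x \<in> H \<alpha> \<kappa>" "x \<noteq> 0" by (rule degree_space_nonzero)
    interpret P: vector_space_pair sc "(*) :: 'f \<Rightarrow> 'f \<Rightarrow> 'f"
      by (simp add: vector_space_pair_def V.vector_space_axioms vector_space_mult)
    have "V.independent {x}" using x(3) by simp
    from P.linear_independent_extend[OF this, of "\<lambda>_. 1"]
    obtain p where p: "Vector_Spaces.linear sc (*) p" "p x = 1" by auto
    interpret p: Vector_Spaces.linear sc "(*)" p by (rule p(1))
    \<comment> \<open>This reads off the coefficient of x in d x. The projection discards what
      derivations of nonzero degree contribute, which puts f in degree 0.\<close>
    define f where "f d = (if d \<in> D then p (cmp \<alpha> \<kappa> (d x)) else 0)" for d
    have "f \<in> dual_space L D"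
      by (rule dual_spaceI)
         (auto simp: f_def F.subspace_add[OF DD.subspace_W] F.subspace_scale[OF DD.subspace_W]
            pointwise_apply cmp_add cmp_scale p.add p.scale)
    moreover have "f d = 0" if "\<delta> \<noteq> - 0" "d \<in> hcomp L D \<delta>" for d \<delta>
    proof -
      obtain M where M: "mult d M" "\<And>\<mu>. M \<mu> \<in> Cent_deg L \<delta>"
        using CDer_deg_mult \<open>d \<in> hcomp L D \<delta>\<close> unfolding hcomp_def by blast
      have "d x \<in> H \<alpha> (\<delta> + \<kappa>)"
        using Cent_deg_homogeneous[OF M(2) x(1,2)] mult_act[OF M(1) x(1,2)] by simp
      then have "cmp \<alpha> \<kappa> (d x) = 0" using cmp_homogeneous[OF x(1)] that(1) by simp
      then show ?thesis by (simp add: f_def p.zero)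
    qed
    moreover have "f (degree_derivation L \<theta>) = \<theta> \<kappa>"
      if "group_hom_on UNIV \<theta>" "degree_derivation L \<theta> \<in> hcomp L D 0" for \<theta>
      using that degree_derivation_act[OF that(1) x(1,2)]
      by (simp add: f_def hcomp_def cmp_scale cmp_homogeneous[OF x(1,2)] p.scale p(2))
    ultimately have "ev_spec D \<kappa> f" by (auto simp: ev_spec_def C_deg_def)
    then show "\<exists>f. ev_spec D \<kappa> f" by blast
  next
    fix \<kappa> \<mu> assume "\<exists>f. ev_spec D \<kappa> f" "\<exists>f. ev_spec D \<mu> f"
    then obtain f g where "ev_spec D \<kappa> f" "ev_spec D \<mu> g" by blast
    then have "ev_spec D (\<kappa> - \<mu>) (f - g)"
      unfolding ev_spec_def
      by (simp add: fun_space.subspace_diff[OF subspace_C_deg] group_hom_on_diff[OF _ zmod.subspace_UNIV])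
    then show "\<exists>f. ev_spec D (\<kappa> - \<mu>) f" by blast
  qed
qed

text \<open>Elements of \<open>C_deg L D 0\<close> vanish on the other components of D, and every
  derivation of degree 0 is a degree derivation.\<close>

lemma C_deg_0_eq_0:
  assumes gs: "graded_subalgebra L b D" and f: "f \<in> C_deg L D 0"
    and 0: "\<And>\<theta>. group_hom_on UNIV \<theta> \<Longrightarrow> degree_derivation L \<theta> \<in> hcomp L D 0 \<Longrightarrow> f (degree_derivation L \<theta>) = 0"
  shows "f = 0"
proof
  fix d
  interpret DD: dsum "pointwise sc" "centroid_support L" "hcomp L D" D by (rule graded_subalgebra_dsum[OF gs])
  note dual = C_deg_dual[OF f]
  show "f d = 0 d"
  proof (cases "d \<in> D")
    case True
    then have "f d = 0"
    proof (induction d rule: DD.dsum_induct)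
      case zero
      show ?case using dual_space_scale[OF dual F.subspace_0[OF DD.subspace_W], of 0]
        by (simp only: F.scale_zero_left mult_zero_left)
    next
      case (homogeneous \<delta> d)
      show ?case
      proof (cases "\<delta> = 0")
        case True
        then have "d \<in> CDer_deg L 0" using homogeneous unfolding hcomp_def by simp
        then obtain \<theta> where "group_hom_on UNIV \<theta>" "d = degree_derivation L \<theta>" by (rule CDer_deg_0)
        then show ?thesis using 0 homogeneous True by simp
      qed (use C_deg_orthogonal[OF f] homogeneous in auto)
    next
      case (add d e)
      show ?case by (simp only: dual_space_add[OF dual add(1,2)] add add_0_left)
    qed
    then show ?thesis by simp
  qed (simp add: dual_space_out[OF dual])
qed

lemma ev_spec_unique:
  assumes gs: "graded_subalgebra L b D" and f: "ev_spec D \<kappa> f" and g: "ev_spec D \<kappa> g"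
  shows "f = g"
proof -
  have "f - g = 0"
    by (rule C_deg_0_eq_0[OF gs])
       (use f g fun_space.subspace_diff[OF subspace_C_deg] in \<open>auto simp: ev_spec_def\<close>)
  then show ?thesis by simp
qed

lemma ev_spec_ev: "graded_subalgebra L b D \<Longrightarrow> ev_spec D \<kappa> (ev L D \<kappa>)"
  unfolding ev_def ev_spec_def[symmetric]
  using theI'[of "ev_spec D \<kappa>"] ev_exists ev_spec_unique by metis

lemma ev_eqI: "graded_subalgebra L b D \<Longrightarrow> ev_spec D \<kappa> f \<Longrightarrow> ev L D \<kappa> = f"
  using ev_spec_unique ev_spec_ev by metis

end

section \<open>Transport of cocycle pairs\<close>

locale isotopy_form = isotopy L L' \<phi> \<phi>\<^sub>r \<phi>\<^sub>e s
  for L :: "('f::field_char_0, 'v::ab_group_add, 'g::ab_group_add, 'l::ab_group_add) graded_lie"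
    and L' :: "('f, 'w::ab_group_add, 'h::ab_group_add, 'm::ab_group_add) graded_lie"
    and \<phi> \<phi>\<^sub>r \<phi>\<^sub>e s +
  fixes b :: "'l \<Rightarrow> 'l \<Rightarrow> 'f" and b' :: "'m \<Rightarrow> 'm \<Rightarrow> 'f" and a :: 'f
  assumes form: "invariant_form L b" and form': "invariant_form L' b'"
    and a_nonzero: "a \<noteq> 0" and form_phi: "\<And>x y. b' (\<phi> x) (\<phi> y) = a * b x y"
begin

lemma isotopy_form_inverse:
  "isotopy_form L' L (inv \<phi>) (inv_into QL \<phi>\<^sub>r) (inv \<phi>\<^sub>e) s_inv b' b (1 / a)"
proof (intro isotopy_form.intro isotopy_form_axioms.intro isotopy_inverse form form')
  show "1 / a \<noteq> 0" using a_nonzero by simp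
  show "b (inv \<phi> x) (inv \<phi> y) = 1 / a * b' x y" for x y
    using form_phi[of "inv \<phi> x" "inv \<phi> y"] a_nonzero by simp
qed

section \<open>Transport of graded subalgebras\<close>

lemma graded_subalgebra_derivs:
  assumes "graded_subalgebra L b D"
  shows "D \<subseteq> A.derivs"
proof
  interpret DD: dsum "pointwise A.sc" "centroid_support L" "hcomp L D" D
    by (rule A.graded_subalgebra_dsum[OF assms])
  fix d assume "d \<in> D"
  then show "d \<in> A.derivs"
  proof (induction d rule: DD.dsum_induct)
    case zero
    show ?case by (rule A.F.subspace_0[OF A.subspace_derivs])
  next
    case (homogeneous \<gamma> d)
    then show ?case using A.CDer_deg_derivs unfolding hcomp_def by blast
  next
    case (add d e)
    show ?case by (rule A.F.subspace_add[OF A.subspace_derivs add(3,4)])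
  qed
qed

lemma T_hcomp:
  assumes "D \<subseteq> A.derivs"
  shows "hcomp L' (T ` D) (\<phi>\<^sub>e \<gamma>) = T ` hcomp L D \<gamma>"
  using assms T_CDer_deg T'_CDer_deg unfolding hcomp_def by blast

text \<open>Inner derivations are skew by invariance of the form, so the correction changes nothing,
  and \<phi> only rescales the form by the nonzero a.\<close>

lemma T_skew:
  assumes "d \<in> A.derivs"
  shows "(\<forall>x y. b' (T d x) y = - b' x (T d y)) \<longleftrightarrow> (\<forall>x y. b (d x) y = - b x (d y))"
proof -
  have "b (A.br p x) y = - b x (A.br p y)" for p x y
    using A.br_anti[of p x] A.form_rules(10)[OF form, of x p y] by (simp add: A.form_rules(11)[OF form])
  then have "b' (T d (\<phi> x)) (\<phi> y) = - b' (\<phi> x) (T d (\<phi> y)) \<longleftrightarrow> b (d x) y = - b x (d y)" for x y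
    using a_nonzero by (simp add: T_phi form_phi A.form_rules(3,4)[OF form] flip: mult_minus_right)
  then have "(\<forall>x y. b' (T d (\<phi> x)) (\<phi> y) = - b' (\<phi> x) (T d (\<phi> y))) \<longleftrightarrow> (\<forall>x y. b (d x) y = - b x (d y))"
    by simp
  then show ?thesis by (metis phi_inv(2))
qed

lemma graded_subalgebra_T:
  assumes gs: "graded_subalgebra L b D"
  shows "graded_subalgebra L' b' (T ` D)"
proof -
  interpret DD: dsum "pointwise A.sc" "centroid_support L" "hcomp L D" D
    by (rule A.graded_subalgebra_dsum[OF gs])
  note D = graded_subalgebra_derivs[OF gs] and sub = A.graded_subalgebra_subspace[OF gs]
  have CDer: "T d \<in> CDer L'" if "d \<in> D" for d
    using that
  proof (induction d rule: DD.dsum_induct)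
    case zero
    show ?case unfolding T_zero CDer_def by (rule B.F.span_zero)
  next
    case (homogeneous \<gamma> d)
    then show ?case using T_CDer_deg B.CDer_deg_subset_CDer unfolding hcomp_def by blast
  next
    case (add d e)
    have eq: "T (d + e) = T d + T e" using add(1,2) D T_add by blast
    show ?case unfolding eq using add(3,4) unfolding CDer_def by (rule B.F.span_add)
  qed
  have "T d \<in> SCDer L' b'" if "d \<in> D" for d
  proof -
    have "d \<in> A.derivs" using D that by blast
    moreover have "\<forall>x y. b (d x) y = - b x (d y)" using A.graded_subalgebra_skew[OF gs that] by blast
    ultimately show ?thesis using CDer[OF that] T_skew[of d] by (simp add: SCDer_def)
  qed
  then have 1: "T ` D \<subseteq> SCDer L' b'" by blast
  have 2: "direct_sum (pointwise B.sc) (centroid_support L') (hcomp L' (T ` D)) (T ` D)"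
  proof (rule direct_sum_transport[OF DD.dsum A.F.vector_space_axioms B.F.vector_space_axioms])
    show "lin_on (pointwise A.sc) (pointwise B.sc) D T"
      using D T_add T_scale unfolding lin_on_def by blast
    show "inj_on T D" using T_inj D by (rule inj_on_subset)
    show "bij_betw \<phi>\<^sub>e (centroid_support L) (centroid_support L')"
      using support_image bij_is_inj[OF e_bij] by (auto simp: bij_betw_def intro: inj_on_subset)
    show "hcomp L' (T ` D) (\<phi>\<^sub>e \<gamma>) = T ` hcomp L D \<gamma>" for \<gamma> by (rule T_hcomp[OF D])
  qed
  have "commutator x y \<in> T ` D" if "x \<in> T ` D" "y \<in> T ` D" for x y
  proof -
    from that obtain d e where d: "d \<in> D" "x = T d" and e: "e \<in> D" "y = T e" by blast
    have "commutator x y = T (commutator d e)" using D d e T_commutator by (metis subsetD)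
    then show ?thesis using A.graded_subalgebra_commutator[OF gs d(1) e(1)] by blast
  qed
  then show ?thesis
    using 1 2 unfolding graded_subalgebra_def lie_subalgebra_def direct_sum_def by simp
qed

text \<open>The factor a makes the pairing of D with its dual scale as the form on L does under
  \<phi>, so that the total form scales by a single constant.\<close>

definition "push D f d' = (if d' \<in> T ` D then a * f (T' d') else 0)"

lemma push_T: "D \<subseteq> A.derivs \<Longrightarrow> d \<in> D \<Longrightarrow> push D f (T d) = a * f d"
  using T'_T by (auto simp: push_def)

lemma push_out: "d' \<notin> T ` D \<Longrightarrow> push D f d' = 0"
  by (simp add: push_def)

lemma push_add: "push D (f + g) = push D f + push D g"
  and push_scale: "push D (pointwise (*) k f) = pointwise (*) k (push D f)"
  by (auto simp: push_def fun_eq_iff pointwise_apply algebra_simps)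

lemma push_zero: "push D 0 = 0" by (auto simp: push_def fun_eq_iff)

lemma push_inject:
  assumes "D \<subseteq> A.derivs" "\<And>d. d \<notin> D \<Longrightarrow> f d = 0" "\<And>d. d \<notin> D \<Longrightarrow> g d = 0" "push D f = push D g"
  shows "f = g"
proof
  show "f d = g d" for d
    using push_T[OF assms(1), of d f] push_T[OF assms(1), of d g] assms a_nonzero by (cases "d \<in> D") auto
qed

lemma push_dual_space:
  assumes gs: "graded_subalgebra L b D" and f: "f \<in> dual_space L D"
  shows "push D f \<in> dual_space L' (T ` D)"
proof (rule B.dual_spaceI)
  note D = graded_subalgebra_derivs[OF gs] and sub = A.graded_subalgebra_subspace[OF gs]
  show "push D f d' = 0" if "d' \<notin> T ` D" for d' using that by (rule push_out)
  show "push D f (x + y) = push D f x + push D f y" if "x \<in> T ` D" "y \<in> T ` D" for x y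
  proof -
    from that obtain d e where d: "d \<in> D" "x = T d" and e: "e \<in> D" "y = T e" by blast
    have "x + y = T (d + e)" using D d e T_add by (metis subsetD)
    then show ?thesis
      using push_T[OF D] d e A.F.subspace_add[OF sub d(1) e(1)] A.dual_space_add[OF f d(1) e(1)]
      by (simp only: distrib_left)
  qed
  show "push D f (pointwise B.sc k x) = k * push D f x" if "x \<in> T ` D" for x k
  proof -
    from that obtain d where d: "d \<in> D" "x = T d" by blast
    have "pointwise B.sc k x = T (pointwise A.sc k d)" using D d T_scale by (metis subsetD)
    then show ?thesis
      using push_T[OF D] d A.F.subspace_scale[OF sub d(1)] A.dual_space_scale[OF f d(1)]
      by (simp only: mult.left_commute)
  qed
qed

lemma push_C_deg:
  assumes gs: "graded_subalgebra L b D" and f: "f \<in> C_deg L D \<gamma>"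
  shows "push D f \<in> C_deg L' (T ` D) (\<phi>\<^sub>e \<gamma>)"
proof -
  note D = graded_subalgebra_derivs[OF gs]
  have "push D f d' = 0" if \<delta>': "\<delta>' \<in> centroid_support L'" "\<delta>' \<noteq> - \<phi>\<^sub>e \<gamma>" and d': "d' \<in> hcomp L' (T ` D) \<delta>'" for \<delta>' d'
  proof -
    obtain \<delta> where \<delta>: "\<delta> \<in> centroid_support L" "\<delta>' = \<phi>\<^sub>e \<delta>" using \<delta>'(1) support_image by blast
    then obtain d where d: "d \<in> hcomp L D \<delta>" "d' = T d" using d' T_hcomp[OF D] by blast
    have "\<delta> \<noteq> - \<gamma>" using \<delta>'(2) \<delta>(2) e_minus by auto
    then have "f d = 0" using A.C_deg_orthogonal[OF f \<delta>(1) _ d(1)] by blast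
    moreover have "d \<in> D" using d(1) unfolding hcomp_def by simp
    ultimately show ?thesis using push_T[OF D] d(2) by simp
  qed
  then show ?thesis
    using push_dual_space[OF gs A.C_deg_dual[OF f]] unfolding C_deg_def by blast
qed

lemma push_graded_dual:
  assumes gs: "graded_subalgebra L b D" and f: "f \<in> graded_dual L D"
  shows "push D f \<in> graded_dual L' (T ` D)"
  using f unfolding graded_dual_def[of L]
proof (induction rule: fun_space.span_induct_alt)
  case base
  show ?case unfolding push_zero by (rule fun_space.subspace_0[OF B.subspace_graded_dual])
next
  case (step k f g)
  then obtain \<gamma> where \<gamma>: "\<gamma> \<in> centroid_support L" "f \<in> C_deg L D \<gamma>" by blast
  have "\<phi>\<^sub>e \<gamma> \<in> centroid_support L'" using \<gamma>(1) support_image by blast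
  then have "push D f \<in> graded_dual L' (T ` D)"
    using push_C_deg[OF gs \<gamma>(2)] unfolding graded_dual_def by (intro fun_space.span_base) blast
  then show ?case
    unfolding push_add push_scale
    by (intro fun_space.subspace_add fun_space.subspace_scale B.subspace_graded_dual step)
qed

text \<open>The factor 1/a undoes the scaling built into \<open>push\<close>, since evaluation does
  not involve the form.\<close>

lemma ev_T:
  assumes gs: "graded_subalgebra L b D"
  shows "ev L' (T ` D) (\<phi>\<^sub>e \<kappa>) = pointwise (*) (1 / a) (push D (ev L D \<kappa>))"
proof (rule B.ev_eqI[OF graded_subalgebra_T[OF gs]])
  note D = graded_subalgebra_derivs[OF gs]
  let ?f = "ev L D \<kappa>"
  have f: "?f \<in> C_deg L D 0"
    "\<And>\<theta>. group_hom_on UNIV \<theta> \<Longrightarrow> degree_derivation L \<theta> \<in> hcomp L D 0 \<Longrightarrow> ?f (degree_derivation L \<theta>) = \<theta> \<kappa>"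
    using A.ev_spec_ev[OF gs, of \<kappa>] unfolding A.ev_spec_def by blast+
  show "B.ev_spec (T ` D) (\<phi>\<^sub>e \<kappa>) (pointwise (*) (1 / a) (push D ?f))"
    unfolding B.ev_spec_def
  proof (intro conjI allI impI)
    show "pointwise (*) (1 / a) (push D ?f) \<in> C_deg L' (T ` D) 0"
      using fun_space.subspace_scale[OF B.subspace_C_deg push_C_deg[OF gs f(1)]] by (simp add: e_zero)
    fix \<theta>' assume "group_hom_on UNIV \<theta>' \<and> degree_derivation L' \<theta>' \<in> hcomp L' (T ` D) 0"
    then have \<theta>': "group_hom_on UNIV \<theta>'" "degree_derivation L' \<theta>' \<in> hcomp L' (T ` D) (\<phi>\<^sub>e 0)"
      by (simp_all add: e_zero)
    \<comment> \<open>T sends the degree derivation of \<theta> to that of \<theta>'. Injectivity of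
      T identifies it with the preimage d, so it lies in D.\<close>
    define \<theta> where "\<theta> \<mu> = \<theta>' (\<phi>\<^sub>e \<mu>)" for \<mu>
    have \<theta>: "group_hom_on UNIV \<theta>" using \<theta>'(1) by (simp add: group_hom_on_def \<theta>_def e_add)
    have T\<theta>: "T (degree_derivation L \<theta>) = degree_derivation L' \<theta>'"
      using T_degree_derivation(2)[OF \<theta>] by (simp add: \<theta>_def)
    obtain d where d: "d \<in> hcomp L D 0" "degree_derivation L' \<theta>' = T d"
      using \<theta>'(2) unfolding T_hcomp[OF D] by blast
    have dD: "d \<in> D" using d(1) unfolding hcomp_def by simp
    have "degree_derivation L \<theta> \<in> A.derivs" by (rule A.derivsI[OF A.mult_degree_derivation[OF \<theta>]])
    then have "degree_derivation L \<theta> = d" using T\<theta> d(2) dD D T_inj by (auto simp: inj_on_def)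
    then have "push D ?f (degree_derivation L' \<theta>') = a * \<theta> \<kappa>"
      using f(2)[OF \<theta>] push_T[OF D dD] d by simp
    then show "pointwise (*) (1 / a) (push D ?f) (degree_derivation L' \<theta>') = \<theta>' (\<phi>\<^sub>e \<kappa>)"
      using a_nonzero by (simp add: pointwise_apply \<theta>_def)
  qed
qed

lemma inj_ev_T:
  assumes gs: "graded_subalgebra L b D" and inj: "inj (ev L D)"
  shows "inj (ev L' (T ` D))"
proof (rule injI)
  note D = graded_subalgebra_derivs[OF gs]
  fix \<kappa>' \<mu>' assume eq: "ev L' (T ` D) \<kappa>' = ev L' (T ` D) \<mu>'"
  let ?k = "inv \<phi>\<^sub>e \<kappa>'" and ?m = "inv \<phi>\<^sub>e \<mu>'"
  have "pointwise (*) (1 / a) (push D (ev L D ?k)) = pointwise (*) (1 / a) (push D (ev L D ?m))"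
    using ev_T[OF gs, of ?k] ev_T[OF gs, of ?m] eq by simp
  then have "push D (ev L D ?k) = push D (ev L D ?m)"
    using fun_space.scale_left_imp_eq[of "1 / a"] a_nonzero by simp
  moreover have "ev L D \<kappa> d = 0" if "d \<notin> D" for \<kappa> d
    using A.ev_spec_ev[OF gs, of \<kappa>] A.dual_space_out[OF A.C_deg_dual] that unfolding A.ev_spec_def by blast
  ultimately have "ev L D ?k = ev L D ?m" using push_inject[OF D] by blast
  then have "?k = ?m" using inj by (simp add: inj_eq)
  then show "\<kappa>' = \<mu>'" by (metis e_inv(2))
qed

section \<open>Transport of cocycles\<close>

definition "push_cocycle D \<tau> d' e' = (if d' \<in> T ` D \<and> e' \<in> T ` D then push D (\<tau> (T' d') (T' e')) else 0)"

lemma push_cocycle_T: "D \<subseteq> A.derivs \<Longrightarrow> d \<in> D \<Longrightarrow> e \<in> D \<Longrightarrow> push_cocycle D \<tau> (T d) (T e) = push D (\<tau> d e)"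
  by (simp add: push_cocycle_def T'_T subsetD)

lemma coadj_push:
  assumes gs: "graded_subalgebra L b D" and d: "d \<in> D"
  shows "coadj (T ` D) (T d) (push D f) = push D (coadj D d f)"
proof
  note D = graded_subalgebra_derivs[OF gs]
  fix e'
  show "coadj (T ` D) (T d) (push D f) e' = push D (coadj D d f) e'"
  proof (cases "e' \<in> T ` D")
    case True
    then obtain e where e: "e \<in> D" "e' = T e" by blast
    have "commutator (T d) (T e) = T (commutator d e)" using T_commutator D d e by (metis subsetD)
    then show ?thesis
      using push_T[OF D] e A.graded_subalgebra_commutator[OF gs d e(1)] True
      by (simp add: coadj_def)
  qed (simp add: coadj_def push_out)
qed

lemma invariant_cocycle_push:
  assumes gs: "graded_subalgebra L b D" and \<tau>: "invariant_cocycle L D \<tau>"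
  shows "invariant_cocycle L' (T ` D) (push_cocycle D \<tau>)"
proof -
  note D = graded_subalgebra_derivs[OF gs] and sub = A.graded_subalgebra_subspace[OF gs]
  note tauT = push_cocycle_T[OF D]
  have Tadd: "T d + T e = T (d + e)" if "d \<in> D" "e \<in> D" for d e using that D T_add by (metis subsetD)
  have Tscale: "pointwise B.sc k (T d) = T (pointwise A.sc k d)" if "d \<in> D" for d k
    using that D T_scale by (metis subsetD)
  have Tcomm: "commutator (T d) (T e) = T (commutator d e)" if "d \<in> D" "e \<in> D" for d e
    using that D T_commutator by (metis subsetD)
  note closed = A.F.subspace_add[OF sub] A.F.subspace_scale[OF sub] A.graded_subalgebra_commutator[OF gs]
  show ?thesis
    \<comment> \<open>Quantifiers over the image of D under T become quantifiers over D, so most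
      axioms are checked directly at arguments T d.\<close>
    unfolding invariant_cocycle_def ball_simps(9)
  proof (intro conjI ballI allI impI)
    fix d e assume "d \<notin> T ` D \<or> e \<notin> T ` D"
    then show "push_cocycle D \<tau> d e = 0" by (auto simp: push_cocycle_def)
  next
    fix d e assume "d \<in> D" "e \<in> D"
    then show "push_cocycle D \<tau> (T d) (T e) \<in> graded_dual L' (T ` D)"
      using \<tau> push_graded_dual[OF gs] tauT unfolding invariant_cocycle_def by simp
  next
    fix d assume d: "d \<in> D"
    then have lin: "lin_on (pointwise A.sc) (pointwise (*)) D (\<tau> d)"
      using \<tau> unfolding invariant_cocycle_def by blast
    show "lin_on (pointwise B.sc) (pointwise (*)) (T ` D) (push_cocycle D \<tau> (T d))"
      unfolding lin_on_def ball_simps(9)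
    proof (intro conjI ballI allI)
      fix x y k assume x: "x \<in> D"
      show "push_cocycle D \<tau> (T d) (pointwise B.sc k (T x)) = pointwise (*) k (push_cocycle D \<tau> (T d) (T x))"
        using lin x unfolding lin_on_def by (simp only: Tscale tauT d closed push_scale[symmetric])
      assume y: "y \<in> D"
      show "push_cocycle D \<tau> (T d) (T x + T y) = push_cocycle D \<tau> (T d) (T x) + push_cocycle D \<tau> (T d) (T y)"
        using lin x y unfolding lin_on_def by (simp only: Tadd tauT d closed push_add[symmetric])
    qed
  next
    fix e assume e: "e \<in> D"
    then have lin: "lin_on (pointwise A.sc) (pointwise (*)) D (\<lambda>d. \<tau> d e)"
      using \<tau> unfolding invariant_cocycle_def by blast
    show "lin_on (pointwise B.sc) (pointwise (*)) (T ` D) (\<lambda>d. push_cocycle D \<tau> d (T e))"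
      unfolding lin_on_def ball_simps(9)
    proof (intro conjI ballI allI)
      fix x y k assume x: "x \<in> D"
      show "push_cocycle D \<tau> (pointwise B.sc k (T x)) (T e) = pointwise (*) k (push_cocycle D \<tau> (T x) (T e))"
        using lin x unfolding lin_on_def by (simp only: Tscale tauT e closed push_scale[symmetric])
      assume y: "y \<in> D"
      show "push_cocycle D \<tau> (T x + T y) (T e) = push_cocycle D \<tau> (T x) (T e) + push_cocycle D \<tau> (T y) (T e)"
        using lin x y unfolding lin_on_def by (simp only: Tadd tauT e closed push_add[symmetric])
    qed
  next
    fix d assume "d \<in> D"
    then show "push_cocycle D \<tau> (T d) (T d) = 0"
      using \<tau> tauT unfolding invariant_cocycle_def by (simp add: push_zero)
  next
    fix d1 d2 d3 assume d: "d1 \<in> D" "d2 \<in> D" "d3 \<in> D"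
    then have "coadj D d1 (\<tau> d2 d3) + coadj D d2 (\<tau> d3 d1) + coadj D d3 (\<tau> d1 d2) =
        \<tau> (commutator d1 d2) d3 + \<tau> (commutator d2 d3) d1 + \<tau> (commutator d3 d1) d2"
      using \<tau> unfolding invariant_cocycle_def by blast
    then show "coadj (T ` D) (T d1) (push_cocycle D \<tau> (T d2) (T d3)) + coadj (T ` D) (T d2) (push_cocycle D \<tau> (T d3) (T d1)) +
        coadj (T ` D) (T d3) (push_cocycle D \<tau> (T d1) (T d2)) =
        push_cocycle D \<tau> (commutator (T d1) (T d2)) (T d3) + push_cocycle D \<tau> (commutator (T d2) (T d3)) (T d1) +
        push_cocycle D \<tau> (commutator (T d3) (T d1)) (T d2)"
      by (simp only: Tcomm tauT d closed coadj_push[OF gs] push_add[symmetric])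
  next
    fix \<gamma>' \<delta>' d' e' assume \<gamma>': "\<gamma>' \<in> centroid_support L'" and \<delta>': "\<delta>' \<in> centroid_support L'"
      and d': "d' \<in> hcomp L' (T ` D) \<gamma>'" and e': "e' \<in> hcomp L' (T ` D) \<delta>'"
    obtain \<gamma> \<delta> where \<gamma>: "\<gamma> \<in> centroid_support L" "\<gamma>' = \<phi>\<^sub>e \<gamma>" and \<delta>: "\<delta> \<in> centroid_support L" "\<delta>' = \<phi>\<^sub>e \<delta>"
      using \<gamma>' \<delta>' support_image by blast
    obtain d e where d: "d \<in> hcomp L D \<gamma>" "d' = T d" and e: "e \<in> hcomp L D \<delta>" "e' = T e"
      using d' e' unfolding \<gamma>(2) \<delta>(2) T_hcomp[OF D] by blast
    have "\<tau> d e \<in> C_deg L D (\<gamma> + \<delta>)"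
      using \<tau> \<gamma>(1) \<delta>(1) d(1) e(1) unfolding invariant_cocycle_def by blast
    moreover have "d \<in> D" "e \<in> D" using d(1) e(1) by (simp_all add: hcomp_def)
    ultimately show "push_cocycle D \<tau> d' e' \<in> C_deg L' (T ` D) (\<gamma>' + \<delta>')"
      using push_C_deg[OF gs] tauT by (simp add: d(2) e(2) \<gamma>(2) \<delta>(2) flip: e_add)
  next
    fix d1 d2 d3 assume d: "d1 \<in> D" "d2 \<in> D" "d3 \<in> D"
    then have "\<tau> d1 d2 d3 = \<tau> d2 d3 d1" using \<tau> unfolding invariant_cocycle_def by blast
    then show "push_cocycle D \<tau> (T d1) (T d2) (T d3) = push_cocycle D \<tau> (T d2) (T d3) (T d1)"
      using d by (simp add: tauT push_T[OF D])
  next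
    fix d' e assume d': "d' \<in> hcomp L' (T ` D) 0" and e: "e \<in> D"
    then obtain d where d: "d \<in> hcomp L D 0" "d' = T d"
      using T_hcomp[OF D, of 0] by (auto simp: e_zero)
    then have "\<tau> d e = 0" "d \<in> D" using \<tau> e unfolding invariant_cocycle_def hcomp_def by blast+
    then show "push_cocycle D \<tau> d' (T e) = 0" using e by (simp add: d(2) tauT push_zero)
  qed
qed

definition "transport = (\<lambda>(D, \<tau>). (T ` D, push_cocycle D \<tau>))"

lemma transport_cocycle_pairs: "P \<in> cocycle_pairs L b \<Longrightarrow> transport P \<in> cocycle_pairs L' b'"
  unfolding cocycle_pairs_def transport_def
  using graded_subalgebra_T inj_ev_T invariant_cocycle_push by auto

lemma cocycle_pairsD:
  assumes "(D, \<tau>) \<in> cocycle_pairs L b"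
  shows "graded_subalgebra L b D" "D \<subseteq> A.derivs"
    "\<And>d e. d \<notin> D \<or> e \<notin> D \<Longrightarrow> \<tau> d e = 0" "\<And>d e k. k \<notin> D \<Longrightarrow> \<tau> d e k = 0"
proof -
  show gs: "graded_subalgebra L b D" using assms by (simp add: cocycle_pairs_def)
  then show "D \<subseteq> A.derivs" by (rule graded_subalgebra_derivs)
  show out: "\<tau> d e = 0" if "d \<notin> D \<or> e \<notin> D" for d e
    using assms that unfolding cocycle_pairs_def invariant_cocycle_def by blast
  show "\<tau> d e k = 0" if "k \<notin> D" for d e k
  proof (cases "d \<in> D \<and> e \<in> D")
    case True
    then have "\<tau> d e \<in> graded_dual L D"
      using assms unfolding cocycle_pairs_def invariant_cocycle_def by blast
    then show ?thesis using A.graded_dual_dual A.dual_space_out that by blast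
  qed (use out in auto)
qed

text \<open>T is injective on \<open>derivs\<close>, so D is recovered from its image and then
  \<tau> from its values. A preimage of a pair is its transport along the inverse isotopy; the
  factors a and 1/a cancel.\<close>

lemma bij_transport: "bij_betw transport (cocycle_pairs L b) (cocycle_pairs L' b')"
proof -
  interpret I: isotopy_form L' L "inv \<phi>" "inv_into QL \<phi>\<^sub>r" "inv \<phi>\<^sub>e" s_inv b' b "1 / a"
    by (rule isotopy_form_inverse)
  have "inj_on transport (cocycle_pairs L b)"
  proof (rule inj_onI)
    fix P P' assume P: "P \<in> cocycle_pairs L b" "P' \<in> cocycle_pairs L b" "transport P = transport P'"
    obtain D \<tau> D1 \<tau>1 where eq: "P = (D, \<tau>)" "P' = (D1, \<tau>1)" by (cases P, cases P')
    note D = cocycle_pairsD[OF P(1)[unfolded eq]] and D1 = cocycle_pairsD[OF P(2)[unfolded eq]]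
    have "T ` D = T ` D1" and push_cocycle: "push_cocycle D \<tau> = push_cocycle D1 \<tau>1" using P(3) by (simp_all add: transport_def eq)
    then have DD: "D1 = D" using T_inj D(2) D1(2) by (metis inj_on_image_eq_iff)
    have "\<tau> d e = \<tau>1 d e" for d e
    proof (cases "d \<in> D \<and> e \<in> D")
      case True
      then have "push D (\<tau> d e) = push D (\<tau>1 d e)" using push_cocycle_T[OF D(2)] push_cocycle DD by metis
      then show ?thesis using push_inject[OF D(2)] D(4) D1(4) DD by blast
    qed (use D(3) D1(3) DD in auto)
    then have "\<tau> = \<tau>1" by blast
    then show "P = P'" by (simp add: eq DD)
  qed
  moreover have "P \<in> transport ` cocycle_pairs L b" if P: "P \<in> cocycle_pairs L' b'" for P
  proof -
    obtain D' \<tau>' where eq: "P = (D', \<tau>')" by (cases P)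
    note D' = I.cocycle_pairsD[OF P[unfolded eq]]
    define D \<tau> where "D = T' ` D'" and "\<tau> = I.push_cocycle D' \<tau>'"
    have pair: "(D, \<tau>) \<in> cocycle_pairs L b"
      using I.transport_cocycle_pairs[OF P] by (simp add: eq I.transport_def D_def \<tau>_def T'_def)
    note D = cocycle_pairsD[OF pair]
    have TT': "T (T' d) = d" if "d \<in> D'" for d using T_T' D'(2) that by blast
    have img: "T ` D = D'" using TT' by (force simp: D_def)
    have "push_cocycle D \<tau> d e k = \<tau>' d e k" for d e k
    proof (cases "d \<in> D' \<and> e \<in> D' \<and> k \<in> D'")
      case True
      then have "push_cocycle D \<tau> (T (T' d)) (T (T' e)) (T (T' k)) = a * \<tau> (T' d) (T' e) (T' k)"
        using D(2) by (subst push_cocycle_T) (auto simp: D_def push_T)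
      also have "\<tau> (T' d) (T' e) (T' k) = 1 / a * \<tau>' d e k"
        using True unfolding \<tau>_def T'_def by (simp add: I.push_cocycle_T[OF D'(2)] I.push_T[OF D'(2)])
      finally show ?thesis using True TT' a_nonzero by simp
    next
      case False
      then have "push_cocycle D \<tau> d e k = 0" by (auto simp: push_cocycle_def img push_out)
      moreover have "\<tau>' d e k = 0" using False D'(3)[of d e] D'(4)[of k d e] by auto
      ultimately show ?thesis by simp
    qed
    then have "push_cocycle D \<tau> = \<tau>'" by blast
    then have "P = transport (D, \<tau>)" by (simp add: eq transport_def img)
    then show ?thesis using pair by blast
  qed
  ultimately show ?thesis using transport_cocycle_pairs unfolding bij_betw_def by blast
qed

subsection \<open>The isomorphism of extended affine Lie algebras\<close>

text \<open>The transpose of \<open>psi\<close> with respect to the form, restricted to D and set to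
  0 outside as for every functional here.\<close>

definition "kap D l d = (if d \<in> D then b (psi d) l else 0)"

lemma kap_C_deg:
  assumes gs: "graded_subalgebra L b D" and l: "\<alpha> \<in> QL" "l \<in> A.H \<alpha> \<kappa>"
  shows "kap D l \<in> C_deg L D \<kappa>"
proof -
  note D = graded_subalgebra_derivs[OF gs] and sub = A.graded_subalgebra_subspace[OF gs]
  have "kap D l \<in> dual_space L D"
  proof (rule A.dual_spaceI)
    show "kap D l (d + e) = kap D l d + kap D l e" if "d \<in> D" "e \<in> D" for d e
      using that A.F.subspace_add[OF sub that] psi_add[of d e] D
      by (simp add: kap_def A.form_rules(2)[OF form] subset_eq)
    show "kap D l (pointwise A.sc k d) = k * kap D l d" if "d \<in> D" for d k
      using that A.F.subspace_scale[OF sub that] psi_scale[of d] D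
      by (simp add: kap_def A.form_rules(6)[OF form] subset_eq)
  qed (simp add: kap_def)
  moreover have "kap D l d = 0" if "\<delta> \<noteq> - \<kappa>" "d \<in> hcomp L D \<delta>" for \<delta> d
  proof (rule ccontr)
    assume "kap D l d \<noteq> 0"
    then have "b (psi d) l \<noteq> 0" by (auto simp: kap_def split: if_splits)
    moreover have "psi d \<in> A.H 0 \<delta>" using psi_CDer_deg that(2) unfolding hcomp_def by blast
    ultimately have "\<kappa> = - \<delta>"
      using A.form_orthogonal(2)[OF form root_lattice_simps(1) l(1) _ l(2)] by blast
    then show False using that(1) by simp
  qed
  ultimately show ?thesis by (simp add: C_deg_def)
qed

lemma kap_add: "kap D (l + m) = kap D l + kap D m"
  and kap_scale: "kap D (A.sc k l) = pointwise (*) k (kap D l)"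
  by (auto simp: kap_def fun_eq_iff pointwise_apply A.form_rules(1,5)[OF form])

lemma kap_zero: "kap D 0 = 0"
  by (auto simp: kap_def fun_eq_iff A.form_rules(7)[OF form])

text \<open>The graded dual is spanned by parts with degree in the centroid support. If l has degree
  \<kappa> outside the support, then -\<kappa> is outside too, so the functional kills every
  component of D and is 0.\<close>

lemma kap_graded_dual:
  assumes gs: "graded_subalgebra L b D"
  shows "kap D l \<in> graded_dual L D"
proof (induction l rule: A.homog_induct)
  case zero
  show ?case unfolding kap_zero by (rule fun_space.subspace_0[OF A.subspace_graded_dual])
next
  case (homogeneous \<alpha> \<kappa> l)
  note C = kap_C_deg[OF gs homogeneous]
  interpret DD: dsum "pointwise A.sc" "centroid_support L" "hcomp L D" D
    by (rule A.graded_subalgebra_dsum[OF gs])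
  show ?case
  proof (cases "\<kappa> \<in> centroid_support L")
    case True
    then show ?thesis using C unfolding graded_dual_def by (intro fun_space.span_base) blast
  next
    case False
    then have ne: "\<delta> \<noteq> - \<kappa>" if "\<delta> \<in> centroid_support L" for \<delta>
      using A.uminus_in_support[OF that] by auto
    have "kap D l d = 0" for d
    proof (cases "d \<in> D")
      case True
      then show ?thesis
      proof (induction d rule: DD.dsum_induct)
        case zero
        show ?case
          using A.dual_space_scale[OF A.C_deg_dual[OF C] A.F.subspace_0[OF DD.subspace_W], of 0]
          by (simp only: A.F.scale_zero_left mult_zero_left)
      next
        case (homogeneous \<delta> d)
        then show ?case using A.C_deg_orthogonal[OF C _ ne] by blast
      next
        case (add d e)
        show ?case
          by (simp only: A.dual_space_add[OF A.C_deg_dual[OF C] add(1,2)] add add_0_left)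
      qed
    qed (simp add: kap_def)
    then have "kap D l = 0" by (simp add: fun_eq_iff)
    then show ?thesis by (simp only: fun_space.subspace_0[OF A.subspace_graded_dual])
  qed
next
  case (add l m)
  then show ?case unfolding kap_add by (intro fun_space.subspace_add[OF A.subspace_graded_dual])
qed

lemma push_surj:
  assumes gs: "graded_subalgebra L b D" and f': "f' \<in> graded_dual L' (T ` D)"
  obtains f where "f \<in> graded_dual L D" "push D f = f'"
proof -
  interpret I: isotopy_form L' L "inv \<phi>" "inv_into QL \<phi>\<^sub>r" "inv \<phi>\<^sub>e" s_inv b' b "1 / a"
    by (rule isotopy_form_inverse)
  note D = graded_subalgebra_derivs[OF gs] and gs' = graded_subalgebra_T[OF gs]
  have T'T: "T' (T d) = d" if "d \<in> D" for d using T'_T D that by blast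
  have img: "isotopy.T L' (inv \<phi>) s_inv ` T ` D = D" unfolding T'_def[symmetric] using T'T by force
  let ?f = "I.push (T ` D) f'"
  have f: "?f \<in> graded_dual L D" using I.push_graded_dual[OF gs' f'] unfolding img .
  have "push D ?f d' = f' d'" for d'
  proof (cases "d' \<in> T ` D")
    case True
    then obtain d where d: "d \<in> D" "d' = T d" by blast
    have "?f (T' d') = 1 / a * f' d'"
      unfolding T'_def by (rule I.push_T[OF I.graded_subalgebra_derivs[OF gs'] True])
    then show ?thesis using push_T[OF D d(1), of ?f] d T'T a_nonzero by simp
  next
    case False
    then show ?thesis using B.graded_dual_dual B.dual_space_out f' push_out by (metis subsetD)
  qed
  then show ?thesis using that f by blast
qed

text \<open>Pairing l + psi d with m + psi e produces, besides (l | m), the terms (l | psi e), (psi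
  d | m) and (psi d | psi e). The first two are cancelled by the \<open>kap\<close> terms of l and
  of m, the third by one half from each argument.\<close>

definition "cochi D d l f = f - kap D l - pointwise (*) (1 / 2) (kap D (psi d))"

definition "chi D = (\<lambda>(d, l, f). (T d, \<phi> (l + psi d), push D (cochi D d l f)))"

lemma cochi_graded_dual:
  "graded_subalgebra L b D \<Longrightarrow> cochi D d l f \<in> graded_dual L D \<longleftrightarrow> f \<in> graded_dual L D"
proof -
  assume gs: "graded_subalgebra L b D"
  let ?k = "kap D l + pointwise (*) (1 / 2) (kap D (psi d))"
  have k: "?k \<in> graded_dual L D"
    by (intro fun_space.subspace_add fun_space.subspace_scale A.subspace_graded_dual kap_graded_dual gs)
  have "cochi D d l f = f - ?k" "f = cochi D d l f + ?k" by (simp_all add: cochi_def)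
  then show ?thesis
    using fun_space.subspace_add[OF A.subspace_graded_dual _ k] fun_space.subspace_diff[OF A.subspace_graded_dual _ k]
    by metis
qed

lemma cochi_value:
  "k \<in> D \<Longrightarrow> cochi D d l f k = f k - b (psi k) l - 1 / 2 * b (psi k) (psi d)"
  by (simp add: cochi_def kap_def pointwise_apply)

text \<open>The map is triangular along D, L and the graded dual, with bijections T, \<phi> and
  \<open>push\<close> on the diagonal: d is recovered first, then l, then f.\<close>

lemma chi_bij:
  assumes gs: "graded_subalgebra L b D"
  shows "bij_betw (chi D) (D \<times> UNIV \<times> graded_dual L D) (T ` D \<times> UNIV \<times> graded_dual L' (T ` D))"
proof (rule bij_betw_imageI)
  note D = graded_subalgebra_derivs[OF gs]
  have out: "f d = 0" if "f \<in> graded_dual L D" "d \<notin> D" for f d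
    using that A.graded_dual_dual A.dual_space_out by blast
  show "inj_on (chi D) (D \<times> UNIV \<times> graded_dual L D)"
  proof (rule inj_onI)
    fix x y assume "x \<in> D \<times> UNIV \<times> graded_dual L D" "y \<in> D \<times> UNIV \<times> graded_dual L D" and eq: "chi D x = chi D y"
    then obtain d l f e m g where x: "x = (d, l, f)" "d \<in> D" "f \<in> graded_dual L D"
      and y: "y = (e, m, g)" "e \<in> D" "g \<in> graded_dual L D" by (cases x, cases y) blast
    have "T d = T e" using eq by (simp add: x y chi_def)
    then have de: "d = e" using x y D T_inj by (auto simp: inj_on_def)
    then have lm: "l = m" using eq by (simp add: x y chi_def)
    have "push D (cochi D d l f) = push D (cochi D d l g)" using eq by (simp add: x y chi_def de lm)
    moreover have "cochi D d l f \<in> graded_dual L D" "cochi D d l g \<in> graded_dual L D"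
      using cochi_graded_dual[OF gs] x y by simp_all
    ultimately have "cochi D d l f = cochi D d l g"
      using push_inject[OF D, of "cochi D d l f" "cochi D d l g"] out by simp
    then show "x = y" by (simp add: cochi_def x y de lm)
  qed
  show "chi D ` (D \<times> UNIV \<times> graded_dual L D) = T ` D \<times> UNIV \<times> graded_dual L' (T ` D)"
  proof (intro equalityI subsetI)
    fix y assume "y \<in> chi D ` (D \<times> UNIV \<times> graded_dual L D)"
    then show "y \<in> T ` D \<times> UNIV \<times> graded_dual L' (T ` D)"
      using push_graded_dual[OF gs] cochi_graded_dual[OF gs] by (auto simp: chi_def)
  next
    fix y assume "y \<in> T ` D \<times> (UNIV :: 'm set) \<times> graded_dual L' (T ` D)"
    then obtain d l' f' where y: "y = (T d, l', f')" "d \<in> D" "f' \<in> graded_dual L' (T ` D)" by auto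
    obtain g where g: "g \<in> graded_dual L D" "push D g = f'" by (rule push_surj[OF gs y(3)])
    define l where "l = inv \<phi> l' - psi d"
    define f where "f = g + kap D l + pointwise (*) (1 / 2) (kap D (psi d))"
    have fg: "cochi D d l f = g" by (simp add: cochi_def f_def)
    then have "f \<in> graded_dual L D" using cochi_graded_dual[OF gs] g(1) by metis
    moreover have "\<phi> (l + psi d) = l'" by (simp add: l_def)
    then have "y = chi D (d, l, f)" by (simp add: y chi_def fg g(2))
    ultimately show "y \<in> chi D ` (D \<times> UNIV \<times> graded_dual L D)" using y(2) by blast
  qed
qed

text \<open>All ingredients stay in degree 0: psi maps derivations of degree 0 into the component of
  root and degree zero, which \<phi> preserves because s 0 = 0.\<close>

lemma chi_cartan:
  assumes gs: "graded_subalgebra L b D"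
  shows "chi D ` (hcomp L D 0 \<times> A.H 0 0 \<times> C_deg L D 0) = hcomp L' (T ` D) 0 \<times> B.H 0 0 \<times> C_deg L' (T ` D) 0"
proof -
  note D = graded_subalgebra_derivs[OF gs]
  have Q0: "0 \<in> QL" by (rule root_lattice_simps)
  have h: "T ` hcomp L D 0 = hcomp L' (T ` D) 0" using T_hcomp[OF D, of 0] by (simp add: e_zero)
  have psi0: "psi d \<in> A.H 0 0" if "d \<in> hcomp L D 0" for d
    using that psi_CDer_deg unfolding hcomp_def by blast
  have k: "kap D l + pointwise (*) (1 / 2) (kap D (psi d)) \<in> C_deg L D 0" if "d \<in> hcomp L D 0" "l \<in> A.H 0 0" for d l
    by (intro fun_space.subspace_add fun_space.subspace_scale A.subspace_C_deg kap_C_deg[OF gs Q0] psi0 that)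
  have co: "cochi D d l f \<in> C_deg L D 0" if "d \<in> hcomp L D 0" "l \<in> A.H 0 0" "f \<in> C_deg L D 0" for d l f
    using fun_space.subspace_diff[OF A.subspace_C_deg that(3) k[OF that(1,2)]]
    by (simp add: cochi_def diff_diff_eq)
  show ?thesis
  proof (intro equalityI subsetI)
    fix y assume "y \<in> chi D ` (hcomp L D 0 \<times> A.H 0 0 \<times> C_deg L D 0)"
    then obtain d l f where d: "d \<in> hcomp L D 0" "l \<in> A.H 0 0" "f \<in> C_deg L D 0" "y = chi D (d, l, f)" by auto
    have "l + psi d \<in> A.H 0 0" by (rule A.V.subspace_add[OF A.H_subspace[OF Q0] d(2) psi0[OF d(1)]])
    moreover have "push D (cochi D d l f) \<in> C_deg L' (T ` D) 0"
      using push_C_deg[OF gs co[OF d(1-3)]] by (simp add: e_zero)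
    ultimately show "y \<in> hcomp L' (T ` D) 0 \<times> B.H 0 0 \<times> C_deg L' (T ` D) 0"
      using d(1) by (auto simp: d(4) chi_def h[symmetric] phi_H00[symmetric])
  next
    fix y assume "y \<in> hcomp L' (T ` D) 0 \<times> B.H 0 0 \<times> C_deg L' (T ` D) 0"
    then obtain d l0 f' where d: "d \<in> hcomp L D 0" "l0 \<in> A.H 0 0" "f' \<in> C_deg L' (T ` D) 0" "y = (T d, \<phi> l0, f')"
      unfolding h[symmetric] phi_H00[symmetric] by auto
    have "f' \<in> graded_dual L' (T ` D)"
      using d(3) B.zero_in_support unfolding graded_dual_def by (intro fun_space.span_base) blast
    then obtain g where g: "g \<in> graded_dual L D" "push D g = f'" by (rule push_surj[OF gs])
    \<comment> \<open>\<open>push_surj\<close> places g only in the graded dual; that it has degree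
      0 is read off from f' through \<open>push_T\<close>, as a is nonzero.\<close>
    have g0: "g \<in> C_deg L D 0"
      unfolding C_deg_def
    proof (intro CollectI conjI ballI impI)
      show "g \<in> dual_space L D" using g(1) A.graded_dual_dual by blast
      fix \<delta> e assume \<delta>: "\<delta> \<in> centroid_support L" "\<delta> \<noteq> - 0" "e \<in> hcomp L D \<delta>"
      have "T e \<in> hcomp L' (T ` D) (\<phi>\<^sub>e \<delta>)" using T_hcomp[OF D] \<delta>(3) by blast
      moreover have "\<phi>\<^sub>e \<delta> \<in> centroid_support L'" "\<phi>\<^sub>e \<delta> \<noteq> - 0"
        using \<delta>(1,2) support_image e_inject[of \<delta> 0] by (auto simp: e_zero)
      ultimately have "f' (T e) = 0" using B.C_deg_orthogonal[OF d(3)] by blast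
      moreover have "e \<in> D" using \<delta>(3) by (simp add: hcomp_def)
      ultimately show "g e = 0" using push_T[OF D, of e g] g(2) a_nonzero by simp
    qed
    define l where "l = l0 - psi d"
    have l: "l \<in> A.H 0 0"
      unfolding l_def by (rule A.V.subspace_diff[OF A.H_subspace[OF Q0] d(2) psi0[OF d(1)]])
    define f where "f = g + (kap D l + pointwise (*) (1 / 2) (kap D (psi d)))"
    have "f \<in> C_deg L D 0"
      unfolding f_def by (rule fun_space.subspace_add[OF A.subspace_C_deg g0 k[OF d(1) l]])
    moreover have "y = chi D (d, l, f)"
    proof -
      have "cochi D d l f = g" by (simp add: cochi_def f_def)
      then show ?thesis by (simp add: d(4) chi_def g(2) l_def)
    qed
    ultimately show "y \<in> chi D ` (hcomp L D 0 \<times> A.H 0 0 \<times> C_deg L D 0)" using d(1) l by blast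
  qed
qed

lemma chi_form:
  assumes gs: "graded_subalgebra L b D" and D: "d \<in> D" "e \<in> D"
  shows "eform (EALA L' b' (T ` D) \<tau>') (chi D (d, l, f)) (chi D (e, m, g)) =
    a * eform (EALA L b D \<tau>) (d, l, f) (e, m, g)"
proof -
  note push = push_T[OF graded_subalgebra_derivs[OF gs]]
  note r = A.form_rules(1,2)[OF form]
  have "b (psi e) l = b l (psi e)" "b (psi e) (psi d) = b (psi d) (psi e)"
    using A.form_rules(9)[OF form] by blast+
  then show ?thesis
    by (simp add: EALA_def chi_def push D form_phi cochi_value r algebra_simps)
qed

text \<open>The correction terms in \<^term>\<open>cochi\<close> are forced by the invariance of the form; the half
  cancels in the bracket because \<open>\<psi>\<close> satisfies \<open>\<psi> [d, e] = d (\<psi> e) - e (\<psi> d)\<close>.\<close>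

lemma chi_bracket:
  assumes gs: "graded_subalgebra L b D" and D: "d \<in> D" "e \<in> D"
  shows "chi D (ebracket (EALA L b D \<tau>) (d, l, f) (e, m, g)) =
    ebracket (EALA L' b' (T ` D) (push_cocycle D \<tau>)) (chi D (d, l, f)) (chi D (e, m, g))"
proof -
  note sub = graded_subalgebra_derivs[OF gs]
  note push = push_T[OF sub] and comm = A.graded_subalgebra_commutator[OF gs]
  have der: "d \<in> A.derivs" "e \<in> A.derivs" using D sub by auto
  then obtain M N where M: "A.mult d M" and N: "A.mult e N" unfolding A.derivs_def by blast
  note lin = A.linear_rules[OF A.mult_linear[OF M]] A.linear_rules[OF A.mult_linear[OF N]]
  have 1: "T (commutator d e) = commutator (T d) (T e)" by (rule T_commutator[OF der])
  have 2: "\<phi> (A.br l m + d m - e l + psi (commutator d e)) =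
      B.br (\<phi> (l + psi d)) (\<phi> (m + psi e)) + T d (\<phi> (m + psi e)) - T e (\<phi> (l + psi d))"
  proof -
    \<comment> \<open>Arranged so that d and e occur with their inner corrections, the shape
      produced by T. The mixed brackets with psi cancel, leaving the psi of the commutator.\<close>
    have eq: "A.br l m + d m - e l + psi (commutator d e) =
        A.br (l + psi d) (m + psi e) + (d (m + psi e) - A.br (psi d) (m + psi e)) -
        (e (l + psi d) - A.br (psi e) (l + psi d))"
      using A.br_anti[of l "psi e"]
      by (simp add: psi_commutator[OF der] A.br_linear lin br_psi_psi[OF der] br_psi_psi[OF der(2,1)])
    show ?thesis unfolding eq by (simp only: T_phi flip: phi_br phi_rules(1,2))
  qed
  have 3: "push D (cochi D (commutator d e) (A.br l m + d m - e l)
        (coadj D d g - coadj D e f + sigma b D l m + \<tau> d e)) =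
      coadj (T ` D) (T d) (push D (cochi D e m g)) - coadj (T ` D) (T e) (push D (cochi D d l f)) +
      sigma b' (T ` D) (\<phi> (l + psi d)) (\<phi> (m + psi e)) + push_cocycle D \<tau> (T d) (T e)" (is "?l = ?r")
  proof
    fix k'
    show "?l k' = ?r k'"
    proof (cases "k' \<in> T ` D")
      case False
      then show ?thesis by (simp add: push_out coadj_def sigma_def push_cocycle_def)
    next
      case True
      then obtain k where k: "k \<in> D" "k' = T k" by blast
      have kder: "k \<in> A.derivs" using k sub by blast
      then obtain K where K: "A.mult k K" unfolding A.derivs_def by blast
      note klin = A.linear_rules[OF A.mult_linear[OF K]]
      have skew: "b (d x) y = - b x (d y)" "b (e x) y = - b x (e y)" "b (k x) y = - b x (k y)" for x y
        using A.graded_subalgebra_skew[OF gs] D k(1) by simp_all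
      note fr = A.form_rules(1-8,11,12)[OF form]
      have inv: "b (A.br (psi k) x) y = b (psi k) (A.br x y)" for x y by (rule A.form_rules(10)[OF form])
      \<comment> \<open>By invariance this is, up to sign, the pairing of [psi k, psi e] with
        l.\<close>
      have inv': "b (psi k) (A.br l (psi e)) = 0"
      proof -
        have "b (psi k) (A.br l (psi e)) = - b (psi k) (A.br (psi e) l)"
          using A.br_anti[of l "psi e"] by (simp add: fr)
        also have "b (psi k) (A.br (psi e) l) = b (A.br (psi k) (psi e)) l"
          by (rule A.form_rules(10)[OF form, symmetric])
        finally show ?thesis by (simp add: br_psi_psi[OF kder der(2)] fr)
      qed
      have sym: "b (psi e) (k (psi d)) = - b (psi d) (k (psi e))" "b (psi e) (k l) = - b l (k (psi e))"
        using skew(3) A.form_rules(9)[OF form] by metis+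
      have lhs: "?l k' = a * (- g (commutator d k) + f (commutator e k) + b (k l) m + \<tau> d e k
          - b (psi k) (A.br l m + d m - e l) - 1 / 2 * b (psi k) (psi (commutator d e)))"
        using D k comm by (simp add: push cochi_value coadj_def sigma_def)
      have rhs: "?r k' = a * (- (g (commutator d k) - b (psi (commutator d k)) m
             - 1 / 2 * b (psi (commutator d k)) (psi e))
          + (f (commutator e k) - b (psi (commutator e k)) l - 1 / 2 * b (psi (commutator e k)) (psi d))
          + b (k (l + psi d) - A.br (psi k) (l + psi d)) (m + psi e) + \<tau> d e k)"
      proof -
        have "commutator (T d) (T k) = T (commutator d k)" "commutator (T e) (T k) = T (commutator e k)"
          using T_commutator der kder by simp_all
        then show ?thesis
          using D k comm push_cocycle_T[OF sub, of d e \<tau>]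
          by (simp add: push cochi_value coadj_def sigma_def T_phi form_phi algebra_simps)
      qed
      \<comment> \<open>The part free of f, g and \<tau>. Among the terms quadratic in psi, (k (psi
        d) | psi e) occurs on the right with coefficients -1/2, -1/2 and 1, which cancel; the other
        two match the left side by skewness of d and e.\<close>
      have eq: "- b (psi k) (A.br l m + d m - e l) - 1 / 2 * b (psi k) (psi (commutator d e)) + b (k l) m =
          b (psi (commutator d k)) m + 1 / 2 * b (psi (commutator d k)) (psi e)
          - b (psi (commutator e k)) l - 1 / 2 * b (psi (commutator e k)) (psi d)
          + b (k (l + psi d) - A.br (psi k) (l + psi d)) (m + psi e)"
        by (simp add: psi_commutator[OF der] psi_commutator[OF der(1) kder] psi_commutator[OF der(2) kder]
            A.br_linear klin fr inv inv' skew sym br_psi_psi[OF kder der(1)] field_simps)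
      \<comment> \<open>Stated for arbitrary scalars, so that the long expressions are matched as
        atoms and only \<open>eq\<close> has content.\<close>
      have cancel: "a * (- G + F + K + t - X - Y) = a * (- (G - x1 - x2) + (F - y1 - y2) + Z + t)"
        if "- X - Y + K = x1 + x2 - y1 - y2 + Z" for G F K t X Y x1 x2 y1 y2 Z :: 'f
      proof -
        have "- G + F + K + t - X - Y = (F - G + t) + (- X - Y + K)" by simp
        also have "\<dots> = - (G - x1 - x2) + (F - y1 - y2) + Z + t" unfolding that by simp
        finally show ?thesis by simp
      qed
      show ?thesis unfolding lhs rhs by (rule cancel[OF eq])
    qed
  qed
  show ?thesis
    by (simp add: EALA_def chi_def 1 2 3)
qed

lemma eala_isomorphic_transport:
  assumes gs: "graded_subalgebra L b D"
  shows "eala_isomorphic (EALA L b D \<tau>) (EALA L' b' (T ` D) (push_cocycle D \<tau>))"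
  unfolding eala_isomorphic_def
proof (intro exI[of _ "chi D"] exI[of _ a] conjI ballI a_nonzero)
  let ?E = "EALA L b D \<tau>" and ?E' = "EALA L' b' (T ` D) (push_cocycle D \<tau>)"
  note D = graded_subalgebra_derivs[OF gs]
  have car: "ecarrier ?E = D \<times> UNIV \<times> graded_dual L D"
    "ecarrier ?E' = T ` D \<times> UNIV \<times> graded_dual L' (T ` D)" by (simp_all add: EALA_def)
  show "bij_betw (chi D) (ecarrier ?E) (ecarrier ?E')" unfolding car by (rule chi_bij[OF gs])
  show "chi D ` ecartan ?E = ecartan ?E'" using chi_cartan[OF gs] by (simp add: EALA_def)
  show "chi D (ebracket ?E x y) = ebracket ?E' (chi D x) (chi D y)"
    if "x \<in> ecarrier ?E" "y \<in> ecarrier ?E" for x y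
    using that chi_bracket[OF gs] unfolding car by (cases x, cases y) auto
  show "eform ?E' (chi D x) (chi D y) = a * eform ?E x y"
    if "x \<in> ecarrier ?E" "y \<in> ecarrier ?E" for x y
    using that chi_form[OF gs] unfolding car by (cases x, cases y) auto
  show "lin_on (escale ?E) (escale ?E') (ecarrier ?E) (chi D)"
    unfolding lin_on_def
  proof (intro conjI ballI allI)
    fix x y k assume "x \<in> ecarrier ?E"
    then obtain d l f where x: "x = (d, l, f)" "d \<in> D" unfolding car by (cases x) auto
    have der: "d \<in> A.derivs" using x D by blast
    have "cochi D (pointwise A.sc k d) (A.sc k l) (pointwise (*) k f) = pointwise (*) k (cochi D d l f)"
      by (simp add: cochi_def psi_scale[OF der] kap_scale fun_eq_iff pointwise_apply algebra_simps)
    then show "chi D (escale ?E k x) = escale ?E' k (chi D x)"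
      by (simp add: x chi_def EALA_def T_scale[OF der] psi_scale[OF der] phi_rules push_scale B.V.scale_right_distrib)
    assume "y \<in> ecarrier ?E"
    then obtain e m g where y: "y = (e, m, g)" "e \<in> D" unfolding car by (cases y) auto
    have der': "e \<in> A.derivs" using y D by blast
    have "cochi D (d + e) (l + m) (f + g) = cochi D d l f + cochi D e m g"
      unfolding cochi_def psi_add[OF der der'] kap_add by (simp add: fun_eq_iff pointwise_apply algebra_simps)
    then have "push D (cochi D (d + e) (l + m) (f + g)) = push D (cochi D d l f) + push D (cochi D e m g)"
      by (simp only: push_add)
    moreover have "T (d + e) = T d + T e" by (rule T_add[OF der der'])
    moreover have "psi (d + e) = psi d + psi e" by (rule psi_add[OF der der'])
    ultimately show "chi D (x + y) = chi D x + chi D y"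
      unfolding x(1) y(1) chi_def by (simp only: split_conv add_Pair phi_rules add.commute add.left_commute add.assoc)
  qed
qed

end

lemma isotopy_if_isotopic:
  assumes "lie_torus L" "centreless L" "lie_torus L'" "centreless L'" "isotopic L L'"
  obtains \<phi> \<phi>\<^sub>r \<phi>\<^sub>e s where "isotopy L L' \<phi> \<phi>\<^sub>r \<phi>\<^sub>e s"
proof -
  obtain s where s: "group_hom_on (Qlat L) s" and "bi_isomorphic (regrade s L) L'"
    using assms(5) unfolding isotopic_def by blast
  then obtain \<phi> \<phi>\<^sub>r \<phi>\<^sub>e where
    "bij \<phi>" "Vector_Spaces.linear (lscale L) (lscale L') \<phi>"
    "\<And>x y. \<phi> (bracket L x y) = bracket L' (\<phi> x) (\<phi> y)"
    "bij_betw \<phi>\<^sub>r (Qlat L) (Qlat L')" "group_hom_on (Qlat L) \<phi>\<^sub>r" "bij \<phi>\<^sub>e" "group_hom_on UNIV \<phi>\<^sub>e"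
    and H: "\<And>\<alpha> \<kappa>. \<alpha> \<in> Qlat L \<Longrightarrow> \<phi> ` homog L \<alpha> (\<kappa> + s \<alpha>) = homog L' (\<phi>\<^sub>r \<alpha>) (\<phi>\<^sub>e \<kappa>)"
    unfolding bi_isomorphic_def regrade_def by auto
  moreover have "\<phi> ` homog L \<alpha> \<kappa> = homog L' (\<phi>\<^sub>r \<alpha>) (\<phi>\<^sub>e (\<kappa> - s \<alpha>))" if "\<alpha> \<in> Qlat L" for \<alpha> \<kappa>
    using H[OF that, of "\<kappa> - s \<alpha>"] by simp
  ultimately have "isotopy L L' \<phi> \<phi>\<^sub>r \<phi>\<^sub>e s"
    using assms s
    by (intro isotopy.intro isotopy_axioms.intro centreless_lie_torus.intro) simp_all
  then show ?thesis by (rule that)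
qed

text \<open>The form of \<open>L'\<close> pulls back to a form on \<open>L\<close> that is graded for the original grading too, as
  root spaces of non-opposite roots are orthogonal for every invariant form.\<close>

lemma (in isotopy) pullback_form:
  assumes b': "invariant_form L' b'"
  shows "invariant_form L (\<lambda>x y. b' (\<phi> x) (\<phi> y))"
proof -
  let ?b = "\<lambda>x y. b' (\<phi> x) (\<phi> y)"
  note r = B.form_rules[OF b']
  have hom: "?b x y = 0" if "\<kappa> + \<mu> \<noteq> 0" "\<alpha> \<in> QL" "x \<in> A.H \<alpha> \<kappa>" "\<beta> \<in> QL" "y \<in> A.H \<beta> \<mu>" for \<kappa> \<mu> \<alpha> \<beta> x y
  proof (rule ccontr)
    assume ne: "?b x y \<noteq> 0"
    have "\<beta> = - \<alpha>"
    proof (rule A.form_root_orthogonal[of ?b])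
      show "?b x (A.sc k y) = k * ?b x y" for x y k by (simp add: phi_rules r(5))
      show "?b x y = ?b y x" for x y by (rule r(9))
      show "?b (A.br x y) z = ?b x (A.br y z)" for x y z unfolding phi_br by (rule r(10))
    qed (use that ne in blast)+
    moreover have "\<phi>\<^sub>e (\<mu> - s \<beta>) = - \<phi>\<^sub>e (\<kappa> - s \<alpha>)"
      by (rule B.form_orthogonal(2)[OF b' r_in r_in phi_in_H phi_in_H ne]) (use that in blast)+
    \<comment> \<open>Opposite roots have opposite shifts, so s drops out and the original degrees
      are opposite.\<close>
    ultimately have "\<mu> + s \<alpha> = - (\<kappa> - s \<alpha>)"
      using group_hom_on_minus[OF s_hom subspace_root_lattice that(2)] by (simp flip: e_minus)
    then show False using that(1) by (simp add: algebra_simps eq_neg_iff_add_eq_0)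
  qed
  show ?thesis
    unfolding invariant_form_def
  proof (intro conjI allI impI ballI)
    show "Vector_Spaces.linear A.sc (*) (?b x)" for x
      by (simp add: linear_iff A.V.vector_space_axioms vector_space_mult phi_rules r(1,5))
    show "?b x y = ?b y x" for x y by (rule r(9))
    show "?b (A.br x y) z = ?b x (A.br y z)" for x y z unfolding phi_br by (rule r(10))
    show "x = 0" if "\<forall>y. ?b x y = 0" for x
    proof -
      have "\<forall>y. b' (\<phi> x) y = 0" using that by (metis phi_inv(2))
      then have "\<phi> x = 0" using b' unfolding invariant_form_def by blast
      then show ?thesis using phi_inject[of x 0] phi_rules(4) by simp
    qed
    fix \<kappa> \<mu> x y assume \<kappa>: "\<kappa> + \<mu> \<noteq> 0" and x: "x \<in> degree_space L \<kappa>" and y: "y \<in> degree_space L \<mu>"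
    interpret P: vector_space_pair A.sc "(*) :: 'f \<Rightarrow> 'f \<Rightarrow> 'f"
      by (simp add: vector_space_pair_def A.V.vector_space_axioms vector_space_mult)
    have lin: "Vector_Spaces.linear A.sc (*) (?b x)" "Vector_Spaces.linear A.sc (*) (\<lambda>x. ?b x y)" for x y
      by (simp_all add: linear_iff A.V.vector_space_axioms vector_space_mult phi_rules r(1,2,5,6))
    have "?b x y = 0" if x: "\<alpha> \<in> QL" "x \<in> A.H \<alpha> \<kappa>" for \<alpha> x
      by (rule P.linear_eq_0_on_span[OF lin(1) _ y[unfolded degree_space_def]]) (use hom[OF \<kappa> x] in blast)
    then show "?b x y = 0"
      by (intro P.linear_eq_0_on_span[OF lin(2) _ x[unfolded degree_space_def]]) blast
  qed
qed

theorem corollary6p3: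
  fixes L :: "('f::field_char_0, 'v::ab_group_add, 'g::ab_group_add, 'l::ab_group_add) graded_lie"
    and L' :: "('f, 'w::ab_group_add, 'h::ab_group_add, 'm::ab_group_add) graded_lie"
    and b :: "'l \<Rightarrow> 'l \<Rightarrow> 'f" and b' :: "'m \<Rightarrow> 'm \<Rightarrow> 'f"
  assumes "lie_torus L" and "centreless L" and "invariant_form L b"
    and "lie_torus L'" and "centreless L'" and "invariant_form L' b'"
    and "isotopic L L'"
  shows "\<exists>\<Phi>. bij_betw \<Phi> (cocycle_pairs L b) (cocycle_pairs L' b') \<and>
           (\<forall>D \<tau> D' \<tau>'. (D, \<tau>) \<in> cocycle_pairs L b \<and> \<Phi> (D, \<tau>) = (D', \<tau>') \<longrightarrow>
              eala_isomorphic (EALA L b D \<tau>) (EALA L' b' D' \<tau>'))"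
proof -
  obtain \<phi> \<phi>\<^sub>r \<phi>\<^sub>e s where "isotopy L L' \<phi> \<phi>\<^sub>r \<phi>\<^sub>e s"
    using isotopy_if_isotopic[OF assms(1,2,4,5,7)] by blast
  then interpret I: isotopy L L' \<phi> \<phi>\<^sub>r \<phi>\<^sub>e s .
  \<comment> \<open>The two forms are given independently, so a is the ratio of the pulled-back b'
    to b.\<close>
  obtain a where a: "a \<noteq> 0" "\<And>x y. b' (\<phi> x) (\<phi> y) = a * b x y"
    using I.A.form_unique[OF assms(3) I.pullback_form[OF assms(6)]] by blast
  interpret F: isotopy_form L L' \<phi> \<phi>\<^sub>r \<phi>\<^sub>e s b b' a
    using assms(3,6) a by (intro isotopy_form.intro isotopy_form_axioms.intro I.isotopy_axioms) simp_all
  show ?thesis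
  proof (intro exI[of _ F.transport] conjI allI impI)
    show "bij_betw F.transport (cocycle_pairs L b) (cocycle_pairs L' b')" by (rule F.bij_transport)
    fix D \<tau> D' \<tau>' assume "(D, \<tau>) \<in> cocycle_pairs L b \<and> F.transport (D, \<tau>) = (D', \<tau>')"
    then have gs: "graded_subalgebra L b D" and "D' = I.T ` D" "\<tau>' = F.push_cocycle D \<tau>"
      by (auto simp: cocycle_pairs_def F.transport_def)
    then show "eala_isomorphic (EALA L b D \<tau>) (EALA L' b' D' \<tau>')"
      using F.eala_isomorphic_transport by simp
  qed
qed

end
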